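(* In the setting described in the context, the following holds for all sufficiently small $r>0$: for every $\lambda$ with $0<\lambda\le1$, the set $$\Sigma(\lambda)=\bigcup_{0\le\lambda'<\lambda}\ \bigcup_{i=1}^N\{\lambda'\xi_i(\rho)+(1-\lambda')\pi_i(\rho):\rho\in\mathbb B_r(0)\}$$ is open in $\mathbb R^{2\times n}\times\mathbb R^{2\times n}$.
   Context: Let $n\ge2$, $N=2n+1$, $d=n(n-1)/2$. **Parametrization.** For $p\in\mathbb R^2$, $a\in\mathbb R^n$ put $p\otimes a=pa^T$. For $\mathbf x,\mathbf y,\mathbf z\in\mathbb R^{n-1}$ and $1\le r\le n$ let $\alpha_r(\mathbf x)=(x_1,\dots,x_{r-1},1,x_r,\dots,x_{n-1})^T\in\mathbb R^n$; let $b_r(\mathbf x,\mathbf y)=(y_1,\dots,y_{r-1},-(\mathbf x\cdot\mathbf y),y_r,\dots,y_{n-1})$ (a row vector); and let $\beta_r(\mathbf x,\mathbf y,\mathbf z)\in\mathbb R^{2\times n}$ be the matrix with rows $b_r(\mathbf x,\mathbf y)$ and $b_r(\mathbf x,\mathbf z)$. For $1\le i\le N$ let $r_i\in\{1,\dots,n\}$ with $r_i\equiv i \pmod n$. The $n\times n$ matrix $b_r(\mathbf x,\mathbf y)\otimes\alpha_r(\mathbf x)$ has $(j,k)$ entry $b_r(\mathbf x,\mathbf y)_j\,\alpha_r(\mathbf x)_k$ (it has trace $0$). For $X=(\mathbf x_1,\dots,\mathbf x_N)\in(\mathbb R^{n-1})^N$ let $\Delta=\det[\alpha_1(\mathbf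 x_1)\cdots\alpha_n(\mathbf x_n)]$, and let $T$ be the determinant of the linear map $\mathbb R^{n^2-1}\to\mathbb R^{n^2-1}$ sending $(\mathbf y_1,\dots,\mathbf y_{n+1})$ to the entries other than the $(1,1)$ entry of $\sum_{i=1}^{n+1}b_{r_i}(\mathbf x_i,\mathbf y_i)\otimes\alpha_{r_i}(\mathbf x_i)$. $\mathcal V$ is the set of $(P,X)$, $P=(p_{n+1},\dots,p_N)\in(\mathbb R^2)^{N-n}$, such that $\Delta\neq0$, $T\ne0$, $p_j\neq0$ for $n+1\le j\le N$, and the vectors $p_1,\dots,p_n\in\mathbb R^2$ uniquely determined by $\sum_{i=1}^Np_i\otimes\alpha_{r_i}(\mathbf x_i)=0$ are all nonzero. $\mathcal U$ is the set (open in $\mathbb R^{2nN}$) of $U=(P,X,Y,Z,b,\kappa_1,\dots,\kappa_N)$ with $(P,X)\in\mathcal V$, $Y=(\mathbf y_{n+2},\dots,\mathbf y_N)$, $Z=(\mathbf z_{n+2},\dots,\mathbf z_N)$, $\mathbf y_j,\mathbf z_j\in\mathbb R^{n-1}$, $b\in\mathbb R^{n-2}$, $\kappa_i>1$. For $U\in\mathcal U$: $p_1,\dots,p_n\in\mathbb R^2$ are the unique vectors satisfying $\sum_{i=1}^Np_i\otimes\alpha_{r_i}(\mathbf x_i)=0$, where $p_{n+1},\dots,p_N$ are the components of $P$; $\mathbf y_1,\dots,\mathbf y_{n+1}$ (resp. $\mathbf z_1,\dots,\mathbf z_{n+1}$) are the unique solutions of $\sum_{i=1}^Nb_{r_i}(\mathbf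 x_i,\mathbf y_i)\otimes\alpha_{r_i}(\mathbf x_i)=0$ (resp. with $\mathbf z_i$ in place of $\mathbf y_i$); $q(b)=(1,1,b_1,\dots,b_{n-2})^T$; and $a_i(U)=\alpha_{r_i}(\mathbf x_i)$, $B_i(U)=\beta_{r_i}(\mathbf x_i,\mathbf y_i,\mathbf z_i)$, $s_i(U)=a_i(U)\cdot q(b)$, $\gamma_i(U)=(p_i\otimes a_i(U),s_i(U)B_i(U))\in\mathbb R^{2\times n}\times\mathbb R^{2\times n}$, $\eta_i(U)=(\eta_i^1(U),\eta_i^2(U))=\gamma_1(U)+\cdots+\gamma_{i-1}(U)+\kappa_i\gamma_i(U)$; $\kappa_i(U)=\kappa_i$. **The function $F$.** $J(A)\in\mathbb R^d$ is the tuple of all $2\times2$ subdeterminants of $A\in\mathbb R^{2\times n}$; $v\,DJ(A)$ is the gradient of $A\mapsto v\cdot J(A)$. Let $U_0\in\mathcal U$, $c_i\in\mathbb R$, $d_i\in\mathbb R^d$ satisfy $c_j-c_i>\langle\eta_i^2(U_0),\eta_j^1(U_0)-\eta_i^1(U_0)\rangle+d_i\cdot J(\eta_j^1(U_0)-\eta_i^1(U_0))$ for all $i\neq j$. Let $F_0(A)=\frac\epsilon2|A|^2+G(A,J(A))$ with $\epsilon>0$ and $G\colon\mathbb R^{2\times n}\times\mathbb R^d\to\mathbb R$ smooth and convex such that at $(\eta_i^1(U_0),J(\eta_i^1(U_0)))$ one has $G=c_i$, $G_J=d_i$, $G_A=\eta_i^2(U_0)-\epsilon\eta_i^1(U_0)-d_iDJ(\eta_i^1(U_0))$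 for all $i$. Fix $\zeta\in C_c^\infty(B_1(0);[0,1])$ ($B_1(0)\subset\mathbb R^{2\times n}$ the unit ball) equal to $1$ at $0$ and such that the functions $V_{H,t}(A)=\frac12\zeta(A/t)\sum H^{ijpq}a_{ij}a_{pq}$ ($t>0$, $H$ a real tensor with $H^{ijpq}=H^{pqij}$, $1\le i,p\le2$, $1\le j,q\le n$) satisfy $V_{H,t}(0)=0$, $DV_{H,t}(0)=0$, $D^2V_{H,t}(0)=H$, $|D^2V_{H,t}|\le C_0|H|$ with $C_0$ independent of $H,t$. Let $r_0=\min_{i\ne j}|\eta_i^1(U_0)-\eta_j^1(U_0)|>0$. Given such tensors $H_1^0,\dots,H_N^0$, put $\tilde H_j=H_j^0-D^2F_0(\eta_j^1(U_0))$ and $F(A)=F_0(A)+\sum_{j=1}^NV_{\tilde H_j,r_0}(A-\eta_j^1(U_0))$. Put $\Phi(A,B)=DF(A)-B$ and $\Psi(\rho,U)=(\Phi(\rho+\eta_1(U)),\dots,\Phi(\rho+\eta_N(U)))\in\mathbb R^{2nN}$ for $\rho\in\mathbb R^{2\times n}\times\mathbb R^{2\times n}$, $U\in\mathcal U$ (so $\Psi(0,U_0)=0$). Assume $\det\frac{\partial\Psi}{\partial U}(0,U_0)\ne0$ and $\sum_j|\tilde H_j|<\epsilon/(2C_0)$. **Functions of $\rho$.** $\mathbb B_r(0)$ is the open ball of radius $r$ in $\mathbb R^{2\times n}\times\mathbb R^{2\times n}\cong\mathbb R^{4n}$ and $\bar{\mathbb B}_r(0)$ its closure. For small $r$ let $U\colon\bar{\mathbb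 B}_r(0)\to\mathcal U$ be the smooth function given by the implicit function theorem, with $U(0)=U_0$, $\Psi(\rho,U(\rho))=0$. Put $\xi_i(\rho)=\rho+\eta_i(U(\rho))$, $\pi_1(\rho)=\rho$, $\pi_{i+1}(\rho)=\pi_i(\rho)+\gamma_i(U(\rho))$, $z_i(\rho)=\kappa_i(U(\rho))\gamma_i(U(\rho))$ (so $\xi_i=\pi_i+z_i$). Assume: $\det D\pi_i\neq0$ on $\bar{\mathbb B}_r(0)$, each $\pi_i(\mathbb B_r(0))$ is open, and for $i\ne j$ the sets $\xi_i^1(\bar{\mathbb B}_r(0))$, $\xi_j^1(\bar{\mathbb B}_r(0))$ are disjoint and $\pi_i^1(\bar{\mathbb B}_r(0))$, $\pi_j^1(\bar{\mathbb B}_r(0))$ are disjoint (superscript $1$ = first $\mathbb R^{2\times n}$-component). Put $M_i(\rho)=(D\pi_i(\rho))^{-1}Dz_i(\rho)$ ($4n\times 4n$). Its characteristic polynomial has the form $\det[xI-M_i(\rho)]=x^{n+1}(x+1)^{2n}Q(\rho)(x)$ with $Q(\rho)$ monic of degree $n-1$ ($Q$ depends on $i$). Let $E_i(\rho)=\{x<-1:Q(\rho)(x)=0\}$. **Nondegeneracy at $0$.** Assume for every $i$: the discriminant of $Q(0)$ is nonzero, $Q(0)(-1)\neq0$, and $[\operatorname{adj}(x^0I-M_i(0))][\operatorname{adj}D\pi_i(0)]\,z_i(0)\ne0$ for every $x^0\in E_i(0)$ (adj = adjugate). *)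

theory Defs
  imports
    "HOL-Analysis.Analysis"
    "Jordan_Normal_Form.Char_Poly"
    "Subresultants.Resultant_Prelim"
begin

no_notation Matrix.vec_index (infixl "$" 100)

text \<open>
  The integer \<open>n\<close> is \<open>CARD('n)\<close> for an index type \<open>'n :: {card2, linorder}\<close>; the class
  \<^class>\<open>card2\<close> says \<open>CARD('n) \<ge> 2\<close>, and the order fixes the numbering of the coordinates
  of \<open>\<real>\<^sup>n\<close> by \<open>1, \<dots>, n\<close>.
\<close>

definition pos :: "'n::{finite,linorder} \<Rightarrow> nat" where
  "pos j = card {k. k \<le> j}"

definition elt :: "nat \<Rightarrow> 'n::{finite,linorder}" where
  "elt m = (THE j. pos j = m)"


section \<open>Calculus in Euclidean spaces\<close>

text \<open>A fixed enumeration of the standard basis, used to write linear maps as matrices. For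
  endomorphisms the determinant and the characteristic polynomial do not depend on it, and the
  adjugate is the matrix of a basis-independent endomorphism; for maps between different spaces of
  equal dimension only the sign of the determinant does.\<close>

definition basis_enum :: "nat \<Rightarrow> 'a::euclidean_space" where
  "basis_enum = (SOME e. bij_betw e {..<DIM('a)} Basis)"

definition lin_mat :: "('a::euclidean_space \<Rightarrow> 'b::euclidean_space) \<Rightarrow> real Matrix.mat" where
  "lin_mat L = Matrix.mat DIM('b) DIM('a) (\<lambda>(i, j). L (basis_enum j) \<bullet> basis_enum i)"

definition coord_vec :: "'a::euclidean_space \<Rightarrow> real Matrix.vec" where
  "coord_vec v = Matrix.vec DIM('a) (\<lambda>i. v \<bullet> basis_enum i)"

text \<open>\<open>Ck_on k S f\<close>: \<open>f\<close> is \<open>k\<close> times continuously differentiable on the open set \<open>S\<close>.\<close>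

primrec Ck_on :: "nat \<Rightarrow> 'a::euclidean_space set \<Rightarrow> ('a \<Rightarrow> 'b::real_normed_vector) \<Rightarrow> bool" where
  "Ck_on 0 S f = continuous_on S f"
| "Ck_on (Suc k) S f =
     ((\<forall>x\<in>S. f differentiable (at x)) \<and>
      (\<forall>b\<in>Basis. Ck_on k S (\<lambda>x. frechet_derivative f (at x) b)))"

definition smooth_on :: "'a::euclidean_space set \<Rightarrow> ('a \<Rightarrow> 'b::real_normed_vector) \<Rightarrow> bool" where
  "smooth_on S f \<longleftrightarrow> (\<forall>k. Ck_on k S f)"

definition grad :: "('a::euclidean_space \<Rightarrow> real) \<Rightarrow> 'a \<Rightarrow> 'a" where
  "grad f x = (\<Sum>b\<in>Basis. frechet_derivative f (at x) b *\<^sub>R b)"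

text \<open>Tensors \<open>H\<^sup>i\<^sup>j\<^sup>p\<^sup>q\<close> are written \<open>H $ i $ j $ p $ q\<close>; the norm of the type is
  the Euclidean norm of the array of entries.\<close>

type_synonym 'n tensor4 = "real^'n^2^'n^2"

definition hessian :: "(real^'n^2 \<Rightarrow> real) \<Rightarrow> real^'n^2 \<Rightarrow> 'n tensor4" where
  "hessian f A = (\<chi> i j p q.
     frechet_derivative (\<lambda>B. frechet_derivative f (at B) (axis p (axis q 1))) (at A)
       (axis i (axis j 1)))"

definition sym_tensor :: "'n::finite tensor4 \<Rightarrow> bool" where
  "sym_tensor H \<longleftrightarrow> (\<forall>i j p q. H $ i $ j $ p $ q = H $ p $ q $ i $ j)"

definition poly_discr :: "'a::field poly \<Rightarrow> 'a" where
  "poly_discr p = (-1) ^ (degree p * (degree p - 1) div 2) * resultant p (pderiv p) / lead_coeff p"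


section \<open>Index types and parameters\<close>

text \<open>Index type \<open>{1, \<dots>, n - 1}\<close>, so that \<open>\<real>\<^sup>n\<^sup>-\<^sup>1\<close> is \<open>real^('n red)\<close>.\<close>

typedef (overloaded) ('n::card2) red = "{1..CARD('n) - 1}"
proof
  show "1 \<in> {1..CARD('n) - 1}"
    using one_less_card[where 'a='n] by simp
qed

instance red :: (card2) finite
proof
  have "(UNIV :: 'a red set) = Abs_red ` {1..CARD('a) - 1}"
    using type_definition.Abs_image[OF type_definition_red] by metis
  then show "finite (UNIV :: 'a red set)"
    by (metis finite_atLeastAtMost finite_imageI)
qed

text \<open>Index type of the \<open>d = n (n - 1) / 2\<close> column pairs of a \<open>2 \<times> n\<close> matrix.\<close>

typedef (overloaded) ('n::"{card2,linorder}") minor = "{(j, k). j < (k::'n)}"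
proof -
  obtain a b :: 'n where "a \<noteq> b"
    using one_less_card[where 'a='n]
    by (metis (full_types) One_nat_def card_1_singleton_iff UNIV_eq_I less_irrefl singleton_iff)
  then have "(a, b) \<in> {(j, k). j < k} \<or> (b, a) \<in> {(j, k). j < k}"
    by auto
  then show ?thesis
    by blast
qed

instance minor :: ("{card2,linorder}") finite
proof
  have "(UNIV :: 'a minor set) = Abs_minor ` {(j, k). j < k}"
    using type_definition.Abs_image[OF type_definition_minor] by metis
  then show "finite (UNIV :: 'a minor set)"
    by (metis finite finite_imageI)
qed

lemma card_minor: "CARD(('n::{card2,linorder}) minor) = CARD('n) * (CARD('n) - 1) div 2"
proof -
  let ?L = "{(j, k). j < (k::'n)}" and ?G = "{(j, k). k < (j::'n)}"
    and ?D = "range (\<lambda>j::'n. (j, j))"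
  have UN: "(UNIV :: ('n \<times> 'n) set) = (?L \<union> ?G) \<union> ?D"
    by auto
  have "card ((?L \<union> ?G) \<union> ?D) = card (?L \<union> ?G) + card ?D"
    by (rule card_Un_disjoint) auto
  moreover have "card (?L \<union> ?G) = card ?L + card ?G"
    by (rule card_Un_disjoint) auto
  moreover have "card ?D = CARD('n)"
    by (rule card_image) (auto intro: inj_onI)
  moreover have "card ?G = card ?L"
    by (rule bij_betw_same_card[where f=prod.swap], rule bij_betwI[where g=prod.swap]) auto
  ultimately have "card (UNIV :: ('n \<times> 'n) set) = 2 * card ?L + CARD('n)"
    unfolding UN by linarith
  then have "CARD('n) * CARD('n) = 2 * card ?L + CARD('n)"
    by (simp only: card_cartesian_product UNIV_Times_UNIV[symmetric])
  then have "CARD('n) * (CARD('n) - 1) = 2 * card ?L"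
    by (simp add: diff_mult_distrib2)
  then have "card ?L = CARD('n) * (CARD('n) - 1) div 2"
    by linarith
  then show ?thesis
    using type_definition.card[OF type_definition_minor[where 'n='n]] by simp
qed

text \<open>The scalar coordinates of \<open>U = (P, X, Y, Z, b, \<kappa>)\<close>, giving \<open>\<real>\<^sup>2\<^sup>n\<^sup>N\<close> as
  \<open>real^('n param)\<close>, where \<open>N = 2 n + 1\<close>.\<close>

datatype 'k coord =
  CP nat 2 | CX nat 'k | CY nat 'k | CZ nat 'k | Cb nat | CK nat

definition coords :: "('n::card2) red coord set" where
  "coords = (let n = CARD('n); N = 2 * n + 1 in
     {CP j c | j c. j \<in> {n+1..N}} \<union> {CX i k | i k. i \<in> {1..N}} \<union>
     {CY j k | j k. j \<in> {n+2..N}} \<union> {CZ j k | j k. j \<in> {n+2..N}} \<union>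
     {Cb k | k. k \<in> {1..n-2}} \<union> {CK i | i. i \<in> {1..N}})"

lemma card_red: "CARD(('n::card2) red) = CARD('n) - 1"
  using type_definition.card[OF type_definition_red[where 'n='n]] by simp

lemma coords_eq:
  "(coords :: ('n::card2) red coord set) =
     (\<lambda>(j, c). CP j c) ` ({CARD('n)+1..2*CARD('n)+1} \<times> UNIV) \<union>
     (\<lambda>(i, k). CX i k) ` ({1..2*CARD('n)+1} \<times> UNIV) \<union>
     (\<lambda>(j, k). CY j k) ` ({CARD('n)+2..2*CARD('n)+1} \<times> UNIV) \<union>
     (\<lambda>(j, k). CZ j k) ` ({CARD('n)+2..2*CARD('n)+1} \<times> UNIV) \<union>
     Cb ` {1..CARD('n)-2} \<union> CK ` {1..2*CARD('n)+1}"
  unfolding coords_def Let_def by (intro arg_cong2[where f="(\<union>)"]) auto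

lemma finite_coords: "finite (coords :: ('n::card2) red coord set)"
  unfolding coords_eq by simp

lemma card_coords:
  "card (coords :: ('n::card2) red coord set) = 2 * CARD('n) * (2 * CARD('n) + 1)"
proof -
  obtain m where m: "CARD('n) = m + 2"
    using one_less_card[where 'a='n] by (intro that[of "CARD('n) - 2"]) simp
  have r: "CARD('n red) = m + 1"
    using m by (simp add: card_red)
  let ?N = "2 * CARD('n) + 1"
  let ?P = "(\<lambda>(j, c). CP j c) ` ({CARD('n)+1..?N} \<times> UNIV) :: 'n red coord set"
  let ?X = "(\<lambda>(i, k). CX i k) ` ({1..?N} \<times> UNIV) :: 'n red coord set"
  let ?Y = "(\<lambda>(j, k). CY j k) ` ({CARD('n)+2..?N} \<times> UNIV) :: 'n red coord set"
  let ?Z = "(\<lambda>(j, k). CZ j k) ` ({CARD('n)+2..?N} \<times> UNIV) :: 'n red coord set"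
  let ?b = "Cb ` {1..CARD('n)-2} :: 'n red coord set"
  let ?K = "CK ` {1..?N} :: 'n red coord set"
  have c1: "card (?P \<union> ?X \<union> ?Y \<union> ?Z \<union> ?b \<union> ?K) = card (?P \<union> ?X \<union> ?Y \<union> ?Z \<union> ?b) + card ?K"
    by (rule card_Un_disjoint) auto
  have c2: "card (?P \<union> ?X \<union> ?Y \<union> ?Z \<union> ?b) = card (?P \<union> ?X \<union> ?Y \<union> ?Z) + card ?b"
    by (rule card_Un_disjoint) auto
  have c3: "card (?P \<union> ?X \<union> ?Y \<union> ?Z) = card (?P \<union> ?X \<union> ?Y) + card ?Z"
    by (rule card_Un_disjoint) auto
  have c4: "card (?P \<union> ?X \<union> ?Y) = card (?P \<union> ?X) + card ?Y"
    by (rule card_Un_disjoint) auto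
  have c5: "card (?P \<union> ?X) = card ?P + card ?X"
    by (rule card_Un_disjoint) auto
  have P: "card ?P = card ({CARD('n)+1..?N} \<times> (UNIV :: 2 set))"
    by (rule card_image) (auto intro: inj_onI)
  have X: "card ?X = card ({1..?N} \<times> (UNIV :: 'n red set))"
    by (rule card_image) (auto intro: inj_onI)
  have Y: "card ?Y = card ({CARD('n)+2..?N} \<times> (UNIV :: 'n red set))"
    by (rule card_image) (auto intro: inj_onI)
  have Z: "card ?Z = card ({CARD('n)+2..?N} \<times> (UNIV :: 'n red set))"
    by (rule card_image) (auto intro: inj_onI)
  have b: "card ?b = card {1..CARD('n)-2}"
    by (rule card_image) (auto intro: inj_onI)
  have K: "card ?K = card {1..?N}"
    by (rule card_image) (auto intro: inj_onI)
  show ?thesis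
    unfolding coords_eq c1 c2 c3 c4 c5 P X Y Z b K card_cartesian_product r
    by (simp add: m algebra_simps)
qed

typedef (overloaded) ('n::card2) param = "coords :: 'n red coord set"
proof
  show "CK 1 \<in> (coords :: 'n red coord set)"
    unfolding coords_def Let_def by auto
qed

instance param :: (card2) finite
proof
  have "(UNIV :: 'a param set) = Abs_param ` coords"
    using type_definition.Abs_image[OF type_definition_param] by metis
  then show "finite (UNIV :: 'a param set)"
    by (metis finite_coords finite_imageI)
qed

lemma card_param: "CARD(('n::card2) param) = 2 * CARD('n) * (2 * CARD('n) + 1)"
  using type_definition.card[OF type_definition_param[where 'n='n]] by (simp add: card_coords)

type_synonym 'n rn = "real^'n"
type_synonym 'n rvec = "real^'n red"
type_synonym 'n mat2 = "real^'n^2"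
type_synonym 'n space = "(real^'n^2) \<times> (real^'n^2)"
type_synonym 'n pspace = "real^'n param"

definition P_of :: "('n::card2) pspace \<Rightarrow> nat \<Rightarrow> real^2" where
  "P_of U j = (\<chi> c. U $ Abs_param (CP j c))"
definition X_of :: "('n::card2) pspace \<Rightarrow> nat \<Rightarrow> 'n rvec" where
  "X_of U i = (\<chi> k. U $ Abs_param (CX i k))"
definition Y_of :: "('n::card2) pspace \<Rightarrow> nat \<Rightarrow> 'n rvec" where
  "Y_of U j = (\<chi> k. U $ Abs_param (CY j k))"
definition Z_of :: "('n::card2) pspace \<Rightarrow> nat \<Rightarrow> 'n rvec" where
  "Z_of U j = (\<chi> k. U $ Abs_param (CZ j k))"
definition b_of :: "('n::card2) pspace \<Rightarrow> nat \<Rightarrow> real" where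
  "b_of U k = U $ Abs_param (Cb k)"
definition kappa :: "('n::card2) pspace \<Rightarrow> nat \<Rightarrow> real" where
  "kappa U i = U $ Abs_param (CK i)"


section \<open>The parametrization\<close>

definition tensor :: "real^'m \<Rightarrow> real^'n \<Rightarrow> real^'n^'m" where
  "tensor p a = (\<chi> i j. p $ i * a $ j)"

text \<open>The \<open>r \<in> {1, \<dots>, n}\<close> congruent to \<open>i \<ge> 1\<close> modulo \<open>n\<close>.\<close>

definition res :: "nat \<Rightarrow> nat \<Rightarrow> nat" where
  "res n i = (i - 1) mod n + 1"

definition alpha :: "nat \<Rightarrow> ('n::{card2,linorder}) rvec \<Rightarrow> 'n rn" where
  "alpha r x = (\<chi> j. if pos j < r then x $ Abs_red (pos j)
                     else if pos j = r then 1
                     else x $ Abs_red (pos j - 1))"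

definition brow :: "nat \<Rightarrow> ('n::{card2,linorder}) rvec \<Rightarrow> 'n rvec \<Rightarrow> 'n rn" where
  "brow r x y = (\<chi> j. if pos j < r then y $ Abs_red (pos j)
                      else if pos j = r then - (x \<bullet> y)
                      else y $ Abs_red (pos j - 1))"

definition beta :: "nat \<Rightarrow> ('n::{card2,linorder}) rvec \<Rightarrow> 'n rvec \<Rightarrow> 'n rvec \<Rightarrow> 'n mat2" where
  "beta r x y z = vector [brow r x y, brow r x z]"

definition p_sum :: "(nat \<Rightarrow> real^2) \<Rightarrow> (nat \<Rightarrow> ('n::{card2,linorder}) rvec) \<Rightarrow> 'n mat2" where
  "p_sum p X = (\<Sum>i = 1..2 * CARD('n) + 1. tensor (p i) (alpha (res CARD('n) i) (X i)))"

definition b_sum ::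
  "nat set \<Rightarrow> (nat \<Rightarrow> ('n::{card2,linorder}) rvec) \<Rightarrow> (nat \<Rightarrow> 'n rvec) \<Rightarrow> ('n rn, 'n) Finite_Cartesian_Product.vec" where
  "b_sum I X y = (\<Sum>i\<in>I. tensor (brow (res CARD('n) i) (X i) (y i)) (alpha (res CARD('n) i) (X i)))"

definition Delta :: "(nat \<Rightarrow> ('n::{card2,linorder}) rvec) \<Rightarrow> real" where
  "Delta X = Determinants.det (\<chi> j k. (alpha (pos k) (X (pos k)) :: 'n rn) $ j)"

text \<open>Matrix of \<open>(y\<^sub>1, \<dots>, y\<^sub>n\<^sub>+\<^sub>1) \<mapsto> \<close> entries other than \<open>(1,1)\<close>. Column \<open>c\<close> belongs to
  component \<open>c mod (n - 1) + 1\<close> of the block with index \<open>c div (n - 1) + 1\<close>. Row \<open>l\<close> belongs to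
  the entry with row-major position \<open>l + 1\<close>; position \<open>0\<close> is the omitted \<open>(1,1)\<close> entry.\<close>

definition Tdet :: "(nat \<Rightarrow> ('n::{card2,linorder}) rvec) \<Rightarrow> real" where
  "Tdet X = (let n = CARD('n) in
     Determinant.det (Matrix.mat (n\<^sup>2 - 1) (n\<^sup>2 - 1) (\<lambda>(l, c).
       b_sum {1..n+1} X
         (\<lambda>i. if i = c div (n - 1) + 1 then axis (Abs_red (c mod (n - 1) + 1)) 1 else 0)
       $ elt ((l + 1) div n + 1) $ elt ((l + 1) mod n + 1))))"

text \<open>The completed families \<open>(p\<^sub>1, \<dots>, p\<^sub>N)\<close> and \<open>(y\<^sub>1, \<dots>, y\<^sub>N)\<close>, set to \<open>0\<close> outside
  \<open>{1..N}\<close> so that the descriptions are unique.\<close>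

definition p_all ::
  "(nat \<Rightarrow> real^2) \<Rightarrow> (nat \<Rightarrow> ('n::{card2,linorder}) rvec) \<Rightarrow> nat \<Rightarrow> real^2" where
  "p_all P X = (THE p.
     (\<forall>j\<in>{CARD('n)+1..2 * CARD('n) + 1}. p j = P j) \<and>
     (\<forall>j. j \<notin> {1..2 * CARD('n) + 1} \<longrightarrow> p j = 0) \<and> p_sum p X = 0)"

definition y_all ::
  "(nat \<Rightarrow> ('n::{card2,linorder}) rvec) \<Rightarrow> (nat \<Rightarrow> 'n rvec) \<Rightarrow> nat \<Rightarrow> 'n rvec" where
  "y_all X Y = (THE y.
     (\<forall>j\<in>{CARD('n)+2..2 * CARD('n) + 1}. y j = Y j) \<and>
     (\<forall>j. j \<notin> {1..2 * CARD('n) + 1} \<longrightarrow> y j = 0) \<and> b_sum {1..2 * CARD('n) + 1} X y = 0)"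

definition calV :: "((nat \<Rightarrow> real^2) \<times> (nat \<Rightarrow> ('n::{card2,linorder}) rvec)) set" where
  "calV = {(P, X). Delta X \<noteq> 0 \<and> Tdet X \<noteq> 0 \<and>
     (\<forall>j\<in>{CARD('n)+1..2 * CARD('n) + 1}. P j \<noteq> 0) \<and>
     (\<forall>i\<in>{1..CARD('n)}. p_all P X i \<noteq> 0)}"

definition calU :: "('n::{card2,linorder}) pspace set" where
  "calU = {U. (P_of U, X_of U) \<in> calV \<and> (\<forall>i\<in>{1..2 * CARD('n) + 1}. kappa U i > 1)}"

definition qvec :: "('n::{card2,linorder}) pspace \<Rightarrow> 'n rn" where
  "qvec U = (\<chi> j. if pos j \<le> 2 then 1 else b_of U (pos j - 2))"

definition avec :: "('n::{card2,linorder}) pspace \<Rightarrow> nat \<Rightarrow> 'n rn" where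
  "avec U i = alpha (res CARD('n) i) (X_of U i)"

definition Bmat :: "('n::{card2,linorder}) pspace \<Rightarrow> nat \<Rightarrow> 'n mat2" where
  "Bmat U i = beta (res CARD('n) i) (X_of U i) (y_all (X_of U) (Y_of U) i) (y_all (X_of U) (Z_of U) i)"

definition svec :: "('n::{card2,linorder}) pspace \<Rightarrow> nat \<Rightarrow> real" where
  "svec U i = avec U i \<bullet> qvec U"

definition gamma :: "('n::{card2,linorder}) pspace \<Rightarrow> nat \<Rightarrow> 'n space" where
  "gamma U i = (tensor (p_all (P_of U) (X_of U) i) (avec U i), svec U i *\<^sub>R Bmat U i)"

definition eta :: "('n::{card2,linorder}) pspace \<Rightarrow> nat \<Rightarrow> 'n space" where
  "eta U i = (\<Sum>k = 1..<i. gamma U k) + kappa U i *\<^sub>R gamma U i"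


section \<open>The function \<open>F\<close>\<close>

definition Jmin :: "('n::{card2,linorder}) mat2 \<Rightarrow> real^'n minor" where
  "Jmin A = (\<chi> m. let (j, k) = Rep_minor m in A $ 1 $ j * A $ 2 $ k - A $ 1 $ k * A $ 2 $ j)"

definition vDJ :: "real^'n minor \<Rightarrow> ('n::{card2,linorder}) mat2 \<Rightarrow> 'n mat2" where
  "vDJ v = grad (\<lambda>A. v \<bullet> Jmin A)"

definition F0_of ::
  "real \<Rightarrow> (('n::{card2,linorder}) mat2 \<times> (real^'n minor) \<Rightarrow> real) \<Rightarrow> 'n mat2 \<Rightarrow> real" where
  "F0_of \<epsilon> G A = \<epsilon> / 2 * (norm A)\<^sup>2 + G (A, Jmin A)"

definition Vfun :: "('n::finite mat2 \<Rightarrow> real) \<Rightarrow> 'n tensor4 \<Rightarrow> real \<Rightarrow> 'n mat2 \<Rightarrow> real" where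
  "Vfun \<zeta> H t A = 1 / 2 * \<zeta> (A /\<^sub>R t) *
     (\<Sum>i\<in>UNIV. \<Sum>j\<in>UNIV. \<Sum>p\<in>UNIV. \<Sum>q\<in>UNIV. H $ i $ j $ p $ q * A $ i $ j * A $ p $ q)"

definition cutoff :: "('n::finite mat2 \<Rightarrow> real) \<Rightarrow> real \<Rightarrow> bool" where
  "cutoff \<zeta> C\<^sub>0 \<longleftrightarrow>
     smooth_on UNIV \<zeta> \<and> range \<zeta> \<subseteq> {0..1} \<and> closure {A. \<zeta> A \<noteq> 0} \<subseteq> ball 0 1 \<and> \<zeta> 0 = 1 \<and>
     (\<forall>H t. sym_tensor H \<and> t > 0 \<longrightarrow>
        Vfun \<zeta> H t 0 = 0 \<and> grad (Vfun \<zeta> H t) 0 = 0 \<and> hessian (Vfun \<zeta> H t) 0 = H \<and>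
        (\<forall>A. norm (hessian (Vfun \<zeta> H t) A) \<le> C\<^sub>0 * norm H))"

definition sep_radius :: "('n::{card2,linorder}) pspace \<Rightarrow> real" where
  "sep_radius U0 = Min {norm (fst (eta U0 i) - fst (eta U0 j)) | i j.
     i \<in> {1..2 * CARD('n) + 1} \<and> j \<in> {1..2 * CARD('n) + 1} \<and> i \<noteq> j}"

definition Htilde ::
  "('n::{card2,linorder} mat2 \<Rightarrow> real) \<Rightarrow> 'n pspace \<Rightarrow> (nat \<Rightarrow> 'n tensor4) \<Rightarrow> nat \<Rightarrow> 'n tensor4" where
  "Htilde F0 U0 H0 j = H0 j - hessian F0 (fst (eta U0 j))"

definition F_of ::
  "('n::{card2,linorder} mat2 \<Rightarrow> real) \<Rightarrow> ('n mat2 \<Rightarrow> real) \<Rightarrow> 'n pspace \<Rightarrow> (nat \<Rightarrow> 'n tensor4)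
    \<Rightarrow> 'n mat2 \<Rightarrow> real" where
  "F_of F0 \<zeta> U0 H0 A = F0 A +
     (\<Sum>j = 1..2 * CARD('n) + 1.
        Vfun \<zeta> (Htilde F0 U0 H0 j) (sep_radius U0) (A - fst (eta U0 j)))"

definition Phi :: "('n::finite mat2 \<Rightarrow> real) \<Rightarrow> 'n space \<Rightarrow> 'n mat2" where
  "Phi F = (\<lambda>(A, B). grad F A - B)"

text \<open>The \<open>i\<close>-th block, \<open>1 \<le> i \<le> N\<close>, of \<open>\<Psi>(\<rho>, U)\<close>.\<close>

definition Psi ::
  "('n::{card2,linorder} mat2 \<Rightarrow> real) \<Rightarrow> 'n space \<Rightarrow> 'n pspace \<Rightarrow> nat \<Rightarrow> 'n mat2" where
  "Psi F \<rho> U i = Phi F (\<rho> + eta U i)"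

text \<open>The Jacobian matrix \<open>\<partial>\<Psi>/\<partial>U\<close> of size \<open>2 n N\<close>: rows are grouped in \<open>N\<close> blocks of
  length \<open>2 n\<close>, and \<open>2 n N\<close> is the dimension of the space of \<open>U\<close>.\<close>

definition dPsi_dU ::
  "('n::{card2,linorder} mat2 \<Rightarrow> real) \<Rightarrow> 'n space \<Rightarrow> 'n pspace \<Rightarrow> real Matrix.mat" where
  "dPsi_dU F \<rho> U = (let m = 2 * CARD('n); N = 2 * CARD('n) + 1 in
     Matrix.mat (m * N) (m * N) (\<lambda>(l, c).
       frechet_derivative (\<lambda>U. Psi F \<rho> U (l div m + 1)) (at U) (basis_enum c)
         \<bullet> basis_enum (l mod m)))"


section \<open>Functions of \<open>\<rho>\<close>\<close>

text \<open>\<open>Uf\<close> is the implicit function \<open>\<rho> \<mapsto> U(\<rho>)\<close>.\<close>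

definition xi_map :: "('n::{card2,linorder} space \<Rightarrow> 'n pspace) \<Rightarrow> nat \<Rightarrow> 'n space \<Rightarrow> 'n space" where
  "xi_map Uf i \<rho> = \<rho> + eta (Uf \<rho>) i"

definition pi_map :: "('n::{card2,linorder} space \<Rightarrow> 'n pspace) \<Rightarrow> nat \<Rightarrow> 'n space \<Rightarrow> 'n space" where
  "pi_map Uf i \<rho> = \<rho> + (\<Sum>k = 1..<i. gamma (Uf \<rho>) k)"

definition z_map :: "('n::{card2,linorder} space \<Rightarrow> 'n pspace) \<Rightarrow> nat \<Rightarrow> 'n space \<Rightarrow> 'n space" where
  "z_map Uf i \<rho> = kappa (Uf \<rho>) i *\<^sub>R gamma (Uf \<rho>) i"

definition Dpi :: "('n::{card2,linorder} space \<Rightarrow> 'n pspace) \<Rightarrow> nat \<Rightarrow> 'n space \<Rightarrow> real Matrix.mat" where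
  "Dpi Uf i \<rho> = lin_mat (frechet_derivative (pi_map Uf i) (at \<rho>))"

definition Mmat :: "('n::{card2,linorder} space \<Rightarrow> 'n pspace) \<Rightarrow> nat \<Rightarrow> 'n space \<Rightarrow> real Matrix.mat" where
  "Mmat Uf i \<rho> = lin_mat (inv_into UNIV (frechet_derivative (pi_map Uf i) (at \<rho>)) \<circ>
                          frechet_derivative (z_map Uf i) (at \<rho>))"

text \<open>In the setting of the theorem the characteristic polynomial of \<^term>\<open>Mmat Uf i \<rho>\<close> is
  divisible by \<open>x\<^sup>n\<^sup>+\<^sup>1 (x + 1)\<^sup>2\<^sup>n\<close>, so the polynomial division below is exact, and \<open>Q\<close> is the
  monic cofactor of degree \<open>n - 1\<close>.\<close>

definition Qpoly :: "('n::{card2,linorder} space \<Rightarrow> 'n pspace) \<Rightarrow> nat \<Rightarrow> 'n space \<Rightarrow> real poly" where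
  "Qpoly Uf i \<rho> =
     char_poly (Mmat Uf i \<rho>) div ([:0, 1:] ^ (CARD('n) + 1) * [:1, 1:] ^ (2 * CARD('n)))"

definition Eset :: "('n::{card2,linorder} space \<Rightarrow> 'n pspace) \<Rightarrow> nat \<Rightarrow> 'n space \<Rightarrow> real set" where
  "Eset Uf i \<rho> = {x. x < -1 \<and> poly (Qpoly Uf i \<rho>) x = 0}"

definition nondegenerate :: "('n::{card2,linorder} space \<Rightarrow> 'n pspace) \<Rightarrow> nat \<Rightarrow> bool" where
  "nondegenerate Uf i \<longleftrightarrow>
     poly_discr (Qpoly Uf i 0) \<noteq> 0 \<and> poly (Qpoly Uf i 0) (-1) \<noteq> 0 \<and>
     (\<forall>x0\<in>Eset Uf i 0.
        adj_mat (x0 \<cdot>\<^sub>m 1\<^sub>m (4 * CARD('n)) - Mmat Uf i 0) *\<^sub>v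
          (adj_mat (Dpi Uf i 0) *\<^sub>v coord_vec (z_map Uf i 0)) \<noteq> 0\<^sub>v (4 * CARD('n)))"

definition SigmaSet ::
  "('n::{card2,linorder} space \<Rightarrow> 'n pspace) \<Rightarrow> real \<Rightarrow> real \<Rightarrow> 'n space set" where
  "SigmaSet Uf r lam = (\<Union>t\<in>{0..<lam}. \<Union>i\<in>{1..2 * CARD('n) + 1}.
     {t *\<^sub>R xi_map Uf i \<rho> + (1 - t) *\<^sub>R pi_map Uf i \<rho> | \<rho>. \<rho> \<in> ball 0 r})"

end

theory Submission
  imports Defs
begin

text \<open>
  Write \<open>\<xi>\<^sub>i = \<pi>\<^sub>i + z\<^sub>i\<close>, so that \<open>\<Sigma>(\<lambda>)\<close> is the union of the images of the
  maps \<open>\<pi>\<^sub>i + t z\<^sub>i\<close>, \<open>0 \<le> t < \<lambda>\<close>. Where \<open>D\<pi>\<^sub>i + t Dz\<^sub>i\<close> is invertible this map is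
  open. Elsewhere \<open>t > 0\<close> and \<open>-1/t < -1\<close> is a root of the characteristic polynomial of
  \<open>M\<^sub>i\<close>, hence of \<open>Q\<close>; the nondegeneracy condition says, by Cramer's rule, that replacing a
  column of \<open>D\<pi>\<^sub>i + t Dz\<^sub>i\<close> by \<open>z\<^sub>i\<close> yields an invertible matrix, so the map
  \<open>(t, \<rho>) \<mapsto> \<pi>\<^sub>i(\<rho>) + t z\<^sub>i(\<rho>)\<close> is a submersion and again open. One of the two alternatives holds at
  \<open>\<rho> = 0\<close> for every \<open>t \<in> [0, 1)\<close>, and both are open conditions. Near \<open>t = 1\<close> the first one
  holds, because \<open>Q(0)(-1) \<noteq> 0\<close> and \<open>Q(\<rho>)(x)\<close> is continuous. Compactness of \<open>[0, 1]\<close> then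
  gives a neighbourhood of \<open>0\<close> that works for all \<open>t\<close>.

  The factor \<open>x\<^sup>n\<^sup>+\<^sup>1\<close> of the characteristic polynomial comes from the kernel of \<open>Dz\<^sub>i\<close>, as \<open>z\<^sub>i\<close> is a
  smooth function of only \<open>3 n - 1\<close> parameters, and the factor \<open>(x + 1)\<^sup>2\<^sup>n\<close> from the kernel of
  \<open>D\<xi>\<^sub>i\<close>, as \<open>\<xi>\<^sub>i\<close> takes values in the graph of \<open>DF\<close>.
\<close>

no_notation scalar_prod (infix "\<bullet>" 70)

section \<open>Calculus of continuously differentiable maps\<close>

text \<open>Functions that agree on an open set have the same derivative at each of its points, so
  the recursion of \<open>Ck_on\<close> transfers level by level. This lets closed formulas stand in
  for objects defined by unique existence.\<close>

lemma Ck_on_cong: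
  fixes f g :: "'a::euclidean_space \<Rightarrow> 'b::real_normed_vector"
  assumes "open S" "Ck_on k S f" "\<And>x. x \<in> S \<Longrightarrow> f x = g x"
  shows "Ck_on k S g"
  using assms(2,3)
proof (induction k arbitrary: f g)
  case 0
  then show ?case using continuous_on_cong by (metis Ck_on.simps(1))
next
  case (Suc k)
  have d: "(g has_derivative frechet_derivative f (at x)) (at x)" if "x \<in> S" for x
    using Suc.prems that assms(1)
    by (auto intro: has_derivative_transform_within_open simp: frechet_derivative_works)
  then have eq: "frechet_derivative f (at x) = frechet_derivative g (at x)" if "x \<in> S" for x
    using frechet_derivative_at that by blast
  show ?case
    unfolding Ck_on.simps
  proof (intro conjI ballI)
    show "g differentiable (at x)" if "x \<in> S" for x
      using d that differentiable_def by blast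
    show "Ck_on k S (\<lambda>x. frechet_derivative g (at x) b)" if "b \<in> Basis" for b
      using Suc.IH[of "\<lambda>x. frechet_derivative f (at x) b"] Suc.prems that eq by simp
  qed
qed

text \<open>Derivatives are unique at points of an open set, so any explicit family
  \<open>f'\<close> may replace \<open>frechet_derivative\<close>.\<close>

lemma Ck_on_SucI:
  fixes f :: "'a::euclidean_space \<Rightarrow> 'b::real_normed_vector"
  assumes "open S" "\<And>x. x \<in> S \<Longrightarrow> (f has_derivative f' x) (at x)"
    and "\<And>b. b \<in> Basis \<Longrightarrow> Ck_on k S (\<lambda>x. f' x b)"
  shows "Ck_on (Suc k) S f"
proof -
  have "Ck_on k S (\<lambda>x. frechet_derivative f (at x) b)" if "b \<in> Basis" for b
    by (rule Ck_on_cong[OF assms(1) assms(3)[OF that]])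
      (simp add: frechet_derivative_at[OF assms(2), symmetric])
  then show ?thesis
    using assms(2) by (auto simp: differentiable_def)
qed

lemma Ck_on_Suc_has_derivative:
  "Ck_on (Suc k) S f \<Longrightarrow> x \<in> S \<Longrightarrow> (f has_derivative frechet_derivative f (at x)) (at x)"
  by (simp add: frechet_derivative_works)

lemma Ck_on_SucD: "Ck_on (Suc k) S f \<Longrightarrow> Ck_on k S f"
proof (induction k arbitrary: f)
  case 0
  then show ?case
    by (auto intro!: continuous_at_imp_continuous_on differentiable_imp_continuous_within)
next
  case (Suc k)
  from Suc.prems have d: "\<forall>x\<in>S. f differentiable (at x)"
    and p: "\<forall>b\<in>Basis. Ck_on (Suc k) S (\<lambda>x. frechet_derivative f (at x) b)"
    unfolding Ck_on.simps(2)[of "Suc k"] by blast+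
  show ?case
    unfolding Ck_on.simps(2)[of k] using d p Suc.IH by blast
qed

lemma Ck_on_subset: "Ck_on k S f \<Longrightarrow> T \<subseteq> S \<Longrightarrow> Ck_on k T f"
proof (induction k arbitrary: f)
  case (Suc k)
  then show ?case by (simp add: subset_eq)
qed (auto intro: continuous_on_subset)

lemma Ck_on_imp_continuous_on: "Ck_on k S f \<Longrightarrow> continuous_on S f"
proof (induction k)
  case (Suc k)
  then show ?case using Ck_on_SucD by blast
qed simp

lemma Ck_on_const: "open S \<Longrightarrow> Ck_on k S (\<lambda>x::'a::euclidean_space. c)"
proof (induction k arbitrary: c)
  case (Suc k)
  then show ?case
    by (intro Ck_on_SucI[where f'="\<lambda>_ _. 0"] has_derivative_const)
qed simp

lemma Ck_on_add:
  assumes "open S" "Ck_on k S f" "Ck_on k S g"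
  shows "Ck_on k S (\<lambda>x. f x + g x)"
  using assms(2,3)
proof (induction k arbitrary: f g)
  case (Suc k)
  show ?case
  proof (rule Ck_on_SucI[OF assms(1) has_derivative_add[OF Suc.prems(1)[THEN Ck_on_Suc_has_derivative]
          Suc.prems(2)[THEN Ck_on_Suc_has_derivative]]])
    show "Ck_on k S (\<lambda>x. frechet_derivative f (at x) b + frechet_derivative g (at x) b)"
      if "b \<in> Basis" for b
      using Suc.prems that by (intro Suc.IH) auto
  qed
qed (auto intro: continuous_on_add)

lemma Ck_on_sum:
  assumes "open S" "finite I" "\<And>i. i \<in> I \<Longrightarrow> Ck_on k S (f i)"
  shows "Ck_on k S (\<lambda>x. \<Sum>i\<in>I. f i x)"
  using assms(2,3) by (induction I rule: finite_induct) (auto intro: Ck_on_const Ck_on_add assms(1))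

lemma Ck_on_bounded_linear_comp:
  assumes "open S" "bounded_linear h" "Ck_on k S f"
  shows "Ck_on k S (\<lambda>x. h (f x))"
  using assms(3)
proof (induction k arbitrary: f)
  case 0
  then show ?case using assms(2) by (auto intro: bounded_linear.continuous_on)
next
  case (Suc k)
  show ?case
  proof (rule Ck_on_SucI[OF assms(1) bounded_linear.has_derivative[OF assms(2)
          Suc.prems(1)[THEN Ck_on_Suc_has_derivative]]])
    show "Ck_on k S (\<lambda>x. h (frechet_derivative f (at x) b))" if "b \<in> Basis" for b
      using Suc.prems that by (intro Suc.IH) auto
  qed
qed

lemma Ck_on_id: "open S \<Longrightarrow> Ck_on k S (\<lambda>x::'a::euclidean_space. x)"
proof (cases k)
  case (Suc m)
  show "open S \<Longrightarrow> ?thesis"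
    unfolding Suc by (rule Ck_on_SucI[where f'="\<lambda>_ v. v"]) (auto intro: Ck_on_const)
qed simp

lemma Ck_on_bounded_linear:
  "open S \<Longrightarrow> bounded_linear h \<Longrightarrow> Ck_on k S (h :: 'a::euclidean_space \<Rightarrow> _)"
  using Ck_on_bounded_linear_comp[OF _ _ Ck_on_id] by auto

lemma Ck_on_bilinear:
  assumes "open S" "bounded_bilinear m" "Ck_on k S f" "Ck_on k S g"
  shows "Ck_on k S (\<lambda>x. m (f x) (g x))"
  using assms(3,4)
proof (induction k arbitrary: f g)
  case 0
  then show ?case using bounded_bilinear.continuous_on[OF assms(2)] by auto
next
  case (Suc k)
  show ?case
  proof (rule Ck_on_SucI[OF assms(1) bounded_bilinear.FDERIV[OF assms(2)
          Suc.prems(1)[THEN Ck_on_Suc_has_derivative] Suc.prems(2)[THEN Ck_on_Suc_has_derivative]]])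
    show "Ck_on k S (\<lambda>x. m (f x) (frechet_derivative g (at x) b) + m (frechet_derivative f (at x) b) (g x))"
      if "b \<in> Basis" for b
      using Suc.prems[THEN Ck_on_SucD] Suc.prems that by (intro Ck_on_add[OF assms(1)] Suc.IH) auto
  qed
qed

lemmas Ck_on_scaleR = Ck_on_bilinear[OF _ bounded_bilinear_scaleR]
lemmas Ck_on_mult = Ck_on_bilinear[OF _ bounded_bilinear_mult]

lemma Ck_on_compose:
  fixes f :: "'a::euclidean_space \<Rightarrow> 'b::euclidean_space" and g :: "'b \<Rightarrow> 'c::real_normed_vector"
  assumes "open S" "Ck_on k T g" "Ck_on k S f" "f ` S \<subseteq> T"
  shows "Ck_on k S (\<lambda>x. g (f x))"
  using assms(2,3)
proof (induction k arbitrary: g)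
  case 0
  then show ?case using assms(4) by (auto intro: continuous_on_compose2)
next
  case (Suc k)
  let ?f = "\<lambda>x. frechet_derivative f (at x)" and ?g = "\<lambda>x. frechet_derivative g (at x)"
  show ?case
  proof (rule Ck_on_SucI[OF assms(1)])
    fix x assume x: "x \<in> S"
    have df: "(f has_derivative ?f x) (at x)" and dg: "(g has_derivative ?g (f x)) (at (f x))"
      using Suc.prems x assms(4) by (auto intro!: Ck_on_Suc_has_derivative)
    \<comment> \<open>The direction \<open>?f x b\<close> in the chain rule moves with
      \<open>x\<close>, while \<open>Ck_on\<close> speaks of fixed basis directions. Expanding it in
      the basis leaves a sum of products to which the induction hypothesis applies.\<close>
    have "?g (f x) v = (\<Sum>c\<in>Basis. (v \<bullet> c) *\<^sub>R ?g (f x) c)" for v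
    proof -
      interpret bounded_linear "?g (f x)" using dg has_derivative_bounded_linear by blast
      have "?g (f x) (\<Sum>c\<in>Basis. (v \<bullet> c) *\<^sub>R c) = (\<Sum>c\<in>Basis. (v \<bullet> c) *\<^sub>R ?g (f x) c)"
        by (simp add: sum scaleR)
      then show ?thesis by (simp only: euclidean_representation)
    qed
    then have eq: "(\<lambda>b. ?g (f x) (?f x b)) = (\<lambda>b. \<Sum>c\<in>Basis. (?f x b \<bullet> c) *\<^sub>R (?g (f x) c))"
      by (intro ext)
    show "((\<lambda>x. g (f x)) has_derivative (\<lambda>b. \<Sum>c\<in>Basis. (?f x b \<bullet> c) *\<^sub>R (?g (f x) c))) (at x)"
      using has_derivative_compose[OF df dg] unfolding eq .
  next
    fix b :: 'a assume b: "b \<in> Basis"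
    show "Ck_on k S (\<lambda>x. \<Sum>c\<in>Basis. (?f x b \<bullet> c) *\<^sub>R (?g (f x) c))"
    proof (intro Ck_on_sum[OF assms(1)] Ck_on_scaleR[OF assms(1)] finite_Basis)
      fix c :: 'b assume c: "c \<in> Basis"
      show "Ck_on k S (\<lambda>x. ?f x b \<bullet> c)"
        by (rule Ck_on_bounded_linear_comp[OF assms(1) bounded_linear_inner_left])
          (use Suc.prems b in auto)
      show "Ck_on k S (\<lambda>x. ?g (f x) c)"
        using Suc.IH[of "\<lambda>y. ?g y c"] Suc.prems c Ck_on_SucD[OF Suc.prems(2)] by auto
    qed
  qed
qed

lemma Ck_on_inverse:
  fixes f :: "'a::euclidean_space \<Rightarrow> real"
  assumes "open S" "Ck_on k S f" "\<And>x. x \<in> S \<Longrightarrow> f x \<noteq> 0"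
  shows "Ck_on k S (\<lambda>x. inverse (f x))"
  using assms(2)
proof (induction k)
  case 0
  then show ?case using assms(3) by (auto intro: continuous_on_inverse)
next
  case (Suc k)
  show ?case
  proof (rule Ck_on_SucI[OF assms(1) Deriv.has_derivative_inverse[OF assms(3)
          Suc.prems(1)[THEN Ck_on_Suc_has_derivative]]])
    fix b :: 'a assume b: "b \<in> Basis"
    have "Ck_on k S (\<lambda>x. inverse (f x))" "Ck_on k S (\<lambda>x. frechet_derivative f (at x) b)"
      using Suc.IH Ck_on_SucD[OF Suc.prems] Suc.prems b by auto
    then show "Ck_on k S (\<lambda>x. - (inverse (f x) * frechet_derivative f (at x) b * inverse (f x)))"
      by (intro Ck_on_bounded_linear_comp[OF assms(1) bounded_linear_minus[OF bounded_linear_ident]]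
          Ck_on_mult[OF assms(1)])
  qed auto
qed

lemma Ck_on_prod:
  fixes f :: "'i \<Rightarrow> 'a::euclidean_space \<Rightarrow> real"
  assumes "open S" "finite I" "\<And>i. i \<in> I \<Longrightarrow> Ck_on k S (f i)"
  shows "Ck_on k S (\<lambda>x. \<Prod>i\<in>I. f i x)"
  using assms(2,3) by (induction I rule: finite_induct) (auto intro: Ck_on_const Ck_on_mult assms(1))

section \<open>Derivatives in fixed directions, vector-valued maps and determinants\<close>

lemma Ck_on_frechet_derivative:
  fixes f :: "'a::euclidean_space \<Rightarrow> 'b::real_normed_vector"
  assumes "open S" "Ck_on (Suc k) S f"
  shows "Ck_on k S (\<lambda>x. frechet_derivative f (at x) v)"
proof (rule Ck_on_cong[OF assms(1)])
  show "Ck_on k S (\<lambda>x. \<Sum>b\<in>Basis. (v \<bullet> b) *\<^sub>R frechet_derivative f (at x) b)"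
    using assms by (intro Ck_on_sum Ck_on_scaleR Ck_on_const) auto
  fix x assume "x \<in> S"
  then interpret bounded_linear "frechet_derivative f (at x)"
    using Ck_on_Suc_has_derivative[OF assms(2)] has_derivative_bounded_linear by blast
  have "frechet_derivative f (at x) (\<Sum>b\<in>Basis. (v \<bullet> b) *\<^sub>R b) =
      (\<Sum>b\<in>Basis. (v \<bullet> b) *\<^sub>R frechet_derivative f (at x) b)"
    by (simp add: sum scaleR)
  then show "(\<Sum>b\<in>Basis. (v \<bullet> b) *\<^sub>R frechet_derivative f (at x) b) = frechet_derivative f (at x) v"
    by (simp only: euclidean_representation)
qed

lemma Ck_on_vec_lambda:
  fixes f :: "'i::finite \<Rightarrow> 'a::euclidean_space \<Rightarrow> 'b::euclidean_space"
  assumes "open S" "\<And>i. Ck_on k S (f i)"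
  shows "Ck_on k S (\<lambda>x. \<chi> i. f i x)"
proof (rule Ck_on_cong[OF assms(1)])
  have "bounded_linear (axis i :: 'b \<Rightarrow> 'b^'i)" for i
    unfolding linear_conv_bounded_linear[symmetric]
    by (rule linearI) (auto simp: axis_def Finite_Cartesian_Product.vec_eq_iff)
  then show "Ck_on k S (\<lambda>x. \<Sum>i\<in>UNIV. axis i (f i x))"
    using Ck_on_bounded_linear_comp[OF assms(1) _ assms(2)]
    by (intro Ck_on_sum[OF assms(1)]) auto
  show "(\<Sum>i\<in>UNIV. axis i (f i x)) = (\<chi> i. f i x)" for x
    by (simp add: Finite_Cartesian_Product.vec_eq_iff axis_def)
qed

lemma Ck_on_vec_nth:
  "open S \<Longrightarrow> Ck_on k S f \<Longrightarrow> Ck_on k S (\<lambda>x. f x $ i)"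
  by (rule Ck_on_bounded_linear_comp[OF _ bounded_linear_vec_nth])

lemma Ck_on_Pair:
  fixes f :: "'a::euclidean_space \<Rightarrow> 'b::real_normed_vector" and g :: "'a \<Rightarrow> 'c::real_normed_vector"
  assumes "open S" "Ck_on k S f" "Ck_on k S g"
  shows "Ck_on k S (\<lambda>x. (f x, g x))"
  using assms(2,3)
proof (induction k arbitrary: f g)
  case (Suc k)
  show ?case
  proof (rule Ck_on_SucI[OF assms(1) has_derivative_Pair[OF Suc.prems(1)[THEN Ck_on_Suc_has_derivative]
          Suc.prems(2)[THEN Ck_on_Suc_has_derivative]]])
    show "Ck_on k S (\<lambda>x. (frechet_derivative f (at x) b, frechet_derivative g (at x) b))"
      if "b \<in> Basis" for b
      using Suc.prems that by (intro Suc.IH) auto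
  qed
qed (auto intro: continuous_on_Pair)

text \<open>The Leibniz formula is a polynomial in the entries. The case \<open>k = 0\<close>
  supplies the continuity of the determinants of pencils.\<close>

lemma Ck_on_det_mat:
  fixes a :: "'a::euclidean_space \<Rightarrow> nat \<times> nat \<Rightarrow> real"
  assumes "open S" "\<And>i j. i < m \<Longrightarrow> j < m \<Longrightarrow> Ck_on k S (\<lambda>x. a x (i, j))"
  shows "Ck_on k S (\<lambda>x. Determinant.det (Matrix.mat m m (a x)))"
proof (rule Ck_on_cong[OF assms(1)])
  show "Ck_on k S (\<lambda>x. \<Sum>p | p permutes {0..<m}. signof p * (\<Prod>i = 0..<m. a x (i, p i)))"
    by (intro Ck_on_sum Ck_on_mult Ck_on_const Ck_on_prod finite_permutations assms)
      (auto dest: permutes_in_image)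
  show "(\<Sum>p | p permutes {0..<m}. signof p * (\<Prod>i = 0..<m. a x (i, p i)))
        = Determinant.det (Matrix.mat m m (a x))" for x
    by (subst det_def'[of _ m])
      (auto intro!: sum.cong prod.cong simp: permutes_in_image)
qed

section \<open>Linear maps and matrices\<close>

lemma bij_betw_basis_enum: "bij_betw (basis_enum :: nat \<Rightarrow> 'a::euclidean_space) {..<DIM('a)} Basis"
proof -
  have "\<exists>e :: nat \<Rightarrow> 'a. bij_betw e {..<DIM('a)} Basis"
    using ex_bij_betw_nat_finite[OF finite_Basis] by (simp add: lessThan_atLeast0)
  then show ?thesis unfolding basis_enum_def by (rule someI_ex)
qed

lemma basis_enum_in_Basis [simp]: "j < DIM('a) \<Longrightarrow> (basis_enum j :: 'a::euclidean_space) \<in> Basis"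
  using bij_betw_basis_enum bij_betwE by blast

lemma inner_basis_enum:
  "i < DIM('a) \<Longrightarrow> j < DIM('a) \<Longrightarrow>
    (basis_enum i :: 'a::euclidean_space) \<bullet> basis_enum j = (if i = j then 1 else 0)"
  using bij_betw_basis_enum[where 'a='a]
  by (auto simp: inner_Basis bij_betw_def inj_on_def)

lemma sum_basis_enum:
  "(\<Sum>j<DIM('a). h (basis_enum j)) = (\<Sum>b\<in>(Basis :: 'a::euclidean_space set). h b)"
  by (rule sum.reindex_bij_betw[OF bij_betw_basis_enum])

lemma basis_enum_representation:
  "(\<Sum>j<DIM('a). (v \<bullet> basis_enum j) *\<^sub>R basis_enum j) = (v :: 'a::euclidean_space)"
  using sum_basis_enum[of "\<lambda>b. (v \<bullet> b) *\<^sub>R b"] by (simp add: euclidean_representation)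

lemma linear_basis_enum:
  fixes f :: "'a::euclidean_space \<Rightarrow> 'b::real_vector"
  assumes "linear f"
  shows "f v = (\<Sum>j<DIM('a). (v \<bullet> basis_enum j) *\<^sub>R f (basis_enum j))"
proof -
  have "f (\<Sum>j<DIM('a). (v \<bullet> basis_enum j) *\<^sub>R basis_enum j) =
      (\<Sum>j<DIM('a). (v \<bullet> basis_enum j) *\<^sub>R f (basis_enum j))"
    using assms by (simp add: linear_sum linear_scale)
  then show ?thesis by (simp only: basis_enum_representation)
qed

lemma lin_mat_carrier [simp]:
  "lin_mat (L :: 'a::euclidean_space \<Rightarrow> 'b::euclidean_space) \<in> carrier_mat DIM('b) DIM('a)"
  by (simp add: lin_mat_def)

lemma coord_vec_carrier [simp]: "coord_vec (v :: 'a::euclidean_space) \<in> carrier_vec DIM('a)"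
  by (simp add: coord_vec_def)

lemma lin_mat_comp:
  fixes f :: "'b::euclidean_space \<Rightarrow> 'c::euclidean_space" and g :: "'a::euclidean_space \<Rightarrow> 'b"
  assumes "linear f"
  shows "lin_mat (f \<circ> g) = lin_mat f * lin_mat g"
proof (rule eq_matI)
  fix i j assume "i < dim_row (lin_mat f * lin_mat g)" "j < dim_col (lin_mat f * lin_mat g)"
  then have i: "i < DIM('c)" and j: "j < DIM('a)" by (auto simp: lin_mat_def)
  have "f (g (basis_enum j)) \<bullet> basis_enum i =
      (\<Sum>l<DIM('b). (g (basis_enum j) \<bullet> basis_enum l) * (f (basis_enum l) \<bullet> basis_enum i))"
    by (subst linear_basis_enum[OF assms]) (simp add: inner_sum_left)
  then show "lin_mat (f \<circ> g) $$ (i, j) = (lin_mat f * lin_mat g) $$ (i, j)"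
    using i j by (simp add: lin_mat_def scalar_prod_def lessThan_atLeast0 mult.commute)
qed (auto simp: lin_mat_def)

lemma lin_mat_mult_coord_vec:
  fixes f :: "'a::euclidean_space \<Rightarrow> 'b::euclidean_space"
  assumes "linear f"
  shows "lin_mat f *\<^sub>v coord_vec v = coord_vec (f v)"
proof (rule Matrix.eq_vecI)
  fix i assume "i < dim_vec (coord_vec (f v))"
  then have i: "i < DIM('b)" by (auto simp: coord_vec_def)
  have "f v \<bullet> basis_enum i = (\<Sum>l<DIM('a). (v \<bullet> basis_enum l) * (f (basis_enum l) \<bullet> basis_enum i))"
    by (subst linear_basis_enum[OF assms]) (simp add: inner_sum_left)
  then show "vec_index (lin_mat f *\<^sub>v coord_vec v) i = vec_index (coord_vec (f v)) i"
    using i by (simp add: lin_mat_def coord_vec_def scalar_prod_def lessThan_atLeast0 mult.commute)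
qed (auto simp: lin_mat_def coord_vec_def)

lemma coord_vec_0: "coord_vec (0 :: 'a::euclidean_space) = 0\<^sub>v DIM('a)"
  by (rule Matrix.eq_vecI) (auto simp: coord_vec_def)

lemma coord_vec_eq_0_iff: "coord_vec (v :: 'a::euclidean_space) = 0\<^sub>v DIM('a) \<longleftrightarrow> v = 0"
proof
  assume a: "coord_vec v = 0\<^sub>v DIM('a)"
  have "v \<bullet> basis_enum j = 0" if "j < DIM('a)" for j
    using arg_cong[OF a, of "\<lambda>w. vec_index w j"] that by (simp add: coord_vec_def)
  then show "v = 0"
    using basis_enum_representation[of v] by simp
qed (simp add: coord_vec_0)

lemma lin_mat_id: "lin_mat (id :: 'a::euclidean_space \<Rightarrow> 'a) = 1\<^sub>m DIM('a)"
  by (rule eq_matI) (auto simp: lin_mat_def inner_basis_enum)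

lemma lin_mat_scale_diff:
  fixes f g :: "'a::euclidean_space \<Rightarrow> 'a"
  shows "lin_mat (\<lambda>v. x *\<^sub>R f v - g v) = x \<cdot>\<^sub>m lin_mat f - lin_mat g"
  by (rule eq_matI) (auto simp: lin_mat_def inner_diff_left)

lemma inj_if_det_lin_mat_nonzero:
  fixes f :: "'a::euclidean_space \<Rightarrow> 'a"
  assumes "linear f" "Determinant.det (lin_mat f) \<noteq> 0"
  shows "inj f"
proof -
  have "v = 0" if "f v = 0" for v
  proof (rule ccontr)
    assume "v \<noteq> 0"
    then have "coord_vec v \<noteq> 0\<^sub>v DIM('a)" by (simp add: coord_vec_eq_0_iff)
    moreover have "lin_mat f *\<^sub>v coord_vec v = 0\<^sub>v DIM('a)"
      using lin_mat_mult_coord_vec[OF assms(1), of v] that by (simp add: coord_vec_0)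
    ultimately show False
      using det_0_iff_vec_prod_zero[of "lin_mat f" "DIM('a)"] assms(2) coord_vec_carrier lin_mat_carrier by blast
  qed
  then show ?thesis using assms(1) by (simp add: linear_injective_0)
qed

lemma bij_if_det_lin_mat_nonzero:
  fixes f :: "'a::euclidean_space \<Rightarrow> 'a"
  assumes "linear f" "Determinant.det (lin_mat f) \<noteq> 0"
  shows "bij f"
  using inj_if_det_lin_mat_nonzero[OF assms] linear_injective_imp_surjective[OF assms(1)]
  by (simp add: bij_def)

section \<open>Cramer's rule and replaced columns\<close>

text \<open>Cramer's rule without division: expanding the right-hand determinant along column
  \<open>k\<close> produces row \<open>k\<close> of the adjugate times \<open>b\<close>. It also
  covers singular \<open>A\<close>, the case needed for the characteristic matrix at an
  eigenvalue.\<close>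

lemma adj_mat_mult_vec_nth:
  assumes "A \<in> carrier_mat n n" "b \<in> carrier_vec n" "k < n"
  shows "vec_index (adj_mat A *\<^sub>v b) k = Determinant.det (replace_col A b k)"
proof -
  have Ab: "replace_col A b k \<in> carrier_mat n n"
    using assms by (auto simp: replace_col_def)
  have "vec_index (adj_mat A *\<^sub>v b) k = scalar_prod (Matrix.row (adj_mat A) k) b"
    using adj_mat[OF assms(1)] assms by auto
  also have "\<dots> = Determinant.det (replace_col A b k)"
    unfolding scalar_prod_def using assms
    by (subst laplace_expansion_column[OF Ab assms(3)], auto intro!: sum.cong arg_cong[of _ _ Determinant.det]
      arg_cong[of _ _ "\<lambda> x. _ * x"] eq_matI
      simp: replace_col_def adj_mat_def Matrix.row_def cofactor_def mat_delete_def ac_simps)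
  finally show ?thesis .
qed

text \<open>Multiplication from the left acts on each column separately.\<close>

lemma mult_replace_col:
  assumes "A \<in> carrier_mat n n" "B \<in> carrier_mat n n" "b \<in> carrier_vec n" "k < n"
  shows "B * replace_col A b k = replace_col (B * A) (B *\<^sub>v b) k"
proof (rule eq_matI)
  fix i j assume "i < dim_row (replace_col (B * A) (B *\<^sub>v b) k)" "j < dim_col (replace_col (B * A) (B *\<^sub>v b) k)"
  then have "i < n" "j < n" using assms by (auto simp: replace_col_def)
  moreover have "Matrix.col (replace_col A b k) j = (if j = k then b else Matrix.col A j)"
    using assms \<open>j < n\<close> by (intro Matrix.eq_vecI) (auto simp: replace_col_def)
  ultimately show "(B * replace_col A b k) $$ (i, j) = replace_col (B * A) (B *\<^sub>v b) k $$ (i, j)"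
    using assms by (auto simp: replace_col_def)
qed (use assms in \<open>auto simp: replace_col_def\<close>)

text \<open>The matrix with the replaced column belongs to a map \<open>g\<close> that sends basis
  vector \<open>k\<close> to \<open>z\<close> and agrees with \<open>f\<close> on the other basis
  vectors. It is invertible, and each of its values is a multiple of \<open>z\<close> plus a value
  of \<open>f\<close>.\<close>

lemma surj_if_det_replace_col_nonzero:
  fixes f :: "'a::euclidean_space \<Rightarrow> 'a"
  assumes "linear f" "k < DIM('a)" "Determinant.det (replace_col (lin_mat f) (coord_vec z) k) \<noteq> 0"
  shows "surj (\<lambda>(s, v). s *\<^sub>R z + f v)"
proof -
  define e where "e = (basis_enum k :: 'a)"
  define g where "g v = (v \<bullet> e) *\<^sub>R z + f (v - (v \<bullet> e) *\<^sub>R e)" for v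
  have "linear g"
    unfolding g_def using assms(1)
    by (intro linearI) (simp_all add: linear_add linear_diff linear_scale algebra_simps)
  moreover have "replace_col (lin_mat f) (coord_vec z) k = lin_mat g"
    using assms(1,2)
    by (intro eq_matI)
      (auto simp: lin_mat_def replace_col_def coord_vec_def g_def e_def inner_basis_enum linear_0)
  ultimately have "surj g"
    using bij_if_det_lin_mat_nonzero[of g] assms(3) by (simp add: bij_def)
  have "\<exists>p. (case p of (s, v) \<Rightarrow> s *\<^sub>R z + f v) = y" for y
  proof -
    obtain v where "y = g v" using \<open>surj g\<close> by (auto simp: surj_def)
    then show ?thesis by (intro exI[of _ "(v \<bullet> e, v - (v \<bullet> e) *\<^sub>R e)"]) (simp add: g_def)
  qed
  then show ?thesis unfolding surj_def by metis
qed

lemma smult_one_mult_mat_vec: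
  assumes "v \<in> carrier_vec n"
  shows "(c \<cdot>\<^sub>m 1\<^sub>m n) *\<^sub>v v = c \<cdot>\<^sub>v (v :: 'a::comm_ring_1 Matrix.vec)"
proof (rule Matrix.eq_vecI)
  fix i assume "i < dim_vec (c \<cdot>\<^sub>v v)"
  then have i: "i < n" using assms by simp
  then have "Matrix.row (c \<cdot>\<^sub>m 1\<^sub>m n) i = c \<cdot>\<^sub>v unit_vec n i"
    by (intro Matrix.eq_vecI) auto
  then show "vec_index ((c \<cdot>\<^sub>m 1\<^sub>m n) *\<^sub>v v) i = vec_index (c \<cdot>\<^sub>v v) i"
    using i assms by (simp add: smult_scalar_prod_distrib[of _ n] scalar_prod_left_unit[of _ n])
qed (use assms in simp)

section \<open>Eigenspaces and multiplicities of roots of the characteristic polynomial\<close>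

text \<open>Every term of the Leibniz formula contains one factor from each of the first
  \<open>k\<close> columns.\<close>

lemma power_dvd_det_cols:
  fixes A :: "'a::comm_ring_1 mat"
  assumes "A \<in> carrier_mat n n" "k \<le> n" "\<And>i j. i < n \<Longrightarrow> j < k \<Longrightarrow> d dvd A $$ (i, j)"
  shows "d ^ k dvd Determinant.det A"
proof -
  have "d ^ k dvd (\<Prod>j<n. A $$ (p j, j))" if p: "p permutes {0..<n}" for p
  proof -
    have "(\<Prod>j<k. d) dvd (\<Prod>j<k. A $$ (p j, j))"
      using assms p permutes_in_image[OF p] by (intro prod_dvd_prod) auto
    moreover have "(\<Prod>j<n. A $$ (p j, j)) = (\<Prod>j<k. A $$ (p j, j)) * (\<Prod>j=k..<n. A $$ (p j, j))"
      using assms(2) by (subst prod.union_disjoint[symmetric]) (auto intro: prod.cong simp: ivl_disj_un)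
    ultimately show ?thesis by (simp add: dvd_mult2)
  qed
  then show ?thesis
    unfolding det_col[OF assms(1)] by (intro dvd_sum dvd_mult) auto
qed

text \<open>The map is injective on the orthogonal complement of its kernel, so that complement has
  at most the dimension of the target.\<close>

lemma dim_kernel_ge:
  fixes f :: "'a::euclidean_space \<Rightarrow> 'b::euclidean_space"
  assumes "linear f"
  shows "DIM('a) \<le> dim {v. f v = 0} + DIM('b)"
proof -
  let ?K = "{v. f v = 0}" and ?O = "{y \<in> UNIV. \<forall>x\<in>{v. f v = 0}. real_inner_class.orthogonal x y}"
  have K: "subspace ?K" by (rule linear_subspace_kernel[OF assms])
  have "dim ?O + dim ?K = dim (UNIV :: 'a set)"
    by (rule dim_subspace_orthogonal_to_vectors) (use K in auto)
  moreover have "dim ?O \<le> DIM('b)"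
  proof -
    have sub: "subspace ?O"
      using subspace_orthogonal_to_vectors[of ?K] by simp
    have "inj_on f (span ?O)"
      unfolding span_eq_iff[THEN iffD2, OF sub]
    proof (rule inj_onI)
      fix x y assume x: "x \<in> ?O" and y: "y \<in> ?O" and "f x = f y"
      then have "x - y \<in> ?K" using assms by (simp add: linear_diff)
      moreover have "x - y \<in> ?O" using subspace_diff[OF sub x y] .
      ultimately have "real_inner_class.orthogonal (x - y) (x - y)" by blast
      then show "x = y" by (simp add: real_inner_class.orthogonal_def)
    qed
    then have "dim (f ` ?O) = dim ?O" by (rule dim_image_eq[OF assms])
    then show ?thesis using dim_subset_UNIV[of "f ` ?O"] by simp
  qed
  ultimately show ?thesis by simp
qed

text \<open>In a basis that starts with eigenvectors, the corresponding columns of the characteristic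
  matrix are divisible by \<open>x - e\<close>.\<close>

lemma power_dvd_char_poly_if_eigenspace_dim:
  fixes L :: "'a::euclidean_space \<Rightarrow> 'a"
  assumes L: "linear L" and k: "k \<le> dim {v. L v = e *\<^sub>R v}"
  shows "[:- e, 1:] ^ k dvd char_poly (lin_mat L)"
proof -
  let ?K = "{v. L v = e *\<^sub>R v}" and ?D = "DIM('a)"
  define m where "m = dim ?K"
  obtain B where B: "B \<subseteq> ?K" "independent B" "card B = m"
    using basis_exists[of ?K] unfolding m_def by metis
  obtain C where C: "B \<subseteq> C" "independent C" "UNIV \<subseteq> span C"
    using maximal_independent_subset_extend[of B UNIV] B by auto
  have "finite C" using C(2) by (rule independent_imp_finite)
  then have "finite B" using C(1) finite_subset by blast
  have cC: "card C = ?D"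
    using basis_card_eq_dim[of C UNIV] C by simp
  obtain h1 where h1: "bij_betw h1 {..<m} B"
    using ex_bij_betw_nat_finite[OF \<open>finite B\<close>] B by (metis lessThan_atLeast0)
  have "card (C - B) = ?D - m"
    using C(1) B \<open>finite B\<close> cC by (simp add: card_Diff_subset)
  moreover have mD: "m \<le> ?D"
    using card_mono[OF \<open>finite C\<close> C(1)] B cC by simp
  ultimately have "card {m..<?D} = card (C - B)" by simp
  then obtain h2 where h2: "bij_betw h2 {m..<?D} (C - B)"
    using \<open>finite C\<close> by (metis bij_betw_iff_card finite_Diff finite_atLeastLessThan)
  \<comment> \<open>\<open>h\<close> lists a basis of the whole space whose first \<open>m\<close>
    members are the independent eigenvectors; \<open>g\<close> carries the standard basis to
    it.\<close>
  define h where "h j = (if j < m then h1 j else h2 j)" for j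
  define g where "g v = (\<Sum>j<?D. (v \<bullet> basis_enum j) *\<^sub>R h j)" for v :: 'a
  have g: "linear g"
    unfolding g_def by (intro linearI) (simp_all add: inner_add_left scaleR_add_left sum.distrib scaleR_sum_right)
  have ge: "g (basis_enum j) = h j" if "j < ?D" for j
  proof -
    have "g (basis_enum j) = (\<Sum>l<?D. if l = j then h j else 0)"
      unfolding g_def using that by (intro sum.cong) (auto simp: inner_basis_enum)
    then show ?thesis using that by simp
  qed
  have hK: "h j \<in> ?K" if "j < m" for j
    using that h1 B(1) bij_betwE unfolding h_def by fastforce
  have "C \<subseteq> range g"
  proof
    fix c assume c: "c \<in> C"
    obtain j where "j < ?D" "c = h j"
    proof (cases "c \<in> B")
      case True
      then obtain j where "j < m" "c = h1 j" using h1 unfolding bij_betw_def by auto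
      then show ?thesis using mD by (intro that[of j]) (auto simp: h_def)
    next
      case False
      then have "c \<in> h2 ` {m..<?D}" using h2 c unfolding bij_betw_def by simp
      then obtain j where "j \<in> {m..<?D}" "c = h2 j" by blast
      then show ?thesis by (intro that[of j]) (auto simp: h_def)
    qed
    then show "c \<in> range g" using ge[of j] by (intro range_eqI[of _ _ "basis_enum j"]) simp
  qed
  then have "span C \<subseteq> range g"
    using span_minimal[OF _ linear_subspace_image[OF g subspace_UNIV]] by blast
  then have "surj g" using C(3) by auto
  then obtain g' where g': "linear g'" "g \<circ> g' = id" using linear_surjective_right_inverse[OF g] by auto
  then have g'g: "g' \<circ> g = id" using linear_inverse_left[OF g g'(1)] by simp
  let ?M = "lin_mat (g' \<circ> L \<circ> g)"
  have "?M = lin_mat g' * lin_mat L * lin_mat g"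
    using g' L by (simp add: lin_mat_comp linear_compose)
  moreover have "lin_mat g' * lin_mat g = 1\<^sub>m ?D" "lin_mat g * lin_mat g' = 1\<^sub>m ?D"
    using lin_mat_comp[OF g, of g'] lin_mat_comp[OF g'(1), of g] g'(2) g'g by (simp_all add: lin_mat_id)
  ultimately have "similar_mat_wit ?M (lin_mat L) (lin_mat g') (lin_mat g)"
    by (intro similar_mat_witI[of _ _ ?D]) (use lin_mat_carrier[of "g' \<circ> L \<circ> g"] in auto)
  then have "similar_mat ?M (lin_mat L)"
    unfolding similar_mat_def by blast
  then have cp: "char_poly (lin_mat L) = char_poly ?M"
    using char_poly_similar[of ?M] by simp
  have "[:- e, 1:] ^ m dvd char_poly ?M"
    unfolding char_poly_def
  proof (rule power_dvd_det_cols[OF _ mD])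
    fix i j assume i: "i < ?D" and j: "j < m"
    have "g' (L (g (basis_enum j))) = e *\<^sub>R g' (g (basis_enum j))"
      using hK[OF j] j mD ge[of j] g'(1) by (simp add: linear_scale)
    also have "\<dots> = e *\<^sub>R basis_enum j" using fun_cong[OF g'g, of "basis_enum j"] by simp
    finally have "?M $$ (i, j) = (if i = j then e else 0)"
      using i j mD by (simp add: lin_mat_def inner_basis_enum)
    then have "char_poly_matrix ?M $$ (i, j) = (if i = j then [:- e, 1:] else 0)"
      using i j mD by (simp add: char_poly_matrix_def lin_mat_def)
    then show "[:- e, 1:] dvd char_poly_matrix ?M $$ (i, j)" by simp
  qed (use lin_mat_carrier[of "g' \<circ> L \<circ> g"] in simp)
  moreover have "[:- e, 1:] ^ k dvd [:- e, 1:] ^ m"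
    using k by (simp add: le_imp_power_dvd m_def)
  ultimately show ?thesis unfolding cp by (rule dvd_trans[rotated])
qed

section \<open>Pencils and the open mapping argument\<close>

text \<open>Finitely many of the sets \<open>A t\<close> cover \<open>K\<close>; the intersection of
  the corresponding sets \<open>B t\<close> serves all of \<open>K\<close> at once.\<close>

lemma compact_tube:
  assumes "compact K"
    and "\<And>t. t \<in> K \<Longrightarrow> \<exists>A B. open A \<and> t \<in> A \<and> open B \<and> x \<in> B \<and> (\<forall>t'\<in>A. \<forall>x'\<in>B. P t' x')"
  shows "\<exists>B. open B \<and> x \<in> B \<and> (\<forall>t\<in>K. \<forall>x'\<in>B. P t x')"
proof -
  obtain A B where AB: "\<And>t. t \<in> K \<Longrightarrow> open (A t) \<and> t \<in> A t \<and> open (B t) \<and> x \<in> B t \<and>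
      (\<forall>t'\<in>A t. \<forall>x'\<in>B t. P t' x')"
    using assms(2) by metis
  obtain C where C: "C \<subseteq> K" "finite C" "K \<subseteq> (\<Union>t\<in>C. A t)"
    by (rule compactE_image[OF assms(1), of K A]) (use AB in auto)
  show ?thesis
  proof (intro exI[of _ "\<Inter>t\<in>C. B t"] conjI ballI)
    show "open (\<Inter>t\<in>C. B t)" using C AB by (intro open_INT) auto
    show "x \<in> (\<Inter>t\<in>C. B t)" using C AB by auto
    fix t x' assume "t \<in> K" "x' \<in> (\<Inter>t\<in>C. B t)"
    then show "P t x'" using C AB by blast
  qed
qed

text \<open>The right-hand side is the value at \<open>x\<close> of a polynomial of degree below
  \<open>card A\<close> that agrees with \<open>q\<close> on \<open>A\<close>, and two such
  polynomials coincide.\<close>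

lemma poly_lagrange:
  fixes q :: "real poly"
  assumes "finite A" "degree q < card A"
  shows "poly q x = (\<Sum>a\<in>A. poly q a * (\<Prod>b\<in>A - {a}. (x - b) / (a - b)))"
proof -
  define l where "l a = (\<Prod>b\<in>A - {a}. Polynomial.smult (1 / (a - b)) [:- b, 1:])" for a
  have pl: "poly (l a) y = (\<Prod>b\<in>A - {a}. (y - b) / (a - b))" for a y
    unfolding l_def poly_prod by (intro prod.cong) (simp_all add: divide_inverse algebra_simps)
  have "degree (l a) \<le> (\<Sum>b\<in>A - {a}. 1)" for a
    unfolding l_def by (rule order_trans[OF degree_prod_sum_le sum_mono]) (use assms(1) in auto)
  then have "degree (l a) \<le> card (A - {a})" for a by simp
  then have dl: "degree (l a) \<le> card A - 1" if "a \<in> A" for a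
    using that by (metis card_Diff_singleton)
  define p where "p = (\<Sum>a\<in>A. Polynomial.smult (poly q a) (l a))"
  have "degree p \<le> card A - 1"
    unfolding p_def using dl assms(1) by (intro degree_sum_le) (auto intro: order_trans[OF degree_smult_le])
  then have "degree p < card A" using assms(2) by linarith
  moreover have "poly q a = poly p a" if "a \<in> A" for a
  proof -
    have "poly (l c) a = (if c = a then 1 else 0)" if "c \<in> A" for c
    proof (cases "c = a")
      case False
      then have "poly (l c) a = 0"
        unfolding pl using \<open>a \<in> A\<close> assms(1) by (intro prod_zero) auto
      then show ?thesis using False by simp
    next
      case True
      have "(\<Prod>b\<in>A - {a}. (a - b) / (a - b)) = 1" by (intro prod.neutral) auto
      then show ?thesis using True by (simp add: pl)
    qed
    then have "poly p a = (\<Sum>c\<in>A. if c = a then poly q c else 0)"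
      unfolding p_def poly_sum by (intro sum.cong) simp_all
    then show ?thesis using that assms(1) by simp
  qed
  ultimately have "q = p" using assms(2) by (intro poly_eqI_degree[of A]) auto
  then have "poly q x = poly p x" by simp
  then show ?thesis by (simp add: p_def poly_sum pl)
qed

section \<open>The pencil of derivatives and the characteristic polynomial\<close>

text \<open>Abstract setting for a single index: \<open>p\<close> and \<open>z\<close> stand for
  \<open>\<pi>\<^sub>i\<close> and \<open>z\<^sub>i\<close>, and \<open>S\<close> for an open ball
  around the origin.\<close>

locale unfolding_pencil =
  fixes p z :: "'a::euclidean_space \<Rightarrow> 'a" and S :: "'a set"
  assumes open_S: "open S" and p_C1: "Ck_on 1 S p" and z_C1: "Ck_on 1 S z"
    and det_Dp: "\<And>\<rho>. \<rho> \<in> S \<Longrightarrow> Determinant.det (lin_mat (frechet_derivative p (at \<rho>))) \<noteq> 0"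
begin

abbreviation Dp where "Dp \<rho> \<equiv> frechet_derivative p (at \<rho>)"
abbreviation Dz where "Dz \<rho> \<equiv> frechet_derivative z (at \<rho>)"

definition M :: "'a \<Rightarrow> real Matrix.mat" where
  "M \<rho> = lin_mat (inv_into UNIV (Dp \<rho>) \<circ> Dz \<rho>)"

text \<open>Two parameters serve both viewpoints: \<open>pencil 1 t\<close> is the derivative of
  \<open>p + t z\<close>, and \<open>pencil x (- 1)\<close> is \<open>Dp\<close> times the
  characteristic matrix of \<open>M\<close> at \<open>x\<close>. The second form remains meaningful
  without dividing by \<open>t\<close>.\<close>

definition pencil :: "real \<Rightarrow> real \<Rightarrow> 'a \<Rightarrow> real Matrix.mat" where
  "pencil x y \<rho> = lin_mat (\<lambda>v. x *\<^sub>R Dp \<rho> v + y *\<^sub>R Dz \<rho> v)"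

lemma has_derivative_p: "\<rho> \<in> S \<Longrightarrow> (p has_derivative Dp \<rho>) (at \<rho>)"
  using Ck_on_Suc_has_derivative p_C1[unfolded One_nat_def] by blast

lemma has_derivative_z: "\<rho> \<in> S \<Longrightarrow> (z has_derivative Dz \<rho>) (at \<rho>)"
  using Ck_on_Suc_has_derivative z_C1[unfolded One_nat_def] by blast

lemma linear_Dp: "\<rho> \<in> S \<Longrightarrow> linear (Dp \<rho>)" and linear_Dz: "\<rho> \<in> S \<Longrightarrow> linear (Dz \<rho>)"
  using has_derivative_p has_derivative_z has_derivative_linear by blast+

lemma linear_pencil: "\<rho> \<in> S \<Longrightarrow> linear (\<lambda>v. x *\<^sub>R Dp \<rho> v + y *\<^sub>R Dz \<rho> v)"
  by (intro linear_compose_add linear_compose_scale_right linear_Dp linear_Dz)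

lemma bij_Dp: "\<rho> \<in> S \<Longrightarrow> bij (Dp \<rho>)"
  by (intro bij_if_det_lin_mat_nonzero linear_Dp det_Dp)

lemma linear_inv_Dp: "\<rho> \<in> S \<Longrightarrow> linear (inv_into UNIV (Dp \<rho>))"
  by (rule inj_linear_imp_inv_linear[OF linear_Dp bij_is_inj[OF bij_Dp]])

lemma linear_M: "\<rho> \<in> S \<Longrightarrow> linear (inv_into UNIV (Dp \<rho>) \<circ> Dz \<rho>)"
  by (intro linear_compose linear_Dz linear_inv_Dp)

lemma M_carrier [simp]: "M \<rho> \<in> carrier_mat DIM('a) DIM('a)"
  by (simp add: M_def)

lemma pencil_carrier [simp]: "pencil x y \<rho> \<in> carrier_mat DIM('a) DIM('a)"
  by (simp add: pencil_def)

lemma dim_M [simp]: "dim_row (M \<rho>) = DIM('a)" "dim_col (M \<rho>) = DIM('a)"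
  by (simp_all add: M_def lin_mat_def)

lemma dim_pencil [simp]: "dim_row (pencil x y \<rho>) = DIM('a)" "dim_col (pencil x y \<rho>) = DIM('a)"
  by (simp_all add: pencil_def lin_mat_def)

text \<open>As \<open>Dp \<rho>\<close> is invertible, it can be factored out of
  \<open>x Dp - Dz\<close>.\<close>

lemma pencil_minus_one:
  assumes "\<rho> \<in> S"
  shows "pencil x (- 1) \<rho> = lin_mat (Dp \<rho>) * (x \<cdot>\<^sub>m 1\<^sub>m DIM('a) - M \<rho>)"
proof -
  have "(\<lambda>v. x *\<^sub>R Dp \<rho> v + (- 1) *\<^sub>R Dz \<rho> v) =
      Dp \<rho> \<circ> (\<lambda>v. x *\<^sub>R id v - (inv_into UNIV (Dp \<rho>) \<circ> Dz \<rho>) v)"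
    using linear_Dp[OF assms] bij_Dp[OF assms]
    by (auto simp: fun_eq_iff linear_diff linear_scale bij_def surj_f_inv_f)
  then show ?thesis
    using lin_mat_comp[OF linear_Dp[OF assms]]
    unfolding pencil_def M_def lin_mat_id[symmetric] lin_mat_scale_diff[symmetric] by simp
qed

lemma det_pencil_minus_one:
  assumes "\<rho> \<in> S"
  shows "Determinant.det (pencil x (- 1) \<rho>) =
    Determinant.det (lin_mat (Dp \<rho>)) * poly (char_poly (M \<rho>)) x"
proof -
  have "x \<cdot>\<^sub>m 1\<^sub>m DIM('a) - M \<rho> = - (char_matrix (M \<rho>) x)"
    by (intro eq_matI) (auto simp: char_matrix_def)
  then show ?thesis
    unfolding pencil_minus_one[OF assms] char_poly_matrix[OF M_carrier]
    by (subst det_mult[of _ "DIM('a)"]) auto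
qed

lemma pencil_one:
  assumes "t \<noteq> 0"
  shows "pencil 1 t \<rho> = (- t) \<cdot>\<^sub>m pencil (- 1 / t) (- 1) \<rho>"
  using assms by (intro eq_matI) (auto simp: pencil_def lin_mat_def inner_add_left algebra_simps)

text \<open>Singular parameters \<open>t\<close> correspond to roots \<open>- 1 / t\<close> of the
  characteristic polynomial; these lie below -1 exactly when 0 < t < 1.\<close>

lemma det_pencil_one:
  assumes "\<rho> \<in> S" "t \<noteq> 0"
  shows "Determinant.det (pencil 1 t \<rho>) =
    (- t) ^ DIM('a) * (Determinant.det (lin_mat (Dp \<rho>)) * poly (char_poly (M \<rho>)) (- 1 / t))"
  using assms by (simp add: pencil_one det_pencil_minus_one)

section \<open>Joint continuity in the parameters and regularity as an open condition\<close>

lemma continuous_on_Dp: "continuous_on S (\<lambda>\<rho>. Dp \<rho> v)"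
  and continuous_on_Dz: "continuous_on S (\<lambda>\<rho>. Dz \<rho> v)"
  using Ck_on_frechet_derivative[OF open_S, of 0 p v] Ck_on_frechet_derivative[OF open_S, of 0 z v] p_C1 z_C1
  by simp_all

lemma continuous_on_p: "continuous_on S p" and continuous_on_z: "continuous_on S z"
  using p_C1 z_C1 Ck_on_imp_continuous_on by blast+

lemma continuous_on_pencil_entry:
  "continuous_on (UNIV \<times> UNIV \<times> S)
     (\<lambda>w. ((fst w *\<^sub>R Dp (snd (snd w)) u + fst (snd w) *\<^sub>R Dz (snd (snd w)) u) \<bullet> v :: real))"
  by (intro continuous_intros continuous_on_compose2[OF continuous_on_Dp]
      continuous_on_compose2[OF continuous_on_Dz]) auto

lemma continuous_on_det_pencil:
  "continuous_on (UNIV \<times> UNIV \<times> S) (\<lambda>w. Determinant.det (pencil (fst w) (fst (snd w)) (snd (snd w))))"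
proof -
  have "Ck_on 0 (UNIV \<times> UNIV \<times> S)
    (\<lambda>w. Determinant.det (Matrix.mat DIM('a) DIM('a) (\<lambda>(i, j).
      (fst w *\<^sub>R Dp (snd (snd w)) (basis_enum j) + fst (snd w) *\<^sub>R Dz (snd (snd w)) (basis_enum j)) \<bullet> basis_enum i)))"
    using continuous_on_pencil_entry by (intro Ck_on_det_mat open_Times open_UNIV open_S) simp_all
  then show ?thesis by (simp add: pencil_def lin_mat_def)
qed

lemma continuous_on_det_replace_col_pencil:
  "continuous_on (UNIV \<times> UNIV \<times> S)
    (\<lambda>w. Determinant.det (replace_col (pencil (fst w) (fst (snd w)) (snd (snd w))) (coord_vec (z (snd (snd w)))) k))"
proof -
  let ?f = "\<lambda>w (i, j). if j = k then z (snd (snd w)) \<bullet> basis_enum i else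
      (fst w *\<^sub>R Dp (snd (snd w)) (basis_enum j) + fst (snd w) *\<^sub>R Dz (snd (snd w)) (basis_enum j)) \<bullet> basis_enum i"
  have "Ck_on 0 (UNIV \<times> UNIV \<times> S) (\<lambda>w. Determinant.det (Matrix.mat DIM('a) DIM('a) (?f w)))"
  proof (intro Ck_on_det_mat open_Times open_UNIV open_S)
    fix i j
    have "continuous_on (UNIV \<times> UNIV \<times> S) (\<lambda>w. z (snd (snd w)) \<bullet> basis_enum i)"
      by (intro continuous_intros continuous_on_compose2[OF continuous_on_z]) auto
    then show "Ck_on 0 (UNIV \<times> UNIV \<times> S) (\<lambda>w. ?f w (i, j))"
      using continuous_on_pencil_entry by (cases "j = k") simp_all
  qed
  moreover have "replace_col (pencil (fst w) (fst (snd w)) (snd (snd w))) (coord_vec (z (snd (snd w)))) k =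
      Matrix.mat DIM('a) DIM('a) (?f w)" for w
    by (intro eq_matI) (auto simp: replace_col_def pencil_def lin_mat_def coord_vec_def)
  ultimately show ?thesis by simp
qed

text \<open>By Cramer's rule the second alternative says that \<open>(t, \<rho>) \<mapsto> p \<rho> + t z \<rho>\<close> is a submersion.\<close>

definition regular_at :: "real \<Rightarrow> 'a \<Rightarrow> bool" where
  "regular_at t \<rho> \<longleftrightarrow> Determinant.det (pencil 1 t \<rho>) \<noteq> 0 \<or>
     (\<exists>k<DIM('a). Determinant.det (replace_col (pencil 1 t \<rho>) (coord_vec (z \<rho>)) k) \<noteq> 0)"

text \<open>Each alternative says that a function continuous in \<open>t\<close> and
  \<open>\<rho>\<close> does not vanish. In the second one the column index \<open>k\<close> is kept
  fixed throughout the neighbourhood.\<close>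

lemma open_regular_at:
  assumes "\<rho> \<in> S" "regular_at t \<rho>"
  shows "\<exists>A B. open A \<and> t \<in> A \<and> open B \<and> \<rho> \<in> B \<and> (\<forall>t'\<in>A. \<forall>\<rho>'\<in>B. regular_at t' \<rho>')"
proof -
  have key: "\<exists>A B. open A \<and> t \<in> A \<and> open B \<and> \<rho> \<in> B \<and> (\<forall>t'\<in>A. \<forall>\<rho>'\<in>B. h (1, t', \<rho>') \<noteq> 0)"
    if h: "continuous_on (UNIV \<times> UNIV \<times> S) h" "h (1, t, \<rho>) \<noteq> 0" for h :: "real \<times> real \<times> 'a \<Rightarrow> real"
  proof -
    have "open {w \<in> UNIV \<times> UNIV \<times> S. h w \<noteq> 0}"
    proof -
      have "open ((UNIV \<times> UNIV \<times> S) \<inter> h -` (- {0}))"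
        by (rule continuous_open_preimage[OF h(1)]) (auto intro: open_Times open_S)
      moreover have "(UNIV \<times> UNIV \<times> S) \<inter> h -` (- {0}) = {w \<in> UNIV \<times> UNIV \<times> S. h w \<noteq> 0}" by auto
      ultimately show ?thesis by simp
    qed
    moreover have "(1, t, \<rho>) \<in> {w \<in> UNIV \<times> UNIV \<times> S. h w \<noteq> 0}" using assms(1) h(2) by simp
    \<comment> \<open>The first splitting removes the pencil parameter frozen at 1, the second one
      separates \<open>t\<close> from \<open>\<rho>\<close>.\<close>
    ultimately obtain A C where AC: "open A" "open C" "1 \<in> A" "(t, \<rho>) \<in> C" "A \<times> C \<subseteq> {w \<in> UNIV \<times> UNIV \<times> S. h w \<noteq> 0}"
      by (rule open_prod_elim) (auto simp: subset_eq)
    from AC(2,4) obtain A' B where "open A'" "open B" "t \<in> A'" "\<rho> \<in> B" "A' \<times> B \<subseteq> C"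
      by (rule open_prod_elim) (auto simp: subset_eq)
    with AC show ?thesis by (intro exI[of _ A'] exI[of _ B]) auto
  qed
  show ?thesis
  proof (cases "Determinant.det (pencil 1 t \<rho>) \<noteq> 0")
    case True
    then show ?thesis
      using key[OF continuous_on_det_pencil] unfolding regular_at_def by fastforce
  next
    case False
    then obtain k where k: "k < DIM('a)" "Determinant.det (replace_col (pencil 1 t \<rho>) (coord_vec (z \<rho>)) k) \<noteq> 0"
      using assms(2) unfolding regular_at_def by blast
    then obtain A B where "open A" "t \<in> A" "open B" "\<rho> \<in> B"
      "\<forall>t'\<in>A. \<forall>\<rho>'\<in>B. Determinant.det (replace_col (pencil 1 t' \<rho>') (coord_vec (z \<rho>')) k) \<noteq> 0"
      using key[OF continuous_on_det_replace_col_pencil[of k]] by auto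
    then show ?thesis using k(1) unfolding regular_at_def by blast
  qed
qed

text \<open>Sussmann's theorem puts the image of a point into the interior of the image once the
  derivative there has a linear right inverse. If the pencil is invertible, this is applied with
  \<open>t\<close> fixed; otherwise \<open>t\<close> becomes a variable.\<close>

lemma open_family_image:
  assumes "open B" "B \<subseteq> S" "\<And>t \<rho>. t \<in> {0..<lam} \<Longrightarrow> \<rho> \<in> B \<Longrightarrow> regular_at t \<rho>"
  shows "open (\<Union>t\<in>{0..<lam}. (\<lambda>\<rho>. p \<rho> + t *\<^sub>R z \<rho>) ` B)" (is "open ?\<Sigma>")
proof -
  have "y \<in> interior ?\<Sigma>" if "y \<in> ?\<Sigma>" for y
  proof -
    obtain t \<rho> where t: "t \<in> {0..<lam}" and \<rho>: "\<rho> \<in> B" and y: "y = p \<rho> + t *\<^sub>R z \<rho>"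
      using \<open>y \<in> ?\<Sigma>\<close> by (elim UN_E imageE)
    then have \<rho>S: "\<rho> \<in> S" using assms(2) by auto
    have cp: "continuous_on B p" and cz: "continuous_on B z"
      using continuous_on_p continuous_on_z assms(2) continuous_on_subset by blast+
    let ?L = "\<lambda>v. 1 *\<^sub>R Dp \<rho> v + t *\<^sub>R Dz \<rho> v"
    show ?thesis
    proof (cases "Determinant.det (pencil 1 t \<rho>) \<noteq> 0")
      case True
      then have "surj ?L"
        using bij_if_det_lin_mat_nonzero[OF linear_pencil[OF \<rho>S, of 1 t]] by (simp add: pencil_def bij_def)
      then obtain g' where "linear g'" "?L \<circ> g' = id"
        using linear_surjective_right_inverse[OF linear_pencil[OF \<rho>S, of 1 t]] by blast
      moreover have "((\<lambda>\<rho>. p \<rho> + t *\<^sub>R z \<rho>) has_derivative ?L) (at \<rho>)"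
        using has_derivative_add[OF has_derivative_p[OF \<rho>S] has_derivative_scaleR_right[OF has_derivative_z[OF \<rho>S]]]
        by simp
      moreover have "continuous_on B (\<lambda>\<rho>. p \<rho> + t *\<^sub>R z \<rho>)"
        by (intro continuous_intros cp cz)
      ultimately have "p \<rho> + t *\<^sub>R z \<rho> \<in> interior ((\<lambda>\<rho>. p \<rho> + t *\<^sub>R z \<rho>) ` B)"
        using \<rho> assms(1)
        by (intro sussmann_open_mapping[of B _ \<rho> ?L g']) (simp_all add: linear_conv_bounded_linear interior_open)
      also have "\<dots> \<subseteq> interior ?\<Sigma>" using t by (intro interior_mono) auto
      finally show ?thesis by (simp add: y)
    next
      case False
      \<comment> \<open>At \<open>t = 0\<close> the pencil is the invertible \<open>Dp\<close>, so a
        singular \<open>t\<close> is positive. It is then an interior point of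
        \<open>{0..<lam}\<close> and may be moved in both directions.\<close>
      have "pencil 1 0 \<rho> = lin_mat (Dp \<rho>)" by (simp add: pencil_def)
      then have "t \<noteq> 0" using False det_Dp[OF \<rho>S] by auto
      then have t0: "0 < t" using t by auto
      obtain k where k: "k < DIM('a)" "Determinant.det (replace_col (pencil 1 t \<rho>) (coord_vec (z \<rho>)) k) \<noteq> 0"
        using False assms(3)[OF t \<rho>] unfolding regular_at_def by blast
      \<comment> \<open>\<open>?f'\<close> is the derivative of \<open>?f\<close> in both variables
        at \<open>(t, \<rho>)\<close>; the term with \<open>z \<rho>\<close> comes from varying
        \<open>t\<close>.\<close>
      let ?f = "\<lambda>(s, \<rho>). p \<rho> + s *\<^sub>R z \<rho>" and ?f' = "\<lambda>(s, v). s *\<^sub>R z \<rho> + ?L v"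
      have "surj ?f'"
        using surj_if_det_replace_col_nonzero[OF linear_pencil[OF \<rho>S, of 1 t] k(1)] k(2) unfolding pencil_def by simp
      moreover have "linear ?f'"
        using linear_add[OF linear_Dp[OF \<rho>S]] linear_add[OF linear_Dz[OF \<rho>S]]
          linear_scale[OF linear_Dp[OF \<rho>S]] linear_scale[OF linear_Dz[OF \<rho>S]]
        by (intro linearI) (auto simp: algebra_simps)
      ultimately obtain g' where g': "linear g'" "?f' \<circ> g' = id"
        using linear_surjective_right_inverse by blast
      have snd: "(snd has_derivative snd) (at (t, \<rho>))"
        using bounded_linear_imp_has_derivative[OF bounded_linear_snd] .
      have ps: "((\<lambda>w. p (snd w)) has_derivative (\<lambda>w. Dp \<rho> (snd w))) (at (t, \<rho>))"
        and zs: "((\<lambda>w. z (snd w)) has_derivative (\<lambda>w. Dz \<rho> (snd w))) (at (t, \<rho>))"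
        using has_derivative_compose[OF snd, of p "Dp \<rho>"] has_derivative_compose[OF snd, of z "Dz \<rho>"]
          has_derivative_p[OF \<rho>S] has_derivative_z[OF \<rho>S] by simp_all
      have "((\<lambda>w. p (snd w) + fst w *\<^sub>R z (snd w)) has_derivative
          (\<lambda>w. Dp \<rho> (snd w) + (t *\<^sub>R Dz \<rho> (snd w) + fst w *\<^sub>R z \<rho>))) (at (t, \<rho>))"
        using has_derivative_add[OF ps has_derivative_scaleR[OF
            bounded_linear_imp_has_derivative[OF bounded_linear_fst] zs]]
        by simp
      then have der: "(?f has_derivative ?f') (at (t, \<rho>))"
        unfolding case_prod_beta by (rule has_derivative_eq_rhs) (auto simp: fun_eq_iff)
      have "?f (t, \<rho>) \<in> interior (?f ` ({0<..<lam} \<times> B))"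
      proof (rule sussmann_open_mapping[where S="{0<..<lam} \<times> B" and g'=g', OF _ _ _ der _ g'(2)])
        show "open ({0<..<lam} \<times> B)" using assms(1) by (simp add: open_Times)
        then show "(t, \<rho>) \<in> interior ({0<..<lam} \<times> B)" using t0 t \<rho> by (simp add: interior_open)
        show "continuous_on ({0<..<lam} \<times> B) ?f"
          unfolding case_prod_beta
          by (intro continuous_intros continuous_on_compose2[OF cp] continuous_on_compose2[OF cz]) auto
      qed (use g' t0 t \<rho> in \<open>auto simp: linear_conv_bounded_linear\<close>)
      also have "\<dots> \<subseteq> interior ?\<Sigma>" by (intro interior_mono) force
      finally show ?thesis by (simp add: y)
    qed
  qed
  then have "interior ?\<Sigma> = ?\<Sigma>" using interior_subset[of ?\<Sigma>] by blast
  then show ?thesis using open_interior[of ?\<Sigma>] by (rule subst)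
qed

end

text \<open>By Cramer's rule this determinant is a coordinate of \<open>adj_mat A\<close> applied to
  the inserted column, hence linear in that column.\<close>

lemma det_replace_col_smult:
  fixes A :: "'a::field mat"
  assumes "A \<in> carrier_mat n n" "b \<in> carrier_vec n" "k < n"
  shows "Determinant.det (replace_col A (c \<cdot>\<^sub>v b) k) = c * Determinant.det (replace_col A b k)"
proof -
  have "adj_mat A *\<^sub>v (c \<cdot>\<^sub>v b) = c \<cdot>\<^sub>v (adj_mat A *\<^sub>v b)"
    using mult_mat_vec[OF adj_mat(1)[OF assms(1)] assms(2)] by simp
  moreover have "dim_vec (adj_mat A *\<^sub>v b) = n" using adj_mat(1)[OF assms(1)] by simp
  ultimately show ?thesis
    using adj_mat_mult_vec_nth[OF assms(1) _ assms(3), of "c \<cdot>\<^sub>v b"] adj_mat_mult_vec_nth[OF assms] assms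
    by simp
qed

text \<open>The power of x does not vanish at -1, so dividing it out leaves the multiplicity of the
  root -1 unchanged.\<close>

lemma coprime_linear_powers_dvd:
  fixes p :: "real poly"
  assumes "[:0, 1:] ^ a dvd p" "[:1, 1:] ^ b dvd p"
  shows "[:0, 1:] ^ a * [:1, 1:] ^ b dvd p"
proof (cases "p = 0")
  case False
  obtain q where q: "p = [:0, 1:] ^ a * q" using assms(1) by blast
  then have "q \<noteq> 0" and nz: "[:0, 1:] ^ a * q \<noteq> 0" using False by auto
  have "order (- 1) ([:0, 1:] ^ a :: real poly) = 0"
    by (rule order_0I) (simp add: poly_power)
  then have "order (- 1) q = order (- 1) p"
    unfolding q using order_mult[OF nz, of "- 1"] by simp
  then have "[:1, 1:] ^ b dvd q"
    using assms(2) False \<open>q \<noteq> 0\<close> order_divides[of "- 1" b q] order_divides[of "- 1" b p] by simp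
  then show ?thesis unfolding q by (rule mult_dvd_mono[OF dvd_refl])
qed simp

section \<open>The cofactor of the characteristic polynomial and regularity near the origin\<close>

context unfolding_pencil
begin

lemma pencil_one_zero: "pencil 1 0 \<rho> = lin_mat (Dp \<rho>)"
  by (simp add: pencil_def)

context
  fixes a b :: nat and D :: "real poly"
  assumes zero_in_S: "0 \<in> S"
    and D_def: "D = [:0, 1:] ^ a * [:1, 1:] ^ b"
    and D_dvd: "\<And>\<rho>. \<rho> \<in> S \<Longrightarrow> D dvd char_poly (M \<rho>)"
begin

lemma poly_D_nonzero: "x \<noteq> 0 \<Longrightarrow> x \<noteq> - 1 \<Longrightarrow> poly D x \<noteq> 0"
  by (auto simp: D_def poly_power)

lemma poly_char_poly_M:
  "\<rho> \<in> S \<Longrightarrow> poly (char_poly (M \<rho>)) x = poly D x * poly (char_poly (M \<rho>) div D) x"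
  using D_dvd by (metis dvd_mult_div_cancel poly_mult)

text \<open>Interpolation expresses the cofactor through finitely many determinants, so that its
  continuity in \<open>\<rho>\<close> becomes visible.\<close>

lemma poly_cofactor_eq_sum:
  fixes x :: real
  assumes "\<rho> \<in> S"
  defines "A \<equiv> real ` {1..DIM('a) + 1}"
  shows "poly (char_poly (M \<rho>) div D) x =
    (\<Sum>c\<in>A. Determinant.det (pencil c (- 1) \<rho>) / Determinant.det (pencil 1 0 \<rho>) / poly D c *
      (\<Prod>e\<in>A - {c}. (x - e) / (c - e)))"
proof -
  let ?Q = "char_poly (M \<rho>) div D"
  have \<chi>: "degree (char_poly (M \<rho>)) = DIM('a)" "char_poly (M \<rho>) \<noteq> 0"
    using degree_monic_char_poly[OF M_carrier[of \<rho>]] by auto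
  have "degree (char_poly (M \<rho>)) = degree D + degree ?Q"
    using \<chi>(2) D_dvd[OF assms(1)] by (metis degree_mult_eq dvd_mult_div_cancel mult_zero_left mult_zero_right)
  \<comment> \<open>\<open>DIM('a) + 1\<close> nodes are enough for any factor of the characteristic
    polynomial.\<close>
  moreover have "card A = DIM('a) + 1" unfolding A_def by (subst card_image) (auto simp: inj_on_def)
  ultimately have "degree ?Q < card A" using \<chi>(1) by simp
  then have "poly ?Q x = (\<Sum>c\<in>A. poly ?Q c * (\<Prod>e\<in>A - {c}. (x - e) / (c - e)))"
    by (intro poly_lagrange) (auto simp: A_def)
  also have "\<dots> = (\<Sum>c\<in>A. Determinant.det (pencil c (- 1) \<rho>) / Determinant.det (pencil 1 0 \<rho>) / poly D c *
      (\<Prod>e\<in>A - {c}. (x - e) / (c - e)))"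
  proof (rule sum.cong[OF refl])
    fix c assume "c \<in> A"
    \<comment> \<open>The nodes are positive and so avoid the roots 0 and -1 of
      \<open>D\<close>.\<close>
    then have "poly D c \<noteq> 0" unfolding A_def by (intro poly_D_nonzero) auto
    then have "poly ?Q c = Determinant.det (pencil c (- 1) \<rho>) / Determinant.det (pencil 1 0 \<rho>) / poly D c"
      using det_pencil_minus_one[OF assms(1), of c] poly_char_poly_M[OF assms(1), of c] det_Dp[OF assms(1)]
      by (simp add: pencil_one_zero)
    then show "poly ?Q c * (\<Prod>e\<in>A - {c}. (x - e) / (c - e)) =
      Determinant.det (pencil c (- 1) \<rho>) / Determinant.det (pencil 1 0 \<rho>) / poly D c *
      (\<Prod>e\<in>A - {c}. (x - e) / (c - e))" by simp
  qed
  finally show ?thesis .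
qed

lemma continuous_on_det_pencil_const:
  "continuous_on S (\<lambda>\<rho>. Determinant.det (pencil x y \<rho>))"
  using continuous_on_compose2[OF continuous_on_det_pencil, of S "\<lambda>\<rho>. (x, y, \<rho>)"]
  by (force intro: continuous_intros)

text \<open>The domain is all of \<open>t > 0\<close> because neighbourhoods of \<open>t = 1\<close>
  are needed, where the cofactor is evaluated near -1.\<close>

lemma continuous_on_poly_cofactor:
  "continuous_on ({0<..} \<times> S) (\<lambda>w. poly (char_poly (M (snd w)) div D) (- 1 / fst w))"
proof -
  let ?A = "real ` {1..DIM('a) + 1}"
  have "continuous_on ({0<..} \<times> S) (\<lambda>w. \<Sum>c\<in>?A. Determinant.det (pencil c (- 1) (snd w)) /
      Determinant.det (pencil 1 0 (snd w)) / poly D c * (\<Prod>e\<in>?A - {c}. (- 1 / fst w - e) / (c - e)))"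
  proof (intro continuous_on_sum continuous_on_mult continuous_on_prod)
    fix c assume "c \<in> ?A"
    then have "poly D c \<noteq> 0" by (intro poly_D_nonzero) auto
    then show "continuous_on ({0<..} \<times> S) (\<lambda>w. Determinant.det (pencil c (- 1) (snd w)) /
      Determinant.det (pencil 1 0 (snd w)) / poly D c)"
      using det_Dp
      by (intro continuous_intros continuous_on_compose2[OF continuous_on_det_pencil_const])
        (auto simp: pencil_one_zero)
    fix e assume "e \<in> ?A - {c}"
    then show "continuous_on ({0<..} \<times> S) (\<lambda>w. (- 1 / fst w - e) / (c - e))"
      by (intro continuous_intros) auto
  qed
  then show ?thesis
    by (rule continuous_on_cong[THEN iffD1, rotated 2]) (auto simp: poly_cofactor_eq_sum)
qed

text \<open>If the pencil is singular, \<open>x = - 1 / t\<close> is a root of the cofactor below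
  -1, and some coordinate of the vector in \<open>adj\<close> is nonzero. By Cramer's rule that
  coordinate is the determinant of the characteristic matrix with one column replaced;
  multiplication by \<open>Dp 0\<close> turns it into a pencil with \<open>z 0\<close> as that
  column.\<close>

lemma regular_at_zero:
  assumes "0 \<le> t" "t < 1"
    and adj: "\<And>x. x < - 1 \<Longrightarrow> poly (char_poly (M 0) div D) x = 0 \<Longrightarrow>
      adj_mat (x \<cdot>\<^sub>m 1\<^sub>m DIM('a) - M 0) *\<^sub>v (adj_mat (lin_mat (Dp 0)) *\<^sub>v coord_vec (z 0)) \<noteq> 0\<^sub>v DIM('a)"
  shows "regular_at t 0"
proof (cases "Determinant.det (pencil 1 t 0) \<noteq> 0")
  case False
  have "t \<noteq> 0" using False det_Dp[OF zero_in_S] pencil_one_zero[of 0] by auto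
  define x where "x = - 1 / t"
  have x: "x < - 1" using assms(1,2) \<open>t \<noteq> 0\<close> by (simp add: x_def field_simps)
  have "poly (char_poly (M 0)) x = 0"
    using False det_pencil_one[OF zero_in_S \<open>t \<noteq> 0\<close>] \<open>t \<noteq> 0\<close> det_Dp[OF zero_in_S] by (simp add: x_def)
  then have Q: "poly (char_poly (M 0) div D) x = 0"
    using poly_char_poly_M[OF zero_in_S, of x] poly_D_nonzero[of x] x by auto
  let ?n = "DIM('a)" and ?Dp = "lin_mat (Dp 0)" and ?z = "coord_vec (z 0)" and ?P = "pencil x (- 1) 0"
  let ?A = "x \<cdot>\<^sub>m 1\<^sub>m ?n - M 0" and ?w = "adj_mat (lin_mat (Dp 0)) *\<^sub>v coord_vec (z 0)"
  let ?\<delta> = "Determinant.det (lin_mat (Dp 0))"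
  have A: "?A \<in> carrier_mat ?n ?n" using minus_carrier_mat[OF M_carrier] .
  have aDp: "adj_mat ?Dp \<in> carrier_mat ?n ?n" by (rule adj_mat) simp
  then have w: "?w \<in> carrier_vec ?n" by simp
  have "dim_vec (adj_mat ?A *\<^sub>v ?w) = ?n" using adj_mat(1)[OF A] by simp
  then obtain k where k: "k < ?n" "vec_index (adj_mat ?A *\<^sub>v ?w) k \<noteq> 0"
    using adj[OF x Q] by (metis Matrix.eq_vecI index_zero_vec)
  then have "Determinant.det (replace_col ?A ?w k) \<noteq> 0"
    by (simp add: adj_mat_mult_vec_nth[OF A w])
  moreover have "replace_col ?A ?w k \<in> carrier_mat ?n ?n" by (simp add: replace_col_def)
  ultimately have "Determinant.det (?Dp * replace_col ?A ?w k) \<noteq> 0"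
    using det_Dp[OF zero_in_S] by (simp add: det_mult[of _ ?n])
  moreover have "?Dp * replace_col ?A ?w k = replace_col ?P (?Dp *\<^sub>v ?w) k"
    unfolding pencil_minus_one[OF zero_in_S] by (rule mult_replace_col[OF A _ w k(1)]) simp
  \<comment> \<open>A matrix times its adjugate is its determinant times the identity, so the
    inserted column becomes a nonzero multiple of \<open>z 0\<close>.\<close>
  moreover have "?Dp *\<^sub>v ?w = ?\<delta> \<cdot>\<^sub>v ?z"
  proof -
    have "?Dp *\<^sub>v ?w = (?Dp * adj_mat ?Dp) *\<^sub>v ?z"
      using aDp by (intro assoc_mult_mat_vec[symmetric, of _ ?n ?n _ ?n]) auto
    also have "\<dots> = (?\<delta> \<cdot>\<^sub>m 1\<^sub>m ?n) *\<^sub>v ?z" by (subst adj_mat(2)[of _ ?n]) auto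
    also have "\<dots> = ?\<delta> \<cdot>\<^sub>v ?z"
      by (rule smult_one_mult_mat_vec) simp
    finally show ?thesis .
  qed
  ultimately have nz: "Determinant.det (replace_col ?P ?z k) \<noteq> 0"
    using k(1) by (simp add: det_replace_col_smult[of _ ?n])
  \<comment> \<open>Scaling the whole matrix by \<open>- t\<close> also scales the inserted column,
    which therefore enters with the factor \<open>- 1 / t\<close>.\<close>
  have "replace_col (pencil 1 t 0) ?z k = (- t) \<cdot>\<^sub>m replace_col ?P ((- 1 / t) \<cdot>\<^sub>v ?z) k"
    using \<open>t \<noteq> 0\<close> unfolding pencil_one[OF \<open>t \<noteq> 0\<close>] x_def
    by (intro eq_matI) (auto simp: replace_col_def coord_vec_def)
  then have "Determinant.det (replace_col (pencil 1 t 0) ?z k) \<noteq> 0"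
    using nz \<open>t \<noteq> 0\<close> k(1) by (simp add: det_replace_col_smult[of _ ?n])
  then show ?thesis using k(1) unfolding regular_at_def by blast
qed (simp add: regular_at_def)

lemma regular_near_zero:
  assumes nz: "poly (char_poly (M 0) div D) (- 1) \<noteq> 0"
    and adj: "\<And>x. x < - 1 \<Longrightarrow> poly (char_poly (M 0) div D) x = 0 \<Longrightarrow>
      adj_mat (x \<cdot>\<^sub>m 1\<^sub>m DIM('a) - M 0) *\<^sub>v (adj_mat (lin_mat (Dp 0)) *\<^sub>v coord_vec (z 0)) \<noteq> 0\<^sub>v DIM('a)"
  shows "\<exists>B. open B \<and> 0 \<in> B \<and> (\<forall>t\<in>{0..<1}. \<forall>\<rho>\<in>B. regular_at t \<rho>)"
proof -
  \<comment> \<open>The endpoint 1 is added to obtain a compact interval; the guard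
    \<open>t < 1\<close> excludes it from the claim itself.\<close>
  have "\<exists>B. open B \<and> 0 \<in> B \<and> (\<forall>t\<in>{0..1}. \<forall>\<rho>\<in>B. t < 1 \<longrightarrow> regular_at t \<rho>)"
  proof (rule compact_tube[OF compact_Icc])
    fix t :: real assume t: "t \<in> {0..1}"
    show "\<exists>A B. open A \<and> t \<in> A \<and> open B \<and> 0 \<in> B \<and> (\<forall>t'\<in>A. \<forall>\<rho>'\<in>B. t' < 1 \<longrightarrow> regular_at t' \<rho>')"
    proof (cases "t < 1")
      case True
      have "regular_at t 0" by (rule regular_at_zero) (use True t adj in simp_all)
      from open_regular_at[OF zero_in_S this] obtain A B where
        "open A" "t \<in> A" "open B" "0 \<in> B" "\<forall>t'\<in>A. \<forall>\<rho>'\<in>B. regular_at t' \<rho>'"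
        by blast
      then show ?thesis by (intro exI[of _ A] exI[of _ B]) simp
    next
      case False
      \<comment> \<open>Here \<open>t = 1\<close>, where the factor \<open>D\<close> may make the
        determinant vanish. The cofactor stays nonzero for nearby parameters, and \<open>D\<close>
        is nonzero at \<open>- 1 / t'\<close> whenever 0 < t' < 1.\<close>
      let ?h = "\<lambda>w. poly (char_poly (M (snd w)) div D) (- 1 / fst w)"
      have "open (({0<..} \<times> S) \<inter> ?h -` (- {0}))"
        by (rule continuous_open_preimage[OF continuous_on_poly_cofactor])
          (auto intro: open_Times open_S)
      moreover have "(t, 0) \<in> ({0<..} \<times> S) \<inter> ?h -` (- {0})"
        using False t nz zero_in_S by simp
      ultimately obtain A B where AB: "open A" "open B" "(t, 0) \<in> A \<times> B" "A \<times> B \<subseteq> ({0<..} \<times> S) \<inter> ?h -` (- {0})"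
        by (rule open_prod_elim)
      have "regular_at t' \<rho>'" if "t' \<in> A" "\<rho>' \<in> B" "t' < 1" for t' \<rho>'
      proof -
        have *: "0 < t'" "\<rho>' \<in> S" "?h (t', \<rho>') \<noteq> 0" using AB(4) that(1,2) by auto
        have "- 1 / t' \<noteq> 0" "- 1 / t' \<noteq> - 1" using *(1) that(3) by (auto simp: field_simps)
        then have "Determinant.det (pencil 1 t' \<rho>') \<noteq> 0"
          using * poly_char_poly_M[OF *(2), of "- 1 / t'"] poly_D_nonzero[of "- 1 / t'"] det_Dp[OF *(2)]
          by (simp add: det_pencil_one)
        then show ?thesis by (simp add: regular_at_def)
      qed
      then have "\<forall>t'\<in>A. \<forall>\<rho>'\<in>B. t' < 1 \<longrightarrow> regular_at t' \<rho>'" by simp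
      with AB(1-3) show ?thesis by (intro exI[of _ A] exI[of _ B]) simp
    qed
  qed
  then obtain B where B: "open B" "0 \<in> B" "\<forall>t\<in>{0..1}. \<forall>\<rho>\<in>B. t < 1 \<longrightarrow> regular_at t \<rho>"
    by blast
  have "regular_at t \<rho>" if "t \<in> {0..<1}" "\<rho> \<in> B" for t \<rho>
    using B(3) that by simp
  with B(1,2) show ?thesis by blast
qed

end

end

section \<open>The parametrization\<close>

declare One_nat_def [simp del]

section \<open>Numbering of the coordinates\<close>

lemma pos_less_iff: "pos i < pos j \<longleftrightarrow> i < (j::'n::{finite,linorder})"
proof
  assume "i < j"
  then have "{k. k \<le> i} \<subset> {k. k \<le> j}" by force
  then show "pos i < pos j" unfolding pos_def by (intro psubset_card_mono) auto
next
  assume *: "pos i < pos j"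
  show "i < j"
  proof (rule ccontr)
    assume "\<not> i < j"
    then have "{k. k \<le> j} \<subseteq> {k. k \<le> i}" by auto
    then have "pos j \<le> pos i" unfolding pos_def by (intro card_mono) auto
    with * show False by simp
  qed
qed

lemma bij_betw_pos: "bij_betw (pos :: 'n::{finite,linorder} \<Rightarrow> nat) UNIV {1..CARD('n)}"
proof -
  have inj: "inj (pos :: 'n \<Rightarrow> nat)"
    by (rule injI) (metis less_irrefl linorder_less_linear pos_less_iff)
  have "pos j \<in> {1..CARD('n)}" for j :: 'n
  proof -
    have "card {j} \<le> pos j" unfolding pos_def by (intro card_mono) auto
    moreover have "pos j \<le> CARD('n)" unfolding pos_def by (intro card_mono) auto
    ultimately show ?thesis by simp
  qed
  then have "range (pos :: 'n \<Rightarrow> nat) \<subseteq> {1..CARD('n)}" by auto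
  moreover have "card (range (pos :: 'n \<Rightarrow> nat)) = card {1..CARD('n)}"
    using inj by (simp add: card_image)
  ultimately show ?thesis
    using inj by (simp add: bij_betw_def card_subset_eq)
qed

lemma pos_in: "pos (j::'n::{finite,linorder}) \<in> {1..CARD('n)}"
  using bij_betw_pos bij_betwE by blast

lemma pos_eq_iff: "pos i = pos j \<longleftrightarrow> i = (j::'n::{finite,linorder})"
  using bij_betw_pos unfolding bij_betw_def inj_on_def by blast

lemma elt_pos [simp]: "elt (pos j) = (j::'n::{finite,linorder})"
  unfolding elt_def by (rule the_equality) (auto simp: pos_eq_iff)

lemma pos_elt: "m \<in> {1..CARD('n)} \<Longrightarrow> pos (elt m :: 'n::{finite,linorder}) = m"
  using bij_betw_pos[where 'n='n] elt_pos unfolding bij_betw_def by (metis imageE)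

lemma sum_pos: "(\<Sum>i=1..CARD('n). h i) = (\<Sum>k\<in>(UNIV :: 'n::{finite,linorder} set). h (pos k))"
  by (rule sum.reindex_bij_betw[OF bij_betw_pos, symmetric])

lemma res_in: "n > 0 \<Longrightarrow> res n i \<in> {1..n}"
  unfolding res_def atLeastAtMost_iff using mod_less_divisor[of n "i - 1"] by linarith

lemma res_eq: "i \<in> {1..n} \<Longrightarrow> res n i = i"
  by (auto simp: res_def)

lemma Rep_red_in: "Rep_red (k :: 'n::card2 red) \<in> {1..CARD('n) - 1}"
  by (rule Rep_red)

lemma red_eqI: "Rep_red k = Rep_red l \<Longrightarrow> k = l"
  by (simp add: Rep_red_inject)

text \<open>Coordinate \<open>j\<close> of \<open>\<alpha>\<^sub>r(x)\<close> is coordinate \<open>skip r j\<close> of \<open>x\<close>; the value of \<open>skip r\<close> at position \<open>r\<close>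
  is meaningless.\<close>

definition skip :: "nat \<Rightarrow> 'n::{card2,linorder} \<Rightarrow> 'n red" where
  "skip r j = Abs_red (if pos j < r then pos j else pos j - 1)"

definition unskip :: "nat \<Rightarrow> 'n::{card2,linorder} red \<Rightarrow> 'n" where
  "unskip r k = elt (if Rep_red k < r then Rep_red k else Rep_red k + 1)"

lemma pos_unskip:
  "pos (unskip r k :: 'n::{card2,linorder}) = (if Rep_red k < r then Rep_red k else Rep_red k + 1)"
  unfolding unskip_def using Rep_red_in[of k] by (intro pos_elt) auto

lemma pos_unskip_neq: "pos (unskip r k) \<noteq> r"
  by (auto simp: pos_unskip)

lemma skip_unskip: "skip r (unskip r k) = k"
  by (auto simp: skip_def pos_unskip Rep_red_inverse)

lemma unskip_skip:
  fixes j :: "'n::{card2,linorder}"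
  assumes "r \<in> {1..CARD('n)}" "pos j \<noteq> r"
  shows "unskip r (skip r j) = j"
proof -
  have "(if pos j < r then pos j else pos j - 1) \<in> {1..CARD('n) - 1}"
    using assms pos_in[of j] by auto
  then have R: "Rep_red (skip r j) = (if pos j < r then pos j else pos j - 1)"
    unfolding skip_def by (rule Abs_red_inverse)
  have "pos (unskip r (skip r j)) = pos j"
    unfolding pos_unskip R using assms by auto
  then show ?thesis by (simp add: pos_eq_iff)
qed

section \<open>Coordinates of the vectors \<alpha> and b\<close>

lemma alpha_nth: "alpha r x $ j = (if pos j = r then 1 else x $ skip r j)"
  by (simp add: alpha_def skip_def)

lemma brow_nth: "brow r x y $ j = (if pos j = r then - (x \<bullet> y) else y $ skip r j)"
  by (simp add: brow_def skip_def)

text \<open>The entry at position \<open>r\<close> is chosen to cancel the sum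
  \<open>x \<bullet> y\<close> of the other products. The sum is the trace of the tensor product of
  the two vectors.\<close>

lemma brow_inner_alpha:
  fixes x y :: "('n::{card2,linorder}) rvec"
  assumes "r \<in> {1..CARD('n)}"
  shows "(\<Sum>j\<in>UNIV. brow r x y $ j * alpha r x $ j) = 0"
proof -
  let ?J = "{j::'n. pos j \<noteq> r}"
  have r: "pos (elt r :: 'n) = r" using assms by (rule pos_elt)
  have "(UNIV :: 'n set) = ?J \<union> {elt r}"
    using r by (auto simp: pos_eq_iff[symmetric])
  then have "(\<Sum>j\<in>UNIV. brow r x y $ j * alpha r x $ j) =
      (\<Sum>j\<in>?J \<union> {elt r}. brow r x y $ j * alpha r x $ j)" by simp
  also have "\<dots> = (\<Sum>j\<in>?J. brow r x y $ j * alpha r x $ j) + (\<Sum>j\<in>{elt r}. brow r x y $ j * alpha r x $ j)"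
    by (rule sum.union_disjoint) (use r in auto)
  also have "(\<Sum>j\<in>{elt r}. brow r x y $ j * alpha r x $ j) = - (x \<bullet> y)"
    using r by (simp add: brow_nth alpha_nth)
  also have "(\<Sum>j\<in>?J. brow r x y $ j * alpha r x $ j) = (\<Sum>j\<in>?J. y $ skip r j * x $ skip r j)"
    by (intro sum.cong) (auto simp: brow_nth alpha_nth)
  also have "\<dots> = (\<Sum>k\<in>UNIV. y $ k * x $ k)"
    by (rule sum.reindex_bij_witness[of _ "unskip r" "skip r"])
      (use assms in \<open>auto simp: unskip_skip skip_unskip pos_unskip_neq\<close>)
  also have "\<dots> = x \<bullet> y" by (simp add: inner_vec_def mult.commute)
  finally show ?thesis by simp
qed

text \<open>\<open>brow\<close> is linear in \<open>y\<close>; its values at unit vectors make up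
  the columns of the matrix behind \<open>Tdet\<close>.\<close>

lemma brow_expand:
  fixes x y :: "('n::{card2,linorder}) rvec"
  shows "brow r x y $ j = (\<Sum>k\<in>UNIV. y $ k * brow r x (axis k 1) $ j)"
proof -
  have "(\<Sum>k\<in>UNIV. y $ k * (axis k 1 :: 'n rvec) $ a) = y $ a" for a
    by (simp add: axis_def if_distrib[of "\<lambda>u. _ * u"] cong: if_cong)
  then show ?thesis
    by (simp add: brow_nth inner_axis sum_negf[symmetric]) (simp add: inner_vec_def mult.commute sum_negf)
qed

lemma brow_0 [simp]: "brow r x 0 = 0"
  by (simp add: Finite_Cartesian_Product.vec_eq_iff brow_nth)

lemma brow_scale: "brow r x (c *\<^sub>R y) = c *\<^sub>R brow r x y"
  by (simp add: Finite_Cartesian_Product.vec_eq_iff brow_nth)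

section \<open>The linear system that determines the first n vectors p\<close>

lemma p_sum_nth:
  "p_sum p X $ c $ j = (\<Sum>i=1..2 * CARD('n) + 1. p i $ c * alpha (res CARD('n) i) (X i) $ (j::'n::{card2,linorder}))"
  by (simp add: p_sum_def tensor_def)

lemma b_sum_nth:
  "b_sum I X y $ j $ k = (\<Sum>i\<in>I. brow (res CARD('n) i) (X i) (y i) $ j *
      alpha (res CARD('n) i) (X i) $ (k::'n::{card2,linorder}))"
  by (simp add: b_sum_def tensor_def)

definition alpha_mat :: "(nat \<Rightarrow> ('n::{card2,linorder}) rvec) \<Rightarrow> ('n rn, 'n) Finite_Cartesian_Product.vec" where
  "alpha_mat X = (\<chi> j k. alpha (pos k) (X (pos k)) $ j)"

definition p_rhs :: "(nat \<Rightarrow> real^2) \<Rightarrow> (nat \<Rightarrow> ('n::{card2,linorder}) rvec) \<Rightarrow> 2 \<Rightarrow> 'n rn" where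
  "p_rhs P X c = (\<chi> j. - (\<Sum>i=CARD('n)+1..2 * CARD('n) + 1. P i $ c * alpha (res CARD('n) i) (X i) $ j))"

text \<open>Cramer's rule as a closed formula, which makes smooth dependence on the parameters
  visible. The value 0 outside the index range matches the convention in
  \<open>p_all\<close>.\<close>

definition p_sol :: "(nat \<Rightarrow> real^2) \<Rightarrow> (nat \<Rightarrow> ('n::{card2,linorder}) rvec) \<Rightarrow> nat \<Rightarrow> real^2" where
  "p_sol P X i =
    (if i \<in> {1..CARD('n)} then
       \<chi> c. Determinants.det (\<chi> j k. if k = elt i then p_rhs P X c $ j else alpha_mat X $ j $ k)
         * inverse (Delta X)
     else if i \<in> {CARD('n)+1..2 * CARD('n) + 1} then P i else 0)"

text \<open>Each row \<open>c\<close> of the matrix equation is a separate system with the matrix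
  \<open>alpha_mat X\<close>, because the first n indices are their own residues. The prescribed
  vectors move to the right-hand side.\<close>

lemma p_sum_eq_0_iff:
  fixes X :: "nat \<Rightarrow> ('n::{card2,linorder}) rvec"
  assumes "\<forall>j\<in>{CARD('n)+1..2 * CARD('n) + 1}. p j = P j"
  shows "p_sum p X = 0 \<longleftrightarrow> (\<forall>c. alpha_mat X *v (\<chi> k. p (pos k) $ c) = p_rhs P X c)"
proof -
  have "p_sum p X $ c $ j = (alpha_mat X *v (\<chi> k. p (pos k) $ c)) $ j - p_rhs P X c $ j" for c j
  proof -
    have "{1..2 * CARD('n) + 1} = {1..CARD('n)} \<union> {CARD('n)+1..2 * CARD('n) + 1}" by auto
    then have "p_sum p X $ c $ j =
        (\<Sum>i=1..CARD('n). p i $ c * alpha (res CARD('n) i) (X i) $ j) +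
        (\<Sum>i=CARD('n)+1..2 * CARD('n) + 1. p i $ c * alpha (res CARD('n) i) (X i) $ j)"
      unfolding p_sum_nth by (simp add: sum.union_disjoint)
    also have "(\<Sum>i=1..CARD('n). p i $ c * alpha (res CARD('n) i) (X i) $ j) =
        (\<Sum>k\<in>UNIV. p (pos (k::'n)) $ c * alpha (pos k) (X (pos k)) $ j)"
      unfolding sum_pos by (intro sum.cong refl) (simp add: res_eq[OF pos_in])
    also have "\<dots> = (alpha_mat X *v (\<chi> k. p (pos k) $ c)) $ j"
      by (simp add: matrix_vector_mult_def alpha_mat_def mult.commute)
    also have "(\<Sum>i=CARD('n)+1..2 * CARD('n) + 1. p i $ c * alpha (res CARD('n) i) (X i) $ j) =
        (\<Sum>i=CARD('n)+1..2 * CARD('n) + 1. P i $ c * alpha (res CARD('n) i) (X i) $ j)"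
      using assms by (intro sum.cong) auto
    finally show ?thesis by (simp add: p_rhs_def)
  qed
  then show ?thesis by (auto simp: Finite_Cartesian_Product.vec_eq_iff)
qed

text \<open>With \<open>Delta X\<close> nonzero, Cramer's rule yields existence and uniqueness
  together, so the description in \<open>p_all\<close> denotes the formula.\<close>

lemma p_all_eq_p_sol:
  fixes X :: "nat \<Rightarrow> ('n::{card2,linorder}) rvec"
  assumes "Delta X \<noteq> 0"
  shows "p_all P X = p_sol P X"
proof -
  have det: "Determinants.det (alpha_mat X) = Delta X"
    by (simp add: Delta_def alpha_mat_def)
  have sol: "alpha_mat X *v v = p_rhs P X c \<longleftrightarrow> (\<forall>k. v $ k = p_sol P X (pos k) $ c)" for v c
  proof -
    have "alpha_mat X *v v = p_rhs P X c \<longleftrightarrow>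
      v = (\<chi> k. Determinants.det (\<chi> j l. if l = k then p_rhs P X c $ j else alpha_mat X $ j $ l) / Determinants.det (alpha_mat X))"
      by (rule cramer) (use det assms in simp)
    moreover have "p_sol P X (pos k) $ c = Determinants.det
        (\<chi> j l. if l = k then p_rhs P X c $ j else alpha_mat X $ j $ l) / Determinants.det (alpha_mat X)" for k :: 'n
      using pos_in[of k] by (simp add: p_sol_def det divide_inverse)
    ultimately show ?thesis
      by (auto simp: Finite_Cartesian_Product.vec_eq_iff)
  qed
  have P: "\<forall>j\<in>{CARD('n)+1..2 * CARD('n) + 1}. p_sol P X j = P j" by (auto simp: p_sol_def)
  show ?thesis
    unfolding p_all_def
  proof (rule the_equality)
    show "(\<forall>j\<in>{CARD('n)+1..2 * CARD('n) + 1}. p_sol P X j = P j) \<and>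
     (\<forall>j. j \<notin> {1..2 * CARD('n) + 1} \<longrightarrow> p_sol P X j = 0) \<and> p_sum (p_sol P X) X = 0"
      unfolding p_sum_eq_0_iff[OF P] sol using P by (auto simp: p_sol_def)
  next
    fix p assume p: "(\<forall>j\<in>{CARD('n)+1..2 * CARD('n) + 1}. p j = P j) \<and>
     (\<forall>j. j \<notin> {1..2 * CARD('n) + 1} \<longrightarrow> p j = 0) \<and> p_sum p X = 0"
    then have "\<forall>c k. p (pos (k::'n)) $ c = p_sol P X (pos k) $ c"
      using p_sum_eq_0_iff[of p P X] unfolding sol by simp
    then have *: "p (pos k) = p_sol P X (pos k)" for k :: 'n
      by (simp add: Finite_Cartesian_Product.vec_eq_iff)
    have "p i = p_sol P X i" for i
    proof (cases "i \<in> {1..CARD('n)}")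
      case True
      then show ?thesis using *[of "elt i"] by (simp only: pos_elt)
    next
      case False
      then show ?thesis using p by (cases "i \<in> {CARD('n)+1..2 * CARD('n) + 1}") (auto simp: p_sol_def)
    qed
    then show "p = p_sol P X" by (rule ext)
  qed
qed


section \<open>The linear system that determines the first n + 1 vectors y\<close>

text \<open>\<open>col_row\<close> and \<open>col_entry\<close> decode the column numbers of \<^const>\<open>Tdet\<close>, and \<open>row_fst\<close> and
  \<open>row_snd\<close> below decode its row numbers.\<close>

definition col_row :: "'n::card2 itself \<Rightarrow> nat \<Rightarrow> nat" where
  "col_row _ c = c div (CARD('n) - 1) + 1"

definition col_entry :: "nat \<Rightarrow> 'n::card2 red" where
  "col_entry c = Abs_red (c mod (CARD('n) - 1) + 1)"

text \<open>Inverse of the decoding below a block length of n - 1. Blocks and components count from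
  1, columns from 0.\<close>

definition col_of :: "nat \<Rightarrow> 'n::card2 red \<Rightarrow> nat" where
  "col_of i k = (i - 1) * (CARD('n) - 1) + (Rep_red k - 1)"

lemma Rep_col_entry: "Rep_red (col_entry c :: 'n::card2 red) = c mod (CARD('n) - 1) + 1"
proof -
  have "c mod (CARD('n) - 1) < CARD('n) - 1"
    using one_less_card[where 'a='n] by (intro mod_less_divisor) simp
  then have "c mod (CARD('n) - 1) + 1 \<in> {1..CARD('n) - 1}"
    unfolding atLeastAtMost_iff by linarith
  then show ?thesis unfolding col_entry_def by (rule Abs_red_inverse)
qed

lemma col_of_row_entry: "col_of (col_row TYPE('n::card2) c) (col_entry c :: 'n red) = c"
  unfolding col_of_def Rep_col_entry col_row_def by (simp only: add_diff_cancel_right' div_mult_mod_eq)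

lemma Rep_red_minus_less: "Rep_red (k :: 'n::card2 red) - 1 < CARD('n) - 1"
  using Rep_red_in[of k] one_less_card[where 'a='n] unfolding atLeastAtMost_iff by linarith

lemma Rep_red_cases: obtains m where "Rep_red (k :: 'n::card2 red) = m + 1" "m < CARD('n) - 1"
  using Rep_red_minus_less[of k] Rep_red_in[of k] unfolding atLeastAtMost_iff
  by (metis le_add_diff_inverse2)

lemma col_row_of: "i \<ge> 1 \<Longrightarrow> col_row TYPE('n::card2) (col_of i (k :: 'n red)) = i"
  by (rule Rep_red_cases[of k]) (simp add: col_row_def col_of_def)

lemma col_entry_of: "col_entry (col_of i k) = (k :: 'n::card2 red)"
  by (rule Rep_red_cases[of k], rule red_eqI) (simp add: Rep_col_entry col_of_def)

text \<open>The n + 1 blocks of n - 1 unknowns match the number of entries other than (1,1), so the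
  system is square.\<close>

lemma system_size: "(CARD('n::card2))\<^sup>2 - 1 = (CARD('n) + 1) * (CARD('n) - 1)"
  using one_less_card[where 'a='n] by (simp add: power2_eq_square algebra_simps diff_mult_distrib2)

lemma col_row_in:
  assumes "c < (CARD('n::card2))\<^sup>2 - 1"
  shows "col_row TYPE('n) c \<in> {1..CARD('n) + 1}"
proof -
  have "c div (CARD('n) - 1) < CARD('n) + 1"
    using assms unfolding system_size by (simp add: less_mult_imp_div_less)
  then show ?thesis by (simp add: col_row_def)
qed

lemma col_of_less:
  assumes "i \<in> {1..CARD('n) + 1}"
  shows "col_of i (k :: 'n::card2 red) < (CARD('n))\<^sup>2 - 1"
proof -
  obtain m where m: "i = Suc m" "m \<le> CARD('n)" using assms by (cases i) auto
  have "col_of i k < (m + 1) * (CARD('n) - 1)"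
    using Rep_red_minus_less[of k] m by (simp add: col_of_def distrib_right)
  also have "\<dots> \<le> (CARD('n) + 1) * (CARD('n) - 1)" using m by (intro mult_right_mono) auto
  finally show ?thesis by (simp only: system_size)
qed

lemma sum_col:
  "(\<Sum>c<(CARD('n::card2))\<^sup>2 - 1. h (col_row TYPE('n) c) (col_entry c)) =
    (\<Sum>i=1..CARD('n) + 1. \<Sum>k\<in>(UNIV :: 'n red set). h i k)"
  unfolding sum.cartesian_product
  by (rule sum.reindex_bij_witness[of _ "\<lambda>(i, k). col_of i k" "\<lambda>c. (col_row TYPE('n) c, col_entry c)"])
    (auto simp: col_of_row_entry col_row_of col_entry_of col_of_less simp del: atLeastAtMost_iff
      intro: col_row_in dest: atLeastAtMost_iff[THEN iffD1])

definition row_fst :: "nat \<Rightarrow> 'n::{card2,linorder}" where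
  "row_fst l = elt ((l + 1) div CARD('n) + 1)"

definition row_snd :: "nat \<Rightarrow> 'n::{card2,linorder}" where
  "row_snd l = elt ((l + 1) mod CARD('n) + 1)"

lemma row_exists:
  fixes j k :: "'n::{card2,linorder}"
  assumes "\<not> (pos j = 1 \<and> pos k = 1)"
  shows "\<exists>l<(CARD('n))\<^sup>2 - 1. row_fst l = j \<and> row_snd l = k"
proof -
  let ?n = "CARD('n)"
  obtain a b where a: "pos j = a + 1" "a < ?n" and b: "pos k = b + 1" "b < ?n"
    using pos_in[of j] pos_in[of k] unfolding atLeastAtMost_iff
    by (metis Suc_eq_plus1 Suc_le_lessD le_add_diff_inverse2)
  \<comment> \<open>The row-major position counted from 0 vanishes only for the omitted entry (1,1),
    so here it has the form \<open>l + 1\<close>.\<close>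
  have "a * ?n + b \<noteq> 0" using assms a b by auto
  then obtain l where l: "a * ?n + b = l + 1" by (metis Suc_eq_plus1 not0_implies_Suc)
  have "a * ?n + b < (a + 1) * ?n" using b by (simp add: distrib_right)
  also have "\<dots> \<le> ?n * ?n" using a by (intro mult_right_mono) auto
  finally have "l < ?n\<^sup>2 - 1" unfolding l power2_eq_square by linarith
  moreover have "row_fst l = j" "row_snd l = k"
    unfolding row_fst_def row_snd_def l[symmetric] using a b by (simp_all flip: a(1) b(1))
  ultimately show ?thesis by blast
qed

text \<open>The standard basis vector with number \<open>c\<close> in the space of families y;
  \<open>b_sum\<close> maps it to column \<open>c\<close> of the system.\<close>

definition unit_at :: "nat \<Rightarrow> nat \<Rightarrow> ('n::card2) rvec" where
  "unit_at c i = (if i = col_row TYPE('n) c then axis (col_entry c) 1 else 0)"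

definition T_entry :: "(nat \<Rightarrow> ('n::{card2,linorder}) rvec) \<Rightarrow> nat \<times> nat \<Rightarrow> real" where
  "T_entry X = (\<lambda>(l, c). b_sum {1..CARD('n) + 1} X (unit_at c) $ row_fst l $ row_snd l)"

definition T_mat :: "(nat \<Rightarrow> ('n::{card2,linorder}) rvec) \<Rightarrow> real Matrix.mat" where
  "T_mat X = Matrix.mat ((CARD('n))\<^sup>2 - 1) ((CARD('n))\<^sup>2 - 1) (T_entry X)"

lemma Tdet_eq: "Tdet X = Determinant.det (T_mat X)"
  unfolding Tdet_def T_mat_def T_entry_def unit_at_def row_fst_def row_snd_def Let_def
    col_row_def col_entry_def ..

lemma T_mat_carrier [simp]: "T_mat (X :: nat \<Rightarrow> ('n::{card2,linorder}) rvec) \<in>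
    carrier_mat ((CARD('n))\<^sup>2 - 1) ((CARD('n))\<^sup>2 - 1)"
  by (simp add: T_mat_def)

definition y_coords :: "(nat \<Rightarrow> ('n::card2) rvec) \<Rightarrow> real Matrix.vec" where
  "y_coords y = Matrix.vec ((CARD('n))\<^sup>2 - 1) (\<lambda>c. y (col_row TYPE('n) c) $ col_entry c)"

lemma b_sum_unit_at:
  fixes X :: "nat \<Rightarrow> ('n::{card2,linorder}) rvec"
  assumes "c < (CARD('n))\<^sup>2 - 1"
  shows "b_sum {1..CARD('n) + 1} X (unit_at c) $ j $ k =
    brow (res CARD('n) (col_row TYPE('n) c)) (X (col_row TYPE('n) c)) (axis (col_entry c) 1) $ j *
      alpha (res CARD('n) (col_row TYPE('n) c)) (X (col_row TYPE('n) c)) $ k"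
proof -
  let ?r = "col_row TYPE('n) c"
  have "b_sum {1..CARD('n) + 1} X (unit_at c) $ j $ k = (\<Sum>i=1..CARD('n) + 1. if i = ?r then
      brow (res CARD('n) ?r) (X ?r) (axis (col_entry c) 1) $ j * alpha (res CARD('n) ?r) (X ?r) $ k else 0)"
    unfolding b_sum_nth by (intro sum.cong) (auto simp: unit_at_def)
  then show ?thesis using col_row_in[OF assms] by simp
qed

text \<open>Expanding each y in unit vectors shows that \<open>T_mat X\<close> is the matrix of the
  linear map whose determinant is T.\<close>

lemma T_mat_mult_y_coords:
  fixes X :: "nat \<Rightarrow> ('n::{card2,linorder}) rvec"
  assumes "l < (CARD('n))\<^sup>2 - 1"
  shows "vec_index (T_mat X *\<^sub>v y_coords y) l = b_sum {1..CARD('n) + 1} X y $ row_fst l $ row_snd l"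
proof -
  let ?m = "(CARD('n))\<^sup>2 - 1"
  let ?h = "\<lambda>i k. y i $ k * brow (res CARD('n) i) (X i) (axis k 1) $ row_fst l * alpha (res CARD('n) i) (X i) $ row_snd l"
  have "vec_index (T_mat X *\<^sub>v y_coords y) l =
      (\<Sum>c<?m. T_entry X (l, c) * y (col_row TYPE('n) c) $ col_entry c)"
    using assms by (simp add: T_mat_def y_coords_def scalar_prod_def lessThan_atLeast0)
  also have "\<dots> = (\<Sum>c<?m. ?h (col_row TYPE('n) c) (col_entry c))"
    by (intro sum.cong refl) (simp add: T_entry_def b_sum_unit_at)
  also have "\<dots> = (\<Sum>i=1..CARD('n) + 1. \<Sum>k\<in>UNIV. ?h i k)"
    by (rule sum_col)
  also have "\<dots> = b_sum {1..CARD('n) + 1} X y $ row_fst l $ row_snd l"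
    unfolding b_sum_nth
    by (intro sum.cong refl) (subst brow_expand, simp add: sum_distrib_right)
  finally show ?thesis .
qed

text \<open>The entry \<open>(1,1)\<close> need not be tested, since all summands have trace \<open>0\<close>.\<close>

lemma b_sum_eq_0_iff:
  fixes X :: "nat \<Rightarrow> ('n::{card2,linorder}) rvec"
  shows "b_sum I X y = 0 \<longleftrightarrow> (\<forall>l<(CARD('n))\<^sup>2 - 1. b_sum I X y $ row_fst l $ row_snd l = 0)"
proof
  assume *: "\<forall>l<(CARD('n))\<^sup>2 - 1. b_sum I X y $ row_fst l $ row_snd l = 0"
  have off: "b_sum I X y $ j $ k = 0" if jk: "\<not> (pos j = 1 \<and> pos k = 1)" for j k :: 'n
  proof -
    obtain l where "l < (CARD('n))\<^sup>2 - 1" "row_fst l = j" "row_snd l = k" using row_exists[OF jk] by blast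
    then show ?thesis using * by blast
  qed
  have "(\<Sum>j\<in>UNIV. b_sum I X y $ j $ j) =
      (\<Sum>i\<in>I. \<Sum>j\<in>UNIV. brow (res CARD('n) i) (X i) (y i) $ j * alpha (res CARD('n) i) (X i) $ j)"
    unfolding b_sum_nth by (rule sum.swap)
  also have "\<dots> = 0" by (intro sum.neutral ballI brow_inner_alpha res_in) simp
  finally have tr: "(\<Sum>j\<in>UNIV. b_sum I X y $ j $ j) = 0" .
  have one: "pos (elt 1 :: 'n) = 1" by (rule pos_elt) (simp add: One_nat_def Suc_le_eq)
  have pos_1: "j = elt 1" if "pos j = 1" for j :: 'n
    using that one by (simp add: pos_eq_iff[symmetric])
  have "(\<Sum>j\<in>UNIV. b_sum I X y $ j $ j) = (\<Sum>j\<in>{elt 1}. b_sum I X y $ j $ j)"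
  proof (rule sum.mono_neutral_right)
    show "\<forall>j\<in>UNIV - {elt 1}. b_sum I X y $ j $ j = 0" using off pos_1 by blast
  qed auto
  then have one_one: "b_sum I X y $ elt 1 $ elt 1 = 0" using tr by simp
  have "b_sum I X y $ j $ k = 0" for j k
  proof (cases "pos j = 1 \<and> pos k = 1")
    case True
    then show ?thesis using one_one pos_1[of j] pos_1[of k] by simp
  qed (rule off)
  then show "b_sum I X y = 0" by (simp add: Finite_Cartesian_Product.vec_eq_iff)
qed simp

definition y_rhs :: "(nat \<Rightarrow> ('n::{card2,linorder}) rvec) \<Rightarrow> (nat \<Rightarrow> 'n rvec) \<Rightarrow> real Matrix.vec" where
  "y_rhs X Y = Matrix.vec ((CARD('n))\<^sup>2 - 1)
    (\<lambda>l. - b_sum {CARD('n)+2..2 * CARD('n) + 1} X Y $ row_fst l $ row_snd l)"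

definition y_sol :: "(nat \<Rightarrow> ('n::{card2,linorder}) rvec) \<Rightarrow> (nat \<Rightarrow> 'n rvec) \<Rightarrow> nat \<Rightarrow> 'n rvec" where
  "y_sol X Y i =
    (if i \<in> {1..CARD('n) + 1} then
       \<chi> k. Determinant.det (replace_col (T_mat X) (y_rhs X Y) (col_of i k)) * inverse (Tdet X)
     else if i \<in> {CARD('n)+2..2 * CARD('n) + 1} then Y i else 0)"

lemma b_sum_eq_0_iff_system:
  fixes X :: "nat \<Rightarrow> ('n::{card2,linorder}) rvec"
  assumes "\<forall>j\<in>{CARD('n)+2..2 * CARD('n) + 1}. y j = Y j"
  shows "b_sum {1..2 * CARD('n) + 1} X y = 0 \<longleftrightarrow> T_mat X *\<^sub>v y_coords y = y_rhs X Y"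
proof -
  let ?m = "(CARD('n))\<^sup>2 - 1"
  have "{1..2 * CARD('n) + 1} = {1..CARD('n) + 1} \<union> {CARD('n)+2..2 * CARD('n) + 1}" by auto
  then have "b_sum {1..2 * CARD('n) + 1} X y $ j $ k = b_sum {1..CARD('n) + 1} X y $ j $ k +
      b_sum {CARD('n)+2..2 * CARD('n) + 1} X y $ j $ k" for j k
    unfolding b_sum_nth by (simp add: sum.union_disjoint)
  moreover have "b_sum {CARD('n)+2..2 * CARD('n) + 1} X y = b_sum {CARD('n)+2..2 * CARD('n) + 1} X Y"
    unfolding b_sum_def using assms by (intro sum.cong) auto
  ultimately have "b_sum {1..2 * CARD('n) + 1} X y $ row_fst l $ row_snd l = 0 \<longleftrightarrow>
      vec_index (T_mat X *\<^sub>v y_coords y) l = vec_index (y_rhs X Y) l" if "l < ?m" for l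
    using that by (simp add: T_mat_mult_y_coords y_rhs_def eq_neg_iff_add_eq_0)
  then have "b_sum {1..2 * CARD('n) + 1} X y = 0 \<longleftrightarrow>
      (\<forall>l<?m. vec_index (T_mat X *\<^sub>v y_coords y) l = vec_index (y_rhs X Y) l)"
    unfolding b_sum_eq_0_iff[of "{1..2 * CARD('n) + 1}"] by simp
  also have "\<dots> \<longleftrightarrow> T_mat X *\<^sub>v y_coords y = y_rhs X Y"
    by (metis (mono_tags, lifting) Matrix.eq_vecI T_mat_carrier carrier_matD(1) dim_mult_mat_vec dim_vec y_rhs_def)
  finally show ?thesis .
qed

lemma y_coords_nth: "i \<in> {1..CARD('n) + 1} \<Longrightarrow> vec_index (y_coords y) (col_of i k) = y i $ (k :: 'n::card2 red)"
  by (simp add: y_coords_def col_of_less col_row_of col_entry_of)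

text \<open>The adjugate divided by \<open>Tdet X\<close> gives a solution, whose coordinates are
  the Cramer quotients in \<open>y_sol\<close>. Cramer's lemma applied to an arbitrary solution
  gives uniqueness.\<close>

lemma y_all_eq_y_sol:
  fixes X :: "nat \<Rightarrow> ('n::{card2,linorder}) rvec"
  assumes "Tdet X \<noteq> 0"
  shows "y_all X Y = y_sol X Y"
proof -
  let ?m = "(CARD('n))\<^sup>2 - 1"
  have det: "Determinant.det (T_mat X) = Tdet X" by (simp add: Tdet_eq)
  have rhs: "y_rhs X Y \<in> carrier_vec ?m" by (simp add: y_rhs_def)
  have Y: "\<forall>j\<in>{CARD('n)+2..2 * CARD('n) + 1}. y_sol X Y j = Y j" by (auto simp: y_sol_def)
  define v where "v = inverse (Tdet X) \<cdot>\<^sub>v (adj_mat (T_mat X) *\<^sub>v y_rhs X Y)"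
  have adj: "adj_mat (T_mat X) \<in> carrier_mat ?m ?m" by (rule adj_mat) simp
  have "T_mat X *\<^sub>v v = inverse (Tdet X) \<cdot>\<^sub>v (T_mat X *\<^sub>v (adj_mat (T_mat X) *\<^sub>v y_rhs X Y))"
    unfolding v_def using adj rhs by (intro mult_mat_vec[of _ ?m ?m]) auto
  also have "T_mat X *\<^sub>v (adj_mat (T_mat X) *\<^sub>v y_rhs X Y) = (Tdet X \<cdot>\<^sub>m 1\<^sub>m ?m) *\<^sub>v y_rhs X Y"
    using adj rhs assoc_mult_mat_vec[of "T_mat X" ?m ?m "adj_mat (T_mat X)" ?m "y_rhs X Y"]
      adj_mat(2)[of "T_mat X" ?m] by (simp add: det)
  also have "\<dots> = Tdet X \<cdot>\<^sub>v y_rhs X Y"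
    by (rule smult_one_mult_mat_vec[OF rhs])
  also have "inverse (Tdet X) \<cdot>\<^sub>v (Tdet X \<cdot>\<^sub>v y_rhs X Y) = y_rhs X Y"
    using assms by (simp add: smult_smult_assoc)
  finally have Tv: "T_mat X *\<^sub>v v = y_rhs X Y" .
  have "v = y_coords (y_sol X Y)"
  proof (rule Matrix.eq_vecI)
    fix c assume "c < dim_vec (y_coords (y_sol X Y))"
    then have c: "c < ?m" by (simp add: y_coords_def)
    have "vec_index v c = inverse (Tdet X) * Determinant.det (replace_col (T_mat X) (y_rhs X Y) c)"
      unfolding v_def using c adj rhs by (subst adj_mat_mult_vec_nth[symmetric, of _ ?m]) auto
    then show "vec_index v c = vec_index (y_coords (y_sol X Y)) c"
      using c col_row_in[OF c] by (simp add: y_coords_def y_sol_def col_of_row_entry)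
  qed (use adj in \<open>simp add: v_def y_coords_def\<close>)
  then have sol: "b_sum {1..2 * CARD('n) + 1} X (y_sol X Y) = 0"
    unfolding b_sum_eq_0_iff_system[OF Y] using Tv by simp
  show ?thesis
    unfolding y_all_def
  proof (rule the_equality)
    show "(\<forall>j\<in>{CARD('n)+2..2 * CARD('n) + 1}. y_sol X Y j = Y j) \<and>
     (\<forall>j. j \<notin> {1..2 * CARD('n) + 1} \<longrightarrow> y_sol X Y j = 0) \<and> b_sum {1..2 * CARD('n) + 1} X (y_sol X Y) = 0"
      using sol by (auto simp: y_sol_def)
  next
    fix y assume y: "(\<forall>j\<in>{CARD('n)+2..2 * CARD('n) + 1}. y j = Y j) \<and>
     (\<forall>j. j \<notin> {1..2 * CARD('n) + 1} \<longrightarrow> y j = 0) \<and> b_sum {1..2 * CARD('n) + 1} X y = 0"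
    then have Ty: "T_mat X *\<^sub>v y_coords y = y_rhs X Y" using b_sum_eq_0_iff_system[of y Y X] by simp
    have "y i = y_sol X Y i" for i
    proof (cases "i \<in> {1..CARD('n) + 1}")
      case True
      have "y i $ k = y_sol X Y i $ k" for k
      proof -
        have "Determinant.det (replace_col (T_mat X) (y_rhs X Y) (col_of i k)) = y i $ k * Tdet X"
          using cramer_lemma_mat[of "T_mat X" ?m "y_coords y" "col_of i k"] col_of_less[OF True, of k]
          unfolding Ty y_coords_nth[OF True] det by (simp add: y_coords_def)
        then show ?thesis using True assms by (simp add: y_sol_def)
      qed
      then show ?thesis by (simp add: Finite_Cartesian_Product.vec_eq_iff)
    next
      case False
      then show ?thesis using y by (cases "i \<in> {CARD('n)+2..2 * CARD('n) + 1}") (auto simp: y_sol_def)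
    qed
    then show "y = y_sol X Y" by (rule ext)
  qed
qed

declare One_nat_def [simp]

section \<open>Smoothness and kernels\<close>

lemma Ck_on_det:
  fixes A :: "'a::euclidean_space \<Rightarrow> real^'n^'n"
  assumes S: "open S" and "\<And>i j. Ck_on k S (\<lambda>x. A x $ i $ j)"
  shows "Ck_on k S (\<lambda>x. Determinants.det (A x))"
  unfolding Determinants.det_def
  by (intro Ck_on_sum[OF S] Ck_on_mult[OF S] Ck_on_const[OF S] Ck_on_prod[OF S] assms(2)
      finite_permutations finite)

context
  fixes S :: "'a::euclidean_space set" and k :: nat
  assumes S: "open S"
begin

lemma Ck_on_alpha:
  fixes x :: "'a \<Rightarrow> ('n::{card2,linorder}) rvec"
  assumes "Ck_on k S x"
  shows "Ck_on k S (\<lambda>\<rho>. alpha r (x \<rho>))"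
proof -
  have "Ck_on k S (\<lambda>\<rho>. \<chi> j. if pos j = r then 1 else x \<rho> $ skip r (j::'n))"
  proof (rule Ck_on_vec_lambda[OF S])
    show "Ck_on k S (\<lambda>\<rho>. if pos j = r then 1 else x \<rho> $ skip r j)" for j :: 'n
      using Ck_on_const[OF S, of k "1::real"] Ck_on_vec_nth[OF S assms] by (cases "pos j = r") simp_all
  qed
  moreover have "alpha r (x \<rho>) = (\<chi> j. if pos j = r then 1 else x \<rho> $ skip r j)" for \<rho>
    by (simp add: Finite_Cartesian_Product.vec_eq_iff alpha_nth)
  ultimately show ?thesis by simp
qed

lemma Ck_on_brow:
  fixes x y :: "'a \<Rightarrow> ('n::{card2,linorder}) rvec"
  assumes "Ck_on k S x" "Ck_on k S y"
  shows "Ck_on k S (\<lambda>\<rho>. brow r (x \<rho>) (y \<rho>))"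
proof -
  have "Ck_on k S (\<lambda>\<rho>. x \<rho> \<bullet> y \<rho>)"
    by (rule Ck_on_bilinear[OF S bounded_bilinear_inner assms])
  then have i: "Ck_on k S (\<lambda>\<rho>. - (x \<rho> \<bullet> y \<rho>))"
    by (rule Ck_on_bounded_linear_comp[OF S bounded_linear_minus[OF bounded_linear_ident]])
  have "Ck_on k S (\<lambda>\<rho>. \<chi> j. if pos j = r then - (x \<rho> \<bullet> y \<rho>) else y \<rho> $ skip r (j::'n))"
  proof (rule Ck_on_vec_lambda[OF S])
    show "Ck_on k S (\<lambda>\<rho>. if pos j = r then - (x \<rho> \<bullet> y \<rho>) else y \<rho> $ skip r j)" for j :: 'n
      using i Ck_on_vec_nth[OF S assms(2)] by (cases "pos j = r") simp_all
  qed
  moreover have "brow r (x \<rho>) (y \<rho>) = (\<chi> j. if pos j = r then - (x \<rho> \<bullet> y \<rho>) else y \<rho> $ skip r j)" for \<rho>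
    by (simp add: Finite_Cartesian_Product.vec_eq_iff brow_nth)
  ultimately show ?thesis by simp
qed

lemma Ck_on_tensor:
  fixes p :: "'a \<Rightarrow> real^'m" and a :: "'a \<Rightarrow> real^'l"
  assumes "Ck_on k S p" "Ck_on k S a"
  shows "Ck_on k S (\<lambda>\<rho>. tensor (p \<rho>) (a \<rho>))"
  unfolding tensor_def
  by (rule Ck_on_vec_lambda[OF S] Ck_on_mult[OF S] Ck_on_vec_nth[OF S] assms)+

lemma Ck_on_beta:
  fixes x y z :: "'a \<Rightarrow> ('n::{card2,linorder}) rvec"
  assumes "Ck_on k S x" "Ck_on k S y" "Ck_on k S z"
  shows "Ck_on k S (\<lambda>\<rho>. beta r (x \<rho>) (y \<rho>) (z \<rho>))"
proof -
  have "Ck_on k S (\<lambda>\<rho>. \<chi> i::2. if i = 1 then brow r (x \<rho>) (y \<rho>) else brow r (x \<rho>) (z \<rho>))"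
  proof (rule Ck_on_vec_lambda[OF S])
    show "Ck_on k S (\<lambda>\<rho>. if i = 1 then brow r (x \<rho>) (y \<rho>) else brow r (x \<rho>) (z \<rho>))" for i :: 2
      using Ck_on_brow assms by (cases "i = 1") simp_all
  qed
  moreover have "beta r (x \<rho>) (y \<rho>) (z \<rho>) = (\<chi> i. if i = 1 then brow r (x \<rho>) (y \<rho>) else brow r (x \<rho>) (z \<rho>))" for \<rho>
    by (simp add: beta_def Finite_Cartesian_Product.vec_eq_iff forall_2)
  ultimately show ?thesis by simp
qed

lemma Ck_on_p_sol:
  fixes X :: "'a \<Rightarrow> nat \<Rightarrow> ('n::{card2,linorder}) rvec"
  assumes P: "\<And>i. Ck_on k S (\<lambda>\<rho>. P \<rho> i)" and X: "\<And>i. Ck_on k S (\<lambda>\<rho>. X \<rho> i)"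
    and nz: "\<And>\<rho>. \<rho> \<in> S \<Longrightarrow> Delta (X \<rho>) \<noteq> 0"
  shows "Ck_on k S (\<lambda>\<rho>. p_sol (P \<rho>) (X \<rho>) i)"
proof -
  have A: "Ck_on k S (\<lambda>\<rho>. alpha_mat (X \<rho>) $ j $ l)" for j l
    unfolding alpha_mat_def using Ck_on_vec_nth[OF S Ck_on_alpha[OF X]] by simp
  have R: "Ck_on k S (\<lambda>\<rho>. p_rhs (P \<rho>) (X \<rho>) c $ j)" for c j
  proof -
    have "Ck_on k S (\<lambda>\<rho>. \<Sum>i=CARD('n)+1..2 * CARD('n) + 1. P \<rho> i $ c * alpha (res CARD('n) i) (X \<rho> i) $ j)"
      by (intro Ck_on_sum[OF S] Ck_on_mult[OF S] Ck_on_vec_nth[OF S] P Ck_on_alpha X) simp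
    from Ck_on_bounded_linear_comp[OF S bounded_linear_minus[OF bounded_linear_ident] this]
    show ?thesis by (simp add: p_rhs_def)
  qed
  have "Ck_on k S (\<lambda>\<rho>. Determinants.det (alpha_mat (X \<rho>)))"
    by (rule Ck_on_det[OF S A])
  then have D: "Ck_on k S (\<lambda>\<rho>. inverse (Delta (X \<rho>)))"
    by (intro Ck_on_inverse[OF S] nz) (simp_all add: Delta_def alpha_mat_def)
  consider "i \<in> {1..CARD('n)}" | "i \<notin> {1..CARD('n)}" "i \<in> {CARD('n)+1..2 * CARD('n) + 1}"
    | "i \<notin> {1..CARD('n)}" "i \<notin> {CARD('n)+1..2 * CARD('n) + 1}" by blast
  then show ?thesis
  proof cases
    case 1
    have "Ck_on k S (\<lambda>\<rho>. \<chi> c. Determinants.det (\<chi> j l. if l = (elt i :: 'n) then p_rhs (P \<rho>) (X \<rho>) c $ j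
        else alpha_mat (X \<rho>) $ j $ l) * inverse (Delta (X \<rho>)))"
    proof (intro Ck_on_vec_lambda[OF S] Ck_on_mult[OF S] D Ck_on_det[OF S])
      fix c and j l :: 'n
      show "Ck_on k S (\<lambda>\<rho>. (\<chi> j l. if l = (elt i :: 'n) then p_rhs (P \<rho>) (X \<rho>) c $ j
        else alpha_mat (X \<rho>) $ j $ l) $ j $ l)"
        using A R by (cases "l = elt i") simp_all
    qed
    then show ?thesis using 1 by (simp only: p_sol_def if_True)
  next
    case 2
    then show ?thesis using P by (simp only: p_sol_def if_False if_True)
  next
    case 3
    then show ?thesis using Ck_on_const[OF S] by (simp only: p_sol_def if_False)
  qed
qed

lemma Ck_on_b_sum_nth:
  fixes X :: "'a \<Rightarrow> nat \<Rightarrow> ('n::{card2,linorder}) rvec"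
  assumes "finite I" "\<And>i. Ck_on k S (\<lambda>\<rho>. Y \<rho> i)" "\<And>i. Ck_on k S (\<lambda>\<rho>. X \<rho> i)"
  shows "Ck_on k S (\<lambda>\<rho>. b_sum I (X \<rho>) (Y \<rho>) $ j $ l)"
  unfolding b_sum_nth
  by (intro Ck_on_sum[OF S] Ck_on_mult[OF S] Ck_on_vec_nth[OF S] Ck_on_brow Ck_on_alpha assms)

lemma Ck_on_y_sol:
  fixes X :: "'a \<Rightarrow> nat \<Rightarrow> ('n::{card2,linorder}) rvec"
  assumes Y: "\<And>i. Ck_on k S (\<lambda>\<rho>. Y \<rho> i)" and X: "\<And>i. Ck_on k S (\<lambda>\<rho>. X \<rho> i)"
    and nz: "\<And>\<rho>. \<rho> \<in> S \<Longrightarrow> Tdet (X \<rho>) \<noteq> 0"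
  shows "Ck_on k S (\<lambda>\<rho>. y_sol (X \<rho>) (Y \<rho>) i)"
proof -
  let ?m = "(CARD('n))\<^sup>2 - 1"
  have A: "Ck_on k S (\<lambda>\<rho>. T_entry (X \<rho>) (l, c))" for l c
    unfolding T_entry_def using Ck_on_b_sum_nth[OF _ Ck_on_const[OF S] X] by simp
  have R: "Ck_on k S (\<lambda>\<rho>. - b_sum {CARD('n)+2..2 * CARD('n) + 1} (X \<rho>) (Y \<rho>) $ row_fst l $ row_snd l)" for l
    by (rule Ck_on_bounded_linear_comp[OF S bounded_linear_minus[OF bounded_linear_ident] Ck_on_b_sum_nth[OF _ Y X]]) simp
  have "Ck_on k S (\<lambda>\<rho>. Tdet (X \<rho>))"
    unfolding Tdet_eq T_mat_def by (rule Ck_on_det_mat[OF S]) (rule A)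
  then have D: "Ck_on k S (\<lambda>\<rho>. inverse (Tdet (X \<rho>)))"
    by (rule Ck_on_inverse[OF S]) (rule nz)
  have C: "Ck_on k S (\<lambda>\<rho>. Determinant.det (replace_col (T_mat (X \<rho>)) (y_rhs (X \<rho>) (Y \<rho>)) e))" for e
  proof -
    let ?f = "\<lambda>\<rho> (l, c). if c = e then - b_sum {CARD('n)+2..2 * CARD('n) + 1} (X \<rho>) (Y \<rho>) $ row_fst l $ row_snd l
      else T_entry (X \<rho>) (l, c)"
    have "Ck_on k S (\<lambda>\<rho>. Determinant.det (Matrix.mat ?m ?m (?f \<rho>)))"
    proof (rule Ck_on_det_mat[OF S])
      show "Ck_on k S (\<lambda>\<rho>. ?f \<rho> (l, c))" for l c
        using A R by (cases "c = e") simp_all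
    qed
    moreover have "replace_col (T_mat (X \<rho>)) (y_rhs (X \<rho>) (Y \<rho>)) e = Matrix.mat ?m ?m (?f \<rho>)" for \<rho>
      by (rule eq_matI) (auto simp: replace_col_def T_mat_def y_rhs_def)
    ultimately show ?thesis by simp
  qed
  consider "i \<in> {1..CARD('n)+1}" | "i \<notin> {1..CARD('n)+1}" "i \<in> {CARD('n)+2..2 * CARD('n) + 1}"
    | "i \<notin> {1..CARD('n)+1}" "i \<notin> {CARD('n)+2..2 * CARD('n) + 1}" by blast
  then show ?thesis
  proof cases
    case 1
    have "Ck_on k S (\<lambda>\<rho>. \<chi> l. Determinant.det (replace_col (T_mat (X \<rho>)) (y_rhs (X \<rho>) (Y \<rho>)) (col_of i (l :: 'n red))) *
        inverse (Tdet (X \<rho>)))"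
      by (intro Ck_on_vec_lambda[OF S] Ck_on_mult[OF S] C D)
    then show ?thesis using 1 by (simp only: y_sol_def if_True)
  next
    case 2
    then show ?thesis using Y by (simp only: y_sol_def if_False if_True)
  next
    case 3
    then show ?thesis using Ck_on_const[OF S] by (simp only: y_sol_def if_False)
  qed
qed

context
  fixes Uf :: "'a \<Rightarrow> ('n::{card2,linorder}) pspace"
  assumes Uf: "Ck_on k S Uf" and Uf_in: "\<And>\<rho>. \<rho> \<in> S \<Longrightarrow> Uf \<rho> \<in> calU"
begin

lemma Ck_on_X_of: "Ck_on k S (\<lambda>\<rho>. X_of (Uf \<rho>) i)"
  unfolding X_of_def by (intro Ck_on_vec_lambda[OF S] Ck_on_vec_nth[OF S] Uf)

lemma Ck_on_kappa: "Ck_on k S (\<lambda>\<rho>. kappa (Uf \<rho>) i)"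
  unfolding kappa_def by (intro Ck_on_vec_nth[OF S] Uf)

lemma Ck_on_y_all:
  assumes "\<And>i. Ck_on k S (\<lambda>\<rho>. Y \<rho> i)"
  shows "Ck_on k S (\<lambda>\<rho>. y_all (X_of (Uf \<rho>)) (Y \<rho>) i)"
proof (rule Ck_on_cong[OF S])
  have nz: "Tdet (X_of (Uf \<rho>)) \<noteq> 0" if "\<rho> \<in> S" for \<rho>
    using Uf_in[OF that] by (simp add: calU_def calV_def)
  then show "Ck_on k S (\<lambda>\<rho>. y_sol (X_of (Uf \<rho>)) (Y \<rho>) i)"
    by (intro Ck_on_y_sol assms Ck_on_X_of)
  show "y_sol (X_of (Uf \<rho>)) (Y \<rho>) i = y_all (X_of (Uf \<rho>)) (Y \<rho>) i" if "\<rho> \<in> S" for \<rho>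
    using y_all_eq_y_sol[OF nz[OF that]] by simp
qed

text \<open>Membership in \<open>calU\<close> keeps \<open>Delta\<close> and \<open>Tdet\<close>
  away from zero, so the closed formulas \<open>p_sol\<close> and \<open>y_sol\<close> apply at
  every point of \<open>S\<close>.\<close>

lemma Ck_on_gamma: "Ck_on k S (\<lambda>\<rho>. gamma (Uf \<rho>) i)"
proof -
  have nz: "Delta (X_of (Uf \<rho>)) \<noteq> 0" if "\<rho> \<in> S" for \<rho>
    using Uf_in[OF that] by (simp add: calU_def calV_def)
  have P: "Ck_on k S (\<lambda>\<rho>. P_of (Uf \<rho>) j)" for j
    unfolding P_of_def by (intro Ck_on_vec_lambda[OF S] Ck_on_vec_nth[OF S] Uf)
  have Y: "Ck_on k S (\<lambda>\<rho>. Y_of (Uf \<rho>) j)" "Ck_on k S (\<lambda>\<rho>. Z_of (Uf \<rho>) j)" for j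
    unfolding Y_of_def Z_of_def by (intro Ck_on_vec_lambda[OF S] Ck_on_vec_nth[OF S] Uf)+
  have p: "Ck_on k S (\<lambda>\<rho>. p_all (P_of (Uf \<rho>)) (X_of (Uf \<rho>)) i)"
    by (rule Ck_on_cong[OF S Ck_on_p_sol[OF P Ck_on_X_of nz]]) (simp_all add: p_all_eq_p_sol nz)
  have q: "Ck_on k S (\<lambda>\<rho>. qvec (Uf \<rho>))"
    unfolding qvec_def
  proof (rule Ck_on_vec_lambda[OF S])
    show "Ck_on k S (\<lambda>\<rho>. if pos j \<le> 2 then 1 else b_of (Uf \<rho>) (pos j - 2))" for j :: 'n
      using Ck_on_const[OF S, of k "1::real"] Ck_on_vec_nth[OF S Uf]
      by (cases "pos j \<le> 2") (simp_all add: b_of_def)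
  qed
  have a: "Ck_on k S (\<lambda>\<rho>. avec (Uf \<rho>) i)"
    unfolding avec_def by (intro Ck_on_alpha Ck_on_X_of)
  show ?thesis
    unfolding gamma_def svec_def Bmat_def
    by (intro Ck_on_Pair[OF S] Ck_on_tensor p a Ck_on_scaleR[OF S]
        Ck_on_bilinear[OF S bounded_bilinear_inner] q Ck_on_beta Ck_on_X_of Ck_on_y_all Y)
qed

end

end

lemma Ck_on_pi_map:
  assumes "open S" "Ck_on k S Uf" "\<And>\<rho>. \<rho> \<in> S \<Longrightarrow> Uf \<rho> \<in> calU"
  shows "Ck_on k S (pi_map Uf i)"
  unfolding pi_map_def[abs_def]
  by (intro Ck_on_add Ck_on_id Ck_on_sum Ck_on_gamma assms) simp

lemma Ck_on_z_map:
  assumes "open S" "Ck_on k S Uf" "\<And>\<rho>. \<rho> \<in> S \<Longrightarrow> Uf \<rho> \<in> calU"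
  shows "Ck_on k S (z_map Uf i)"
  unfolding z_map_def[abs_def]
  by (intro Ck_on_scaleR Ck_on_kappa Ck_on_gamma assms)

section \<open>Smoothness of F and its gradient\<close>

lemma Ck_on_Jmin: "Ck_on k UNIV (Jmin :: ('n::{card2,linorder}) mat2 \<Rightarrow> _)"
proof -
  note 1 = Ck_on_vec_nth[OF open_UNIV Ck_on_vec_nth[OF open_UNIV Ck_on_id[OF open_UNIV]]]
  have "Ck_on k UNIV (\<lambda>A :: 'n mat2. \<chi> m. A $ 1 $ fst (Rep_minor m) * A $ 2 $ snd (Rep_minor m) +
      (-1) * (A $ 1 $ snd (Rep_minor m) * A $ 2 $ fst (Rep_minor (m :: 'n minor))))"
    by (intro Ck_on_vec_lambda Ck_on_add Ck_on_mult Ck_on_const 1 open_UNIV)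
  then show ?thesis
    by (simp add: Jmin_def[abs_def] Let_def case_prod_beta)
qed

lemma Ck_on_F_of:
  fixes G :: "('n::{card2,linorder}) mat2 \<times> (real^'n minor) \<Rightarrow> real"
  assumes G: "smooth_on UNIV G" and \<zeta>: "smooth_on UNIV \<zeta>"
  shows "Ck_on k UNIV (F_of (F0_of \<epsilon> G) \<zeta> U\<^sub>0 H0)"
proof -
  note [simp] = open_UNIV
  have "Ck_on k UNIV (\<lambda>A :: 'n mat2. A \<bullet> A)"
    by (intro Ck_on_bilinear[OF _ bounded_bilinear_inner] Ck_on_id) simp_all
  then have 1: "Ck_on k UNIV (\<lambda>A :: 'n mat2. \<epsilon> / 2 * (norm A)\<^sup>2)"
    by (intro Ck_on_mult Ck_on_const) (simp_all add: power2_norm_eq_inner)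
  have "Ck_on k UNIV (\<lambda>A. G (A, Jmin A))"
    by (rule Ck_on_compose[where T=UNIV and g=G and f="\<lambda>A. (A, Jmin A)"])
      (use G Ck_on_Pair[OF open_UNIV Ck_on_id[OF open_UNIV] Ck_on_Jmin] in \<open>auto simp: smooth_on_def\<close>)
  then have F0: "Ck_on k UNIV (F0_of \<epsilon> G)"
    unfolding F0_of_def[abs_def] by (intro Ck_on_add 1) simp_all
  have V: "Ck_on k UNIV (\<lambda>A. Vfun \<zeta> H t (A - B))" for H t B
  proof -
    have d: "Ck_on k UNIV (\<lambda>A :: 'n mat2. A - B)"
      using Ck_on_add[OF _ Ck_on_id Ck_on_const, of UNIV k "- B"] by simp
    have e: "Ck_on k UNIV (\<lambda>A :: 'n mat2. (A - B) /\<^sub>R t)"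
      by (rule Ck_on_bounded_linear_comp[OF _ bounded_linear_scaleR_right d]) simp
    have "Ck_on k UNIV (\<lambda>A. \<zeta> ((A - B) /\<^sub>R t))"
      by (rule Ck_on_compose[where T=UNIV, OF _ _ e]) (use \<zeta> in \<open>auto simp: smooth_on_def\<close>)
    then show ?thesis
      unfolding Vfun_def
      by (intro Ck_on_mult Ck_on_const Ck_on_sum Ck_on_vec_nth d finite) simp_all
  qed
  show ?thesis
    unfolding F_of_def[abs_def] by (intro Ck_on_add F0 Ck_on_sum V) simp_all
qed

lemma Ck_on_grad:
  fixes f :: "'a::euclidean_space \<Rightarrow> real"
  assumes "open S" "Ck_on (Suc k) S f"
  shows "Ck_on k S (grad f)"
  unfolding grad_def[abs_def]
  by (intro Ck_on_sum Ck_on_scaleR Ck_on_const Ck_on_frechet_derivative assms finite_Basis)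


section \<open>Lower bounds for the kernels of derivatives\<close>

text \<open>By the chain rule the derivative of \<open>f\<close> vanishes wherever that of the inner
  map \<open>w\<close> does, and \<open>w\<close> takes values in a space of dimension
  \<open>DIM('b)\<close>.\<close>

lemma dim_kernel_derivative_ge:
  fixes w :: "'a::euclidean_space \<Rightarrow> 'b::euclidean_space" and f :: "'a \<Rightarrow> 'c::euclidean_space"
  assumes S: "open S" "\<rho> \<in> S" and w: "Ck_on 1 S w" and h: "Ck_on 1 UNIV h"
    and f: "(f has_derivative f') (at \<rho>)" and eq: "\<And>\<sigma>. \<sigma> \<in> S \<Longrightarrow> f \<sigma> = h (w \<sigma>)"
  shows "DIM('a) \<le> dim {v. f' v = 0} + DIM('b)"
proof -
  let ?w' = "frechet_derivative w (at \<rho>)" and ?h' = "frechet_derivative h (at (w \<rho>))"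
  have w': "(w has_derivative ?w') (at \<rho>)"
    using Ck_on_Suc_has_derivative w[unfolded One_nat_def] S(2) by blast
  moreover have h': "(h has_derivative ?h') (at (w \<rho>))"
    using Ck_on_Suc_has_derivative[OF h[unfolded One_nat_def]] by blast
  ultimately have "((\<lambda>x. h (w x)) has_derivative (\<lambda>v. ?h' (?w' v))) (at \<rho>)"
    by (rule has_derivative_compose)
  then have "(f has_derivative (\<lambda>v. ?h' (?w' v))) (at \<rho>)"
    by (rule has_derivative_transform_within_open[OF _ S]) (simp add: eq)
  then have "f' = (\<lambda>v. ?h' (?w' v))"
    by (rule has_derivative_unique[OF f])
  moreover have "?h' 0 = 0"
    using h' has_derivative_linear linear_0 by blast
  ultimately have "{v. ?w' v = 0} \<subseteq> {v. f' v = 0}" by auto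
  then have "dim {v. ?w' v = 0} \<le> dim {v. f' v = 0}" by (rule dim_subset)
  then show ?thesis
    using dim_kernel_ge[OF has_derivative_linear[OF w']] by linarith
qed

text \<open>The map factors through 2 + 3 (n - 1) = 3 n - 1 real parameters, and 4 n - (3 n - 1) = n
  + 1.\<close>

lemma dim_kernel_z_map:
  fixes Uf :: "('n::{card2,linorder}) space \<Rightarrow> 'n pspace"
  assumes S: "open S" "\<rho> \<in> S" and Uf: "Ck_on 1 S Uf" and Uf_in: "\<And>\<rho>. \<rho> \<in> S \<Longrightarrow> Uf \<rho> \<in> calU"
    and z': "(z_map Uf i has_derivative z') (at \<rho>)"
  shows "CARD('n) + 1 \<le> dim {v. z' v = 0}"
proof -
  define r where "r = res CARD('n) i"
  have r: "pos (elt r :: 'n) = r" unfolding r_def by (intro pos_elt res_in) simp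
  txt \<open>As \<open>\<alpha>\<^sub>r(x)\<^sub>r = 1\<close>, the components of \<open>w\<close> are \<open>\<kappa> p\<close>, \<open>x\<close>, \<open>\<kappa> s y\<close> and \<open>\<kappa> s z\<close>.\<close>
  define w :: "'n space \<Rightarrow> (real^2) \<times> 'n rvec \<times> 'n rvec \<times> 'n rvec" where
    "w \<sigma> = ((\<chi> c. fst (z_map Uf i \<sigma>) $ c $ elt r), X_of (Uf \<sigma>) i,
      (\<chi> k. snd (z_map Uf i \<sigma>) $ 1 $ unskip r k), (\<chi> k. snd (z_map Uf i \<sigma>) $ 2 $ unskip r k))" for \<sigma>
  \<comment> \<open>\<open>h\<close> rebuilds the value of \<open>z_map\<close> from these
    parameters. The scalar factors can be absorbed because \<open>tensor\<close> is linear in its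
    first argument and \<open>beta\<close> in its last two.\<close>
  define h :: "(real^2) \<times> 'n rvec \<times> 'n rvec \<times> 'n rvec \<Rightarrow> 'n space" where
    "h q = (tensor (fst q) (alpha r (fst (snd q))), beta r (fst (snd q)) (fst (snd (snd q))) (snd (snd (snd q))))" for q
  have z: "Ck_on 1 S (\<lambda>\<sigma>. fst (z_map Uf i \<sigma>))" "Ck_on 1 S (\<lambda>\<sigma>. snd (z_map Uf i \<sigma>))"
    using Ck_on_bounded_linear_comp[OF S(1) bounded_linear_fst] Ck_on_bounded_linear_comp[OF S(1) bounded_linear_snd]
      Ck_on_z_map[OF S(1) Uf Uf_in] by blast+
  have w: "Ck_on 1 S w"
    unfolding w_def[abs_def]
    by (intro Ck_on_Pair Ck_on_vec_lambda Ck_on_vec_nth z S(1) Ck_on_X_of Uf Uf_in)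
  have h: "Ck_on 1 UNIV h"
    unfolding h_def[abs_def]
    by (intro Ck_on_Pair Ck_on_tensor Ck_on_alpha Ck_on_beta open_UNIV Ck_on_bounded_linear
        bounded_linear_fst bounded_linear_snd bounded_linear_compose[OF bounded_linear_fst]
        bounded_linear_compose[OF bounded_linear_snd])
  have "z_map Uf i \<sigma> = h (w \<sigma>)" for \<sigma>
  proof -
    let ?U = "Uf \<sigma>"
    let ?x = "X_of ?U i" and ?p = "p_all (P_of ?U) (X_of ?U) i" and ?c = "kappa ?U i * svec ?U i"
    let ?y = "y_all (X_of ?U) (Y_of ?U) i" and ?y' = "y_all (X_of ?U) (Z_of ?U) i"
    have B: "Bmat ?U i $ 1 = brow r ?x ?y" "Bmat ?U i $ 2 = brow r ?x ?y'"
      by (simp_all add: Bmat_def beta_def r_def)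
    have "fst (w \<sigma>) = kappa ?U i *\<^sub>R ?p"
      by (simp add: w_def z_map_def gamma_def tensor_def avec_def r_def[symmetric] alpha_nth r
          Finite_Cartesian_Product.vec_eq_iff)
    moreover have "fst (snd (snd (w \<sigma>))) = ?c *\<^sub>R ?y" "snd (snd (snd (w \<sigma>))) = ?c *\<^sub>R ?y'"
      by (simp_all add: w_def z_map_def gamma_def B brow_nth pos_unskip_neq skip_unskip
          Finite_Cartesian_Product.vec_eq_iff)
    moreover have "fst (snd (w \<sigma>)) = ?x" by (simp add: w_def)
    moreover have "beta r ?x (?c *\<^sub>R ?y) (?c *\<^sub>R ?y') = ?c *\<^sub>R Bmat ?U i"
      by (simp add: Bmat_def r_def[symmetric] beta_def brow_scale Finite_Cartesian_Product.vec_eq_iff forall_2)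
    moreover have "tensor (kappa ?U i *\<^sub>R ?p) (alpha r ?x) = kappa ?U i *\<^sub>R tensor ?p (avec ?U i)"
      by (simp add: tensor_def avec_def r_def Finite_Cartesian_Product.vec_eq_iff)
    ultimately show ?thesis
      by (simp add: h_def z_map_def gamma_def)
  qed
  then have "DIM('n space) \<le> dim {v. z' v = 0} + DIM((real^2) \<times> 'n rvec \<times> 'n rvec \<times> 'n rvec)"
    by (intro dim_kernel_derivative_ge[OF S w h z'])
  then show ?thesis
    using one_less_card[where 'a='n] by (simp add: card_red)
qed

text \<open>A map into the graph of \<open>g\<close> is determined by its first component, which has
  only half as many coordinates.\<close>

lemma dim_kernel_graph:
  fixes \<xi> :: "'a::euclidean_space \<times> 'a \<Rightarrow> 'a \<times> 'a"
  assumes S: "open S" "\<rho> \<in> S" and \<xi>: "Ck_on 1 S \<xi>" and g: "Ck_on 1 UNIV g"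
    and \<xi>': "(\<xi> has_derivative \<xi>') (at \<rho>)" and eq: "\<And>\<sigma>. \<sigma> \<in> S \<Longrightarrow> snd (\<xi> \<sigma>) = g (fst (\<xi> \<sigma>))"
  shows "DIM('a) \<le> dim {v. \<xi>' v = 0}"
proof -
  have "DIM('a \<times> 'a) \<le> dim {v. \<xi>' v = 0} + DIM('a)"
  proof (rule dim_kernel_derivative_ge[OF S _ _ \<xi>'])
    show "Ck_on 1 S (\<lambda>\<sigma>. fst (\<xi> \<sigma>))"
      by (rule Ck_on_bounded_linear_comp[OF S(1) bounded_linear_fst \<xi>])
    show "Ck_on 1 UNIV (\<lambda>a. (a, g a))"
      by (intro Ck_on_Pair Ck_on_id g open_UNIV)
    show "\<xi> \<sigma> = (fst (\<xi> \<sigma>), g (fst (\<xi> \<sigma>)))" if "\<sigma> \<in> S" for \<sigma>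
      using eq[OF that] by (simp add: prod_eq_iff)
  qed
  then show ?thesis by simp
qed

section \<open>Openness of the union of the interpolating images\<close>

lemma xi_map_eq: "xi_map Uf i \<rho> = pi_map Uf i \<rho> + z_map Uf i \<rho>"
  by (simp add: xi_map_def pi_map_def z_map_def eta_def)

text \<open>The convex combination of \<open>xi_map\<close> and \<open>pi_map\<close> equals
  \<open>pi_map\<close> plus \<open>t\<close> times \<open>z_map\<close>. The unions are exchanged
  so that each index can be treated alone.\<close>

lemma SigmaSet_eq:
  fixes Uf :: "('n::{card2,linorder}) space \<Rightarrow> 'n pspace"
  shows "SigmaSet Uf r lam = (\<Union>i\<in>{1..2 * CARD('n) + 1}. \<Union>t\<in>{0..<lam}.
    (\<lambda>\<rho>. pi_map Uf i \<rho> + t *\<^sub>R z_map Uf i \<rho>) ` ball 0 r)"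
proof -
  have "t *\<^sub>R xi_map Uf i \<rho> + (1 - t) *\<^sub>R pi_map Uf i \<rho> = pi_map Uf i \<rho> + t *\<^sub>R z_map Uf i \<rho>" for t i \<rho>
    by (simp add: xi_map_eq algebra_simps)
  then show ?thesis
    unfolding SigmaSet_def by (simp only: Setcompr_eq_image) (rule SUP_commute)
qed

theorem proposition5p9:
  fixes U\<^sub>0 :: "('n::{card2,linorder}) pspace"
    and c :: "nat \<Rightarrow> real" and d :: "nat \<Rightarrow> real^'n minor"
    and \<epsilon> C\<^sub>0 R :: real
    and G :: "'n mat2 \<times> (real^'n minor) \<Rightarrow> real"
    and \<zeta> F\<^sub>0 F :: "'n mat2 \<Rightarrow> real"
    and H0 :: "nat \<Rightarrow> 'n tensor4"
    and N :: nat
    and W :: "'n space set"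
    and Uf :: "'n space \<Rightarrow> 'n pspace"
  assumes N: "N = 2 * CARD('n) + 1"
    and U0: "U\<^sub>0 \<in> calU"
    and cd: "\<forall>i\<in>{1..N}. \<forall>j\<in>{1..N}. i \<noteq> j \<longrightarrow>
          c j - c i > snd (eta U\<^sub>0 i) \<bullet> (fst (eta U\<^sub>0 j) - fst (eta U\<^sub>0 i))
                      + d i \<bullet> Jmin (fst (eta U\<^sub>0 j) - fst (eta U\<^sub>0 i))"
    and eps: "\<epsilon> > 0"
    and G_smooth: "smooth_on UNIV G"
    and G_convex: "convex_on UNIV G"
    and G_value: "\<forall>i\<in>{1..N}. G (fst (eta U\<^sub>0 i), Jmin (fst (eta U\<^sub>0 i))) = c i"
    and G_J: "\<forall>i\<in>{1..N}. grad (\<lambda>v. G (fst (eta U\<^sub>0 i), v)) (Jmin (fst (eta U\<^sub>0 i))) = d i"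
    and G_A: "\<forall>i\<in>{1..N}. grad (\<lambda>A. G (A, Jmin (fst (eta U\<^sub>0 i)))) (fst (eta U\<^sub>0 i)) =
          snd (eta U\<^sub>0 i) - \<epsilon> *\<^sub>R fst (eta U\<^sub>0 i) - vDJ (d i) (fst (eta U\<^sub>0 i))"
    and F0: "F\<^sub>0 = F0_of \<epsilon> G"
    and zeta: "cutoff \<zeta> C\<^sub>0"
    and H0: "\<forall>j\<in>{1..N}. sym_tensor (H0 j)"
    and F: "F = F_of F\<^sub>0 \<zeta> U\<^sub>0 H0"
    and Jacobian: "Determinant.det (dPsi_dU F 0 U\<^sub>0) \<noteq> 0"
    and H_small: "(\<Sum>j = 1..N. norm (Htilde F\<^sub>0 U\<^sub>0 H0 j)) < \<epsilon> / (2 * C\<^sub>0)"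
    and R: "R > 0"
    and W: "open W" "cball 0 R \<subseteq> W"
    and Uf_smooth: "smooth_on W Uf"
    and Uf_in: "\<forall>\<rho>\<in>cball 0 R. Uf \<rho> \<in> calU"
    and Uf_0: "Uf 0 = U\<^sub>0"
    and Uf_Psi: "\<forall>\<rho>\<in>cball 0 R. \<forall>i\<in>{1..N}. Psi F \<rho> (Uf \<rho>) i = 0"
    and Dpi_nz: "\<forall>i\<in>{1..N}. \<forall>\<rho>\<in>cball 0 R. Determinant.det (Dpi Uf i \<rho>) \<noteq> 0"
    and pi_open: "\<forall>i\<in>{1..N}. open (pi_map Uf i ` ball 0 R)"
    and xi_disjoint: "\<forall>i\<in>{1..N}. \<forall>j\<in>{1..N}. i \<noteq> j \<longrightarrow>
          (fst \<circ> xi_map Uf i) ` cball 0 R \<inter> (fst \<circ> xi_map Uf j) ` cball 0 R = {}"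
    and pi_disjoint: "\<forall>i\<in>{1..N}. \<forall>j\<in>{1..N}. i \<noteq> j \<longrightarrow>
          (fst \<circ> pi_map Uf i) ` cball 0 R \<inter> (fst \<circ> pi_map Uf j) ` cball 0 R = {}"
    and nondeg: "\<forall>i\<in>{1..N}. nondegenerate Uf i"
  shows "\<forall>\<^sub>F r in at_right 0. \<forall>lam. 0 < lam \<and> lam \<le> 1 \<longrightarrow> open (SigmaSet Uf r lam)"
proof -
  let ?S = "ball 0 R :: 'n space set"
  have S: "open ?S" and S_W: "?S \<subseteq> W"
    using W(2) ball_subset_cball by auto
  have U: "Ck_on 1 ?S Uf"
    using Ck_on_subset[OF _ S_W] Uf_smooth unfolding smooth_on_def by blast
  have U_in: "Uf \<rho> \<in> calU" if "\<rho> \<in> ?S" for \<rho>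
    using Uf_in that by simp
  \<comment> \<open>Two derivatives of \<open>F\<close> make \<open>grad F\<close> continuously
    differentiable, as the graph argument requires.\<close>
  have "Ck_on (Suc 1) UNIV F"
    unfolding F F0 using G_smooth zeta unfolding cutoff_def by (intro Ck_on_F_of) auto
  then have grad_F: "Ck_on 1 UNIV (grad F)" by (rule Ck_on_grad[OF open_UNIV])
  define \<Sigma> where "\<Sigma> i r lam =
    (\<Union>t\<in>{0..<lam}. (\<lambda>\<rho>. pi_map Uf i \<rho> + t *\<^sub>R z_map Uf i \<rho>) ` ball 0 r)" for i and r lam :: real
  \<comment> \<open>The neighbourhood \<open>B\<close> is chosen before \<open>r\<close> and
    \<open>lam\<close>; this makes the final bound on \<open>r\<close> uniform in
    \<open>lam\<close>.\<close>
  have ex: "\<exists>B :: 'n space set. open B \<and> 0 \<in> B \<and> (\<forall>r lam. ball 0 r \<subseteq> B \<longrightarrow> lam \<le> 1 \<longrightarrow> open (\<Sigma> i r lam))"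
    if i: "i \<in> {1..N}" for i
  proof -
    interpret unfolding_pencil "pi_map Uf i" "z_map Uf i" ?S
    proof
      show "Ck_on 1 ?S (pi_map Uf i)" "Ck_on 1 ?S (z_map Uf i)"
        by (intro Ck_on_pi_map Ck_on_z_map S U U_in; assumption)+
      show "Determinant.det (lin_mat (frechet_derivative (pi_map Uf i) (at \<rho>))) \<noteq> 0" if "\<rho> \<in> ?S" for \<rho>
        using Dpi_nz i that unfolding Dpi_def by simp
    qed (rule S)
    have M: "M \<rho> = Mmat Uf i \<rho>" for \<rho>
      by (simp add: M_def Mmat_def)
    let ?D = "[:0, 1:] ^ (CARD('n) + 1) * [:1, 1:] ^ (2 * CARD('n)) :: real poly"
    have D_dvd: "?D dvd char_poly (M \<rho>)" if \<rho>: "\<rho> \<in> ?S" for \<rho>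
    proof (rule coprime_linear_powers_dvd)
      let ?L = "inv_into UNIV (Dp \<rho>) \<circ> Dz \<rho>"
      note Dp_inj = bij_is_inj[OF bij_Dp[OF \<rho>]]
      have inv_0: "inv_into UNIV (Dp \<rho>) 0 = 0"
        using linear_0[OF linear_inv_Dp[OF \<rho>]] .
      \<comment> \<open>The kernel of \<open>Dz\<close> lies in the eigenspace of \<open>M\<close>
        for the eigenvalue 0.\<close>
      have "{v. Dz \<rho> v = 0} \<subseteq> {v. ?L v = 0 *\<^sub>R v}" using inv_0 by auto
      from order_trans[OF dim_kernel_z_map[OF S \<rho> U U_in has_derivative_z[OF \<rho>]] dim_subset[OF this]]
      have "CARD('n) + 1 \<le> dim {v. ?L v = 0 *\<^sub>R v}" .
      from power_dvd_char_poly_if_eigenspace_dim[OF linear_M[OF \<rho>] this]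
      show "[:0, 1:] ^ (CARD('n) + 1) dvd char_poly (M \<rho>)" unfolding M_def minus_zero .
      have xi': "(xi_map Uf i has_derivative (\<lambda>v. Dp \<rho> v + Dz \<rho> v)) (at \<rho>)"
        using has_derivative_add[OF has_derivative_p[OF \<rho>] has_derivative_z[OF \<rho>]]
        unfolding xi_map_eq[abs_def] .
      have xi: "Ck_on 1 ?S (xi_map Uf i)"
        unfolding xi_map_eq[abs_def] by (intro Ck_on_add S p_C1 z_C1)
      \<comment> \<open>The equation \<open>Psi = 0\<close> says that \<open>xi_map\<close> takes
        its values in the graph of \<open>grad F\<close>.\<close>
      have graph: "snd (xi_map Uf i \<sigma>) = grad F (fst (xi_map Uf i \<sigma>))" if "\<sigma> \<in> ?S" for \<sigma>
        using Uf_Psi i that by (simp add: Psi_def Phi_def xi_map_def case_prod_beta)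
      have "DIM('n mat2) \<le> dim {v. Dp \<rho> v + Dz \<rho> v = 0}"
        by (rule dim_kernel_graph[OF S \<rho> xi grad_F xi' graph])
      \<comment> \<open>Applying the inverse of \<open>Dp\<close> to \<open>Dz v = - Dp v\<close>
        exhibits \<open>v\<close> as an eigenvector of \<open>M\<close>, or zero, for the eigenvalue
        -1.\<close>
      moreover have "{v. Dp \<rho> v + Dz \<rho> v = 0} \<subseteq> {v. ?L v = (- 1) *\<^sub>R v}"
      proof
        fix v assume "v \<in> {v. Dp \<rho> v + Dz \<rho> v = 0}"
        then have "Dz \<rho> v = - Dp \<rho> v" by (simp add: add_eq_0_iff)
        also have "\<dots> = Dp \<rho> (- v)" by (rule linear_neg[OF linear_Dp[OF \<rho>], symmetric])
        finally have "Dz \<rho> v = Dp \<rho> (- v)" .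
        then show "v \<in> {v. ?L v = (- 1) *\<^sub>R v}" using inv_f_f[OF Dp_inj] by simp
      qed
      ultimately have "2 * CARD('n) \<le> dim {v. ?L v = (- 1) *\<^sub>R v}"
        using dim_subset[of "{v. Dp \<rho> v + Dz \<rho> v = 0}" "{v. ?L v = (- 1) *\<^sub>R v}"] by simp
      from power_dvd_char_poly_if_eigenspace_dim[OF linear_M[OF \<rho>] this]
      show "[:1, 1:] ^ (2 * CARD('n)) dvd char_poly (M \<rho>)" unfolding M_def minus_minus .
    qed
    have nd: "nondegenerate Uf i" using nondeg i by blast
    have Q: "char_poly (M \<rho>) div ?D = Qpoly Uf i \<rho>" for \<rho>
      by (simp only: Qpoly_def M)
    have dim: "DIM('n space) = 4 * CARD('n)" by simp
    have zero: "0 \<in> ?S" using R by simp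
    obtain B where B: "open B" "0 \<in> B" "\<forall>t\<in>{0..<1}. \<forall>\<rho>\<in>B. regular_at t \<rho>"
    proof -
      have "\<exists>B. open B \<and> 0 \<in> B \<and> (\<forall>t\<in>{0..<1}. \<forall>\<rho>\<in>B. regular_at t \<rho>)"
      proof (rule regular_near_zero[OF zero refl D_dvd])
        show "poly (char_poly (M 0) div ?D) (- 1) \<noteq> 0"
          using nd unfolding Q nondegenerate_def by blast
        show "adj_mat (x \<cdot>\<^sub>m 1\<^sub>m DIM('n space) - M 0) *\<^sub>v (adj_mat (lin_mat (Dp 0)) *\<^sub>v coord_vec (z_map Uf i 0))
            \<noteq> 0\<^sub>v DIM('n space)"
          if "x < - 1" "poly (char_poly (M 0) div ?D) x = 0" for x
        proof -
          have "x \<in> Eset Uf i 0" using that unfolding Q Eset_def by simp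
          moreover have "\<forall>x0\<in>Eset Uf i 0. adj_mat (x0 \<cdot>\<^sub>m 1\<^sub>m (4 * CARD('n)) - Mmat Uf i 0) *\<^sub>v
              (adj_mat (Dpi Uf i 0) *\<^sub>v coord_vec (z_map Uf i 0)) \<noteq> 0\<^sub>v (4 * CARD('n))"
            using nd unfolding nondegenerate_def by (elim conjE)
          ultimately show ?thesis unfolding dim M Dpi_def by (rule bspec[rotated])
        qed
      qed
      then show ?thesis using that by blast
    qed
    show ?thesis
    proof (intro exI[of _ "B \<inter> ?S"] conjI allI impI)
      fix r lam :: real assume r: "ball 0 r \<subseteq> B \<inter> ?S" and lam: "lam \<le> 1"
      show "open (\<Sigma> i r lam)"
        unfolding \<Sigma>_def using B(3) r lam by (intro open_family_image) auto
    qed (use B S zero in auto)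
  qed
  then obtain B :: "nat \<Rightarrow> 'n space set" where B: "\<And>i. i \<in> {1..N} \<Longrightarrow> open (B i)" "\<And>i. i \<in> {1..N} \<Longrightarrow> 0 \<in> B i"
    "\<And>i r lam. i \<in> {1..N} \<Longrightarrow> ball 0 r \<subseteq> B i \<Longrightarrow> lam \<le> 1 \<Longrightarrow> open (\<Sigma> i r lam)"
    by metis
  have "open (\<Inter>i\<in>{1..N}. B i)" by (rule open_INT) (use B(1) in blast)+
  moreover have "0 \<in> (\<Inter>i\<in>{1..N}. B i)" using B(2) by blast
  ultimately obtain e where e: "e > 0" "ball 0 e \<subseteq> (\<Inter>i\<in>{1..N}. B i)"
    by (rule openE)
  have "open (SigmaSet Uf r lam)" if r: "r < e" and lam: "lam \<le> 1" for r lam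
  proof -
    have "ball 0 r \<subseteq> B i" if i: "i \<in> {1..N}" for i
    proof -
      have "ball 0 r \<subseteq> (ball 0 e :: 'n space set)" using r by (intro subset_ball) simp
      also have "\<dots> \<subseteq> B i" using e(2) i by blast
      finally show ?thesis .
    qed
    then have "open (\<Union>i\<in>{1..N}. \<Sigma> i r lam)"
      using B(3) lam by (intro open_UN ballI) simp
    then show ?thesis unfolding SigmaSet_eq \<Sigma>_def N .
  qed
  then show ?thesis
    unfolding eventually_at_right_field using e(1) by blast
qed

end
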